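(* Let $l_0,l_1,l_2,l_3\in\mathbb{Z}_{\ge 0}$, not all zero, and $l=l_0+l_1+l_2+l_3$. For $E\in\mathbb{C}$ with $Q(E)\neq 0$, let $\{-t_j\}_{j=1,\dots,l}$ be the set of zeros of the solution $\tilde\Lambda(x,E)$ (as in the context). (a) If $\alpha=-\sum_{j=1}^{l}t_j+\sum_{k=1}^3 l_k\omega_k\not\equiv 0 \pmod{2\omega_1\mathbb{Z}\oplus 2\omega_3\mathbb{Z}}$, then $$\tilde\Lambda(x,E)=\exp(\kappa x)\left(\sum_{i=0}^3\sum_{j=0}^{l_i-1}\tilde b^{(i)}_j\left(\frac{d}{dx}\right)^j\Phi_i(x,\alpha)\right)$$ for some constants $\tilde b^{(i)}_j$ ($i=0,\dots,3$, $j=0,\dots,l_i-1$). Moreover, the values $\alpha$ and $\kappa$ are expressed as $$\wp(\alpha)=\frac{P_1(E)}{P_2(E)},\qquad \wp'(\alpha)=\frac{P_3(E)}{P_4(E)}\sqrt{-Q(E)},\qquad \kappa=\frac{P_5(E)}{P_6(E)}\sqrt{-Q(E)},$$ where $P_1(E),\dots,P_6(E)$ are polynomials in $E$. (b) If $\alpha=-\sum_{j=1}^{l}t_j+\sum_{k=1}^3 l_k\omega_k\equiv 0\pmod{2\omega_1\mathbb{Z}\oplus 2\omega_3\mathbb{Z}}$, then $$\tilde\Lambda(x,E)=\exp(\bar\kappa x)\left(\bar c+\sum_{i=0}^3\sum_{j=0}^{l_i-2}\bar b^{(i)}_j\left(\frac{d}{dx}\right)^j\wp(x+\omega_i)+\sum_{k=1}^3\bar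 c_k\frac{\wp'(x)}{\wp(x)-e_k}\right)$$ for some constants $\bar c$, $\bar c_k$ ($k=1,2,3$), $\bar b^{(i)}_j$ ($i=0,\dots,3$, $j=0,\dots,l_i-2$).
   Context: Let $2\omega_1,2\omega_3\in\mathbb{C}$ be linearly independent over $\mathbb{R}$, $\omega_0=0$, $\omega_2=-\omega_1-\omega_3$; $\wp,\zeta,\sigma$ are the Weierstrass functions with basic periods $(2\omega_1,2\omega_3)$, $e_k=\wp(\omega_k)$, $\eta_k=\zeta(\omega_k)$, and $\sigma_k(x)=e^{-\eta_k x}\sigma(x+\omega_k)/\sigma(\omega_k)$ ($k=1,2,3$). Hamiltonian: $H=-\frac{d^2}{dx^2}+\sum_{i=0}^3 l_i(l_i+1)\wp(x+\omega_i)$. $\Xi(x,E)$: it is known that the third-order equation satisfied by products of pairs of solutions of $(H-E)f=0$, namely $\left(\frac{d^3}{dx^3}-4\left(\sum_i l_i(l_i+1)\wp(x+\omega_i)-E\right)\frac{d}{dx}-2\sum_i l_i(l_i+1)\wp'(x+\omega_i)\right)h=0$, has a nonzero doubly periodic solution $\Xi(x,E)=c_0(E)+\sum_{i=0}^3\sum_{j=0}^{l_i-1}b^{(i)}_j(E)\wp(x+\omega_i)^{l_i-j}$, where $c_0,b_j^{(i)}$ are polynomials in $E$ without common divisor, $c_0$ is monic, and $\deg b_j^{(i)}<g:=\deg c_0$. $Q(E)=\Xi^2\left(E-\sum_i l_i(l_i+1)\wp(x+\omega_i)\right)+\frac12\Xi\frac{d^2\Xi}{dx^2}-\frac14\left(\frac{d\Xi}{dx}\right)^2$;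 it is independent of $x$ and is a monic polynomial in $E$ of degree $2g+1$. $t_j$, $\tilde\Lambda$, $\alpha$, $\kappa$: for $Q(E)\ne0$ one can write $\Xi(x,E)=C_E\prod_{j=1}^l(\wp(x)-\wp(t_j))/\prod_{k=1}^3(\wp(x)-e_k)^{l_k}$ with $C_E\neq0$ a constant, and $\pm t_j,\omega_i$ ($j=1,\dots,l$, $i=0,\dots,3$) are mutually distinct modulo $2\omega_1\mathbb{Z}\oplus2\omega_3\mathbb{Z}$. Viewing $\Xi$ as a rational function of $z=\wp(x)$, the signs of the $t_j$ are fixed by $\left(\frac{d\Xi}{dz}\right)_{z=\wp(t_j)}=-\frac{2\sqrt{-Q(E)}}{\wp'(t_j)}$ (with a fixed choice of $\sqrt{-Q(E)}$). Then $$\tilde\Lambda(x,E)=\frac{\prod_{j=1}^l\sigma(x+t_j)}{\sigma(x)^{l_0}\sigma_1(x)^{l_1}\sigma_2(x)^{l_2}\sigma_3(x)^{l_3}\prod_{j=1}^l\sigma(t_j)}\exp\left(-x\sum_{j=1}^l\zeta(t_j)\right)$$ solves $(H-E)f=0$. Put $\alpha=-\sum_j t_j+\sum_{k=1}^3 l_k\omega_k$ and, if $\alpha\not\equiv0$, $\kappa=\zeta\left(\sum_j t_j-\sum_{k=1}^3 l_k\omega_k\right)-\sum_j\zeta(t_j)+\sum_{k=1}^3 l_k\eta_k$. If $\alpha\equiv 0$, one chooses the representatives $t_j$ modulo $2\omega_1\mathbb{Z}\oplus2\omega_3\mathbb{Z}$ so that $\alpha=0$ exactly, and puts $\bar\kappa=-\sum_j\zeta(t_j)+\sum_{k=1}^3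 l_k\eta_k$. $\Phi_i(x,\alpha)=\frac{\sigma(x+\omega_i-\alpha)}{\sigma(x+\omega_i)}\exp(\zeta(\alpha)x)$ for $i=0,1,2,3$. Empty sums are zero. *)

theory Defs
  imports "HOL-Complex_Analysis.Complex_Analysis"
begin

text \<open>Weierstrass functions for the basic periods \<open>(2\<omega>1, 2\<omega>3)\<close>. All the functions below are total;
  their values at poles are artefacts of division by zero and are never used.\<close>

context
  fixes \<omega>1 \<omega>3 :: complex
begin

definition period_lattice :: "complex set" where
  "period_lattice = {2 * of_int m * \<omega>1 + 2 * of_int n * \<omega>3 | m n :: int. True}"

definition half_period :: "nat \<Rightarrow> complex" where
  "half_period i =
     (if i = 1 then \<omega>1 else if i = 2 then - \<omega>1 - \<omega>3 else if i = 3 then \<omega>3 else 0)"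

text \<open>The points congruent to one of the \<open>\<omega>\<^sub>i\<close>: outside this set every function of \<open>x\<close> occurring in
  the theory is holomorphic, so identities of meromorphic functions are stated there.\<close>
definition half_points :: "complex set" where
  "half_points = {x. \<exists>i\<le>3. x - half_period i \<in> period_lattice}"

definition wp :: "complex \<Rightarrow> complex" where
  "wp z = 1 / z ^ 2 + (\<Sum>\<^sub>\<infinity>w\<in>period_lattice - {0}. 1 / (z - w) ^ 2 - 1 / w ^ 2)"

definition wzeta :: "complex \<Rightarrow> complex" where
  "wzeta z = 1 / z + (\<Sum>\<^sub>\<infinity>w\<in>period_lattice - {0}. 1 / (z - w) + 1 / w + z / w ^ 2)"

text \<open>\<open>weierstrass_factor 2 u = (1 - u) exp (u + u\<^sup>2/2)\<close>; the product over the lattice is the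
  unordered one.\<close>
definition wsigma :: "complex \<Rightarrow> complex" where
  "wsigma z = z * Lim (finite_subsets_at_top (period_lattice - {0}))
                    (\<lambda>F. \<Prod>w\<in>F. weierstrass_factor 2 (z / w))"

definition e_val :: "nat \<Rightarrow> complex" where
  "e_val k = wp (half_period k)"

definition eta_val :: "nat \<Rightarrow> complex" where
  "eta_val k = wzeta (half_period k)"

definition cosigma :: "nat \<Rightarrow> complex \<Rightarrow> complex" where
  "cosigma k x = exp (- eta_val k * x) * wsigma (x + half_period k) / wsigma (half_period k)"

definition Phi :: "nat \<Rightarrow> complex \<Rightarrow> complex \<Rightarrow> complex" where
  "Phi i \<alpha> x = wsigma (x + half_period i - \<alpha>) / wsigma (x + half_period i) * exp (wzeta \<alpha> * x)"

context
  fixes l :: "nat \<Rightarrow> nat"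
begin

text \<open>Only \<open>l 0, \<dots>, l 3\<close> are used.\<close>
definition l_total :: nat where
  "l_total = (\<Sum>i\<le>3. l i)"

definition potential :: "complex \<Rightarrow> complex" where
  "potential x = (\<Sum>i\<le>3. of_nat (l i * (l i + 1)) * wp (x + half_period i))"

text \<open>The coefficients of the solution are polynomials in \<open>E\<close>; \<open>b i j\<close> is used for \<open>i \<le> 3\<close>,
  \<open>j < l i\<close>.\<close>
definition Xi :: "complex poly \<Rightarrow> (nat \<Rightarrow> nat \<Rightarrow> complex poly) \<Rightarrow> complex \<Rightarrow> complex \<Rightarrow> complex" where
  "Xi c0 b E x =
     poly c0 E + (\<Sum>i\<le>3. \<Sum>j<l i. poly (b i j) E * wp (x + half_period i) ^ (l i - j))"

text \<open>The doubly periodic solution of the third-order equation of products of pairs of solutions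
  of \<open>(H - E) f = 0\<close>, with its normalisation. The disjunct \<open>b i j = 0\<close> stands for the convention
  that the zero polynomial has degree \<open>-\<infinity>\<close>.\<close>
definition is_Xi :: "complex poly \<Rightarrow> (nat \<Rightarrow> nat \<Rightarrow> complex poly) \<Rightarrow> bool" where
  "is_Xi c0 b \<longleftrightarrow>
     lead_coeff c0 = 1 \<and>
     (\<forall>i\<le>3. \<forall>j<l i. b i j = 0 \<or> degree (b i j) < degree c0) \<and>
     (\<forall>d. d dvd c0 \<and> (\<forall>i\<le>3. \<forall>j<l i. d dvd b i j) \<longrightarrow> is_unit d) \<and>
     (\<forall>E x. x \<notin> half_points \<longrightarrow>
        (deriv ^^ 3) (Xi c0 b E) x
        - 4 * (potential x - E) * deriv (Xi c0 b E) x
        - 2 * (\<Sum>i\<le>3. of_nat (l i * (l i + 1)) * deriv wp (x + half_period i)) * Xi c0 b E x = 0)"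

text \<open>As a polynomial, \<open>Q\<close> is determined by these values.\<close>
definition is_Q :: "complex poly \<Rightarrow> (nat \<Rightarrow> nat \<Rightarrow> complex poly) \<Rightarrow> complex poly \<Rightarrow> bool" where
  "is_Q c0 b Q \<longleftrightarrow>
     (\<forall>E x. x \<notin> half_points \<longrightarrow>
        poly Q E = (Xi c0 b E x) ^ 2 * (E - potential x)
                   + 1 / 2 * Xi c0 b E x * (deriv ^^ 2) (Xi c0 b E) x
                   - 1 / 4 * (deriv (Xi c0 b E) x) ^ 2)"

text \<open>\<open>\<Xi>\<close> as a rational function of \<open>z = \<wp>(x)\<close>.\<close>
definition Xi_rational :: "complex \<Rightarrow> (nat \<Rightarrow> complex) \<Rightarrow> complex \<Rightarrow> complex" where
  "Xi_rational C t z = C * (\<Prod>j=1..l_total. z - wp (t j)) / (\<Prod>k=1..3. (z - e_val k) ^ l k)"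

text \<open>The choice of \<open>t\<^sub>1, \<dots>, t\<^sub>l\<close> at the eigenvalue \<open>E\<close>, where \<open>s\<close> is the chosen square root of
  \<open>- Q(E)\<close>. The conditions modulo the lattice say that all \<open>\<plusminus>t\<^sub>j\<close> and \<open>\<omega>\<^sub>i\<close> are mutually distinct:
  \<open>t i + t j \<notin> period_lattice\<close> with \<open>i = j\<close> allowed separates \<open>t\<^sub>i\<close> from \<open>-t\<^sub>j\<close>; the \<open>\<omega>\<^sub>i\<close> are
  distinct by linear independence of the periods, and \<open>-\<omega>\<^sub>i\<close> is congruent to \<open>\<omega>\<^sub>i\<close>.\<close>
definition is_zero_system ::
  "complex poly \<Rightarrow> (nat \<Rightarrow> nat \<Rightarrow> complex poly) \<Rightarrow> complex \<Rightarrow> complex \<Rightarrow> (nat \<Rightarrow> complex) \<Rightarrow> bool" where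
  "is_zero_system c0 b E s t \<longleftrightarrow>
     (\<forall>i\<in>{1..l_total}. \<forall>j\<in>{1..l_total}.
        t i + t j \<notin> period_lattice \<and> (i \<noteq> j \<longrightarrow> t i - t j \<notin> period_lattice)) \<and>
     (\<forall>j\<in>{1..l_total}. t j \<notin> half_points) \<and>
     (\<exists>C. C \<noteq> 0 \<and>
        (\<forall>x. x \<notin> half_points \<longrightarrow> Xi c0 b E x = Xi_rational C t (wp x)) \<and>
        (\<forall>j\<in>{1..l_total}. deriv (Xi_rational C t) (wp (t j)) = - 2 * s / deriv wp (t j)))"

definition Lambda_tilde :: "(nat \<Rightarrow> complex) \<Rightarrow> complex \<Rightarrow> complex" where
  "Lambda_tilde t x =
     (\<Prod>j=1..l_total. wsigma (x + t j))
       / (wsigma x ^ l 0 * (\<Prod>k=1..3. cosigma k x ^ l k) * (\<Prod>j=1..l_total. wsigma (t j)))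
     * exp (- x * (\<Sum>j=1..l_total. wzeta (t j)))"

definition alpha :: "(nat \<Rightarrow> complex) \<Rightarrow> complex" where
  "alpha t = - (\<Sum>j=1..l_total. t j) + (\<Sum>k=1..3. of_nat (l k) * half_period k)"

definition kappa_bar :: "(nat \<Rightarrow> complex) \<Rightarrow> complex" where
  "kappa_bar t = - (\<Sum>j=1..l_total. wzeta (t j)) + (\<Sum>k=1..3. of_nat (l k) * eta_val k)"

definition kappa :: "(nat \<Rightarrow> complex) \<Rightarrow> complex" where
  "kappa t = wzeta ((\<Sum>j=1..l_total. t j) - (\<Sum>k=1..3. of_nat (l k) * half_period k))
     - (\<Sum>j=1..l_total. wzeta (t j)) + (\<Sum>k=1..3. of_nat (l k) * eta_val k)"

end

end

end

theory Submission
  imports Defs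
begin

text \<open>Up to a constant and an exponential factor, \<open>\<Lambda>\<close> is
  \<open>\<Prod>\<^sub>j \<sigma>(x + t\<^sub>j) / \<Prod>\<^sub>i \<sigma>(x + \<omega>\<^sub>i)\<^bsup>l\<^sub>i\<^esup>\<close>. An entire function with the quasi-periods of a translate of
  \<open>\<sigma>\<close> is a multiple of that translate. Hence a function with multiplicative quasi-periods and poles
  in the half periods is exhausted by removing its poles one order at a time with derivatives of the
  \<open>\<Phi>\<^sub>i\<close>, or of \<open>\<wp>\<close> and \<open>\<wp>'/(\<wp> - e\<^sub>k)\<close> when the quasi-periods are trivial; this gives both expansions.

  For the rationality let \<open>s\<^sup>2 = -Q(E)\<close>. The elliptic function \<open>G\<close> with zeros \<open>-t\<^sub>j\<close>, \<open>-\<alpha>\<close> and poles of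
  order \<open>l\<^sub>i\<close> at \<open>\<omega>\<^sub>i\<close>, one order more at \<open>0\<close>, is determined up to a scalar by the existence of an
  elliptic function \<open>T\<close>, with one more order at every half period, such that \<open>G (\<Xi>' + 2 s) = \<Xi> T\<close>:
  the factor \<open>\<Xi>' + 2 s\<close> vanishes at the zeros \<open>t\<^sub>j\<close> of \<open>\<Xi>\<close> but not at the zeros \<open>-t\<^sub>j\<close>. The even and
  odd parts of this equation are linear equations in the coefficients of \<open>G\<close> and \<open>T\<close> whose
  coefficients are polynomials in \<open>E\<close>, so that a single kernel vector polynomial in \<open>E\<close> serves all
  \<open>E\<close>. The expansions of \<open>G\<close> and \<open>T\<close> at \<open>0\<close> yield \<open>\<kappa>\<close>, \<open>\<wp>(\<alpha>)\<close>, \<open>\<wp>'(\<alpha>)\<close> as rational functions of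
  \<open>E\<close> and \<open>s\<close> whose denominator is the leading coefficient of \<open>G\<close>, nonzero as \<open>\<alpha>\<close> is not a period.
  The substitution \<open>(s, t) \<mapsto> (-s, -t)\<close> decides which part in \<open>s\<close> survives.\<close>


section \<open>The period lattice\<close>

text \<open>The polynomials \<open>P1\<close> to \<open>P6\<close> must serve every admissible E at
  once, with denominators that vanish at none of them, whereas a kernel vector found for generic E
  may vanish at special ones. What helps is that at each admissible E the kernel is a line, the same
  for both roots s: any polynomial vector that is nonzero at E yields a nonzero multiple of G there,
  and nothing has to be known about which multiple it is. The equation for T comes from the solution
  itself. The quotient (\<Xi>' + 2 s) / \<Xi> is twice the logarithmic derivative of \<Lambda> up to
  an additive constant, and G is \<Lambda> stripped of its exponential and multiplied by S(x +
  \<alpha>) / S(x), the simplest factor that makes it elliptic. Hence (T - 2 G') / (2 G) is Z(x) -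
  Z(x + \<alpha>) plus a constant. This difference, regular at 0 once Z(x) is split off, carries
  \<open>P \<alpha>\<close> and \<open>deriv P \<alpha>\<close> in its Taylor coefficients, while
  \<kappa> is seen in the logarithmic derivative of G. All uniqueness statements rest on Liouville's
  theorem together with division by sigma.\<close>

locale period_pair =
  fixes \<omega>1 \<omega>3 :: complex
  assumes distinct_periods: "\<omega>1 \<noteq> \<omega>3" and independent_periods: "independent {2 * \<omega>1, 2 * \<omega>3}"
begin

abbreviation "Lat \<equiv> period_lattice \<omega>1 \<omega>3"
abbreviation "hp \<equiv> half_period \<omega>1 \<omega>3"
abbreviation "Hpts \<equiv> half_points \<omega>1 \<omega>3"
abbreviation "P \<equiv> wp \<omega>1 \<omega>3"
abbreviation "Z \<equiv> wzeta \<omega>1 \<omega>3"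
abbreviation "S \<equiv> wsigma \<omega>1 \<omega>3"

lemma Lat_iff: "z \<in> Lat \<longleftrightarrow> (\<exists>m n::int. z = 2 * of_int m * \<omega>1 + 2 * of_int n * \<omega>3)"
  by (auto simp: period_lattice_def)

lemma Lat_0 [simp, intro]: "0 \<in> Lat"
  unfolding Lat_iff by (intro exI[of _ 0]) simp

lemma Lat_add: "a \<in> Lat \<Longrightarrow> b \<in> Lat \<Longrightarrow> a + b \<in> Lat"
  unfolding Lat_iff
proof (elim exE)
  fix m n m' n' :: int
  assume "a = 2 * of_int m * \<omega>1 + 2 * of_int n * \<omega>3" "b = 2 * of_int m' * \<omega>1 + 2 * of_int n' * \<omega>3"
  then show "\<exists>m n::int. a + b = 2 * of_int m * \<omega>1 + 2 * of_int n * \<omega>3"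
    by (intro exI[of _ "m + m'"] exI[of _ "n + n'"]) (simp add: algebra_simps)
qed

lemma Lat_uminus: "a \<in> Lat \<Longrightarrow> - a \<in> Lat"
  unfolding Lat_iff
proof (elim exE)
  fix m n :: int
  assume "a = 2 * of_int m * \<omega>1 + 2 * of_int n * \<omega>3"
  then show "\<exists>m n::int. - a = 2 * of_int m * \<omega>1 + 2 * of_int n * \<omega>3"
    by (intro exI[of _ "- m"] exI[of _ "- n"]) (simp add: algebra_simps)
qed

lemma Lat_uminus_iff [simp]: "- a \<in> Lat \<longleftrightarrow> a \<in> Lat"
  using Lat_uminus[of a] Lat_uminus[of "- a"] by auto

lemma Lat_diff: "a \<in> Lat \<Longrightarrow> b \<in> Lat \<Longrightarrow> a - b \<in> Lat"
  using Lat_add[of a "- b"] by simp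

lemma Lat_add_iff [simp]: "b \<in> Lat \<Longrightarrow> a + b \<in> Lat \<longleftrightarrow> a \<in> Lat"
  using Lat_add[of a b] Lat_diff[of "a + b" b] by auto

lemma Lat_add_iff' [simp]: "b \<in> Lat \<Longrightarrow> b + a \<in> Lat \<longleftrightarrow> a \<in> Lat"
  using Lat_add_iff[of b a] by (simp add: add.commute)

lemma Lat_diff_iff [simp]: "b \<in> Lat \<Longrightarrow> a - b \<in> Lat \<longleftrightarrow> a \<in> Lat"
  using Lat_add_iff[of "- b" a] by simp

lemma Lat_diff_iff' [simp]: "b \<in> Lat \<Longrightarrow> b - a \<in> Lat \<longleftrightarrow> a \<in> Lat"
  using Lat_add_iff'[of b "- a"] by simp

lemma Lat_minus_commute: "a - b \<in> Lat \<longleftrightarrow> b - a \<in> Lat"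
  using Lat_uminus_iff[of "a - b"] by simp

lemma Lat_of_nat_mult: "a \<in> Lat \<Longrightarrow> of_nat n * a \<in> Lat"
  by (induction n) (auto simp: algebra_simps)

lemma two_\<omega>1_in_Lat: "2 * \<omega>1 \<in> Lat"
  unfolding Lat_iff by (rule exI[of _ 1], rule exI[of _ 0]) simp

lemma two_\<omega>3_in_Lat: "2 * \<omega>3 \<in> Lat"
  unfolding Lat_iff by (rule exI[of _ 0], rule exI[of _ 1]) simp

lemma \<omega>1_nonzero: "\<omega>1 \<noteq> 0"
proof
  assume "\<omega>1 = 0"
  hence "0 \<in> {2 * \<omega>1, 2 * \<omega>3}" by simp
  from dependent_zero[OF this] show False using independent_periods by contradiction
qed

text \<open>Signed area of the parallelogram on \<omega>1 and \<omega>3. Its nonvanishing is the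
  form in which linear independence of the periods enters the estimates.\<close>

definition area :: real where "area = Im (cnj \<omega>1 * \<omega>3)"

lemma area_nonzero: "area \<noteq> 0"
proof
  assume "area = 0"
  define r where "r = Re (cnj \<omega>1 * \<omega>3) / (norm \<omega>1)^2"
  have "cnj \<omega>1 * \<omega>3 = of_real (Re (cnj \<omega>1 * \<omega>3))"
    using \<open>area = 0\<close> by (simp add: area_def complex_eq_iff)
  also have "\<dots> = of_real r * (of_real (norm \<omega>1))^2"
    using \<omega>1_nonzero by (simp add: r_def)
  also have "\<dots> = cnj \<omega>1 * (of_real r * \<omega>1)"
    by (metis complex_norm_square mult.assoc mult.commute of_real_power)
  finally have "\<omega>3 = of_real r * \<omega>1"
    using \<omega>1_nonzero by simp
  hence "2 * \<omega>3 = r *\<^sub>R (2 * \<omega>1)"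
    by (simp add: scaleR_conv_of_real)
  hence "2 * \<omega>3 \<in> span {2 * \<omega>1}"
    by (metis singletonI span_base span_scale)
  moreover have "independent (insert (2 * \<omega>3) {2 * \<omega>1})"
    using independent_periods by (simp add: insert_commute)
  ultimately show False
    using distinct_periods by (auto simp: independent_insert)
qed

text \<open>Cramer's rule: multiplying \<open>w\<close> by the conjugate of one period makes the
  contribution of that period real, so the imaginary part isolates the other coordinate.\<close>

lemma lattice_coordinates:
  fixes a b :: real
  defines "w \<equiv> 2 * of_real a * \<omega>1 + 2 * of_real b * \<omega>3"
  shows "2 * a * area = - Im (cnj \<omega>3 * w)" "2 * b * area = Im (cnj \<omega>1 * w)"
  unfolding w_def area_def by (simp_all add: algebra_simps)

definition lattice_const :: real where
  "lattice_const = 2 * \<bar>area\<bar> / (norm \<omega>1 + norm \<omega>3)"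

lemma lattice_const_pos: "lattice_const > 0"
  using area_nonzero \<omega>1_nonzero by (auto simp: lattice_const_def intro!: divide_pos_pos add_pos_nonneg)

lemma norm_ge_lattice_const:
  fixes a b :: real
  shows "norm (2 * of_real a * \<omega>1 + 2 * of_real b * \<omega>3) \<ge> lattice_const * max \<bar>a\<bar> \<bar>b\<bar>"
proof -
  let ?w = "2 * of_real a * \<omega>1 + 2 * of_real b * \<omega>3"
  let ?N = "norm \<omega>1 + norm \<omega>3"
  have N: "?N > 0" using \<omega>1_nonzero by (simp add: add_pos_nonneg)
  have "2 * \<bar>a\<bar> * \<bar>area\<bar> = \<bar>Im (cnj \<omega>3 * ?w)\<bar>"
    using lattice_coordinates(1)[of a b] by (metis abs_minus_cancel abs_mult abs_numeral)
  also have "\<dots> \<le> norm (cnj \<omega>3 * ?w)" by (rule abs_Im_le_cmod)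
  also have "\<dots> \<le> ?N * norm ?w" by (simp add: norm_mult mult_right_mono)
  finally have 1: "2 * \<bar>a\<bar> * \<bar>area\<bar> \<le> ?N * norm ?w" .
  have "2 * \<bar>b\<bar> * \<bar>area\<bar> = \<bar>Im (cnj \<omega>1 * ?w)\<bar>"
    using lattice_coordinates(2)[of b a] by (metis abs_mult abs_numeral)
  also have "\<dots> \<le> norm (cnj \<omega>1 * ?w)" by (rule abs_Im_le_cmod)
  also have "\<dots> \<le> ?N * norm ?w" by (simp add: norm_mult mult_right_mono)
  finally have 2: "2 * \<bar>b\<bar> * \<bar>area\<bar> \<le> ?N * norm ?w" .
  have "2 * \<bar>area\<bar> * max \<bar>a\<bar> \<bar>b\<bar> \<le> ?N * norm ?w"
    using 1 2 by (auto simp: max_def mult_ac)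
  thus ?thesis using N by (simp add: lattice_const_def field_simps)
qed

lemma norm_ge_lattice_const_int:
  "norm (2 * of_int m * \<omega>1 + 2 * of_int n * \<omega>3) \<ge> lattice_const * max \<bar>of_int m\<bar> \<bar>of_int n\<bar>"
  using norm_ge_lattice_const[of "of_int m" "of_int n"] by simp

abbreviation lattice_point :: "int \<times> int \<Rightarrow> complex" where
  "lattice_point \<equiv> \<lambda>(m, n). 2 * of_int m * \<omega>1 + 2 * of_int n * \<omega>3"

lemma Lat_eq_range: "Lat = range lattice_point"
  by (auto simp: period_lattice_def)

lemma lattice_point_eq_0_iff: "lattice_point p = 0 \<longleftrightarrow> p = (0, 0)"
proof
  assume *: "lattice_point p = 0"
  obtain m n where p: "p = (m, n)" by force
  have "lattice_const * max \<bar>of_int m\<bar> \<bar>of_int n\<bar> \<le> 0"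
    using norm_ge_lattice_const_int[of m n] * p by simp
  hence "max \<bar>of_int m\<bar> \<bar>of_int n :: real\<bar> \<le> 0"
    using lattice_const_pos by (simp add: mult_le_0_iff)
  thus "p = (0, 0)" using p by (auto simp: max_def split: if_splits)
qed auto

lemma inj_lattice_point: "inj lattice_point"
proof (rule injI)
  fix p q :: "int \<times> int"
  assume "lattice_point p = lattice_point q"
  hence "lattice_point (fst p - fst q, snd p - snd q) = 0"
    by (auto simp: algebra_simps split: prod.splits)
  thus "p = q" unfolding lattice_point_eq_0_iff by (auto simp: prod_eq_iff)
qed

lemma finite_Lat_bounded: "finite {w \<in> Lat. norm w \<le> R}"
proof -
  let ?k = "\<lceil>R / lattice_const\<rceil>"
  have "{w \<in> Lat. norm w \<le> R} \<subseteq> lattice_point ` ({- ?k..?k} \<times> {- ?k..?k})"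
  proof
    fix w assume "w \<in> {w \<in> Lat. norm w \<le> R}"
    then obtain m n where w: "w = lattice_point (m, n)" "norm w \<le> R"
      by (auto simp: Lat_iff)
    have "lattice_const * max \<bar>of_int m\<bar> \<bar>of_int n\<bar> \<le> R"
      using norm_ge_lattice_const_int[of m n] w by simp
    hence "max \<bar>of_int m\<bar> \<bar>of_int n\<bar> \<le> R / lattice_const"
      using lattice_const_pos by (subst pos_le_divide_eq) (simp_all add: mult.commute)
    hence "\<bar>m\<bar> \<le> ?k" "\<bar>n\<bar> \<le> ?k" by linarith+
    thus "w \<in> lattice_point ` ({- ?k..?k} \<times> {- ?k..?k})" using w by (intro image_eqI[of _ _ "(m, n)"]) auto
  qed
  thus ?thesis by (rule finite_subset) auto
qed

lemma countable_Lat: "countable Lat"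
  unfolding Lat_eq_range by auto

section \<open>Absolute convergence of the lattice sums\<close>

lemma summable_on_int_powr: "(\<lambda>m::int. (1 + \<bar>of_int m\<bar> :: real) powr (- (3 / 2))) summable_on (UNIV :: int set)"
proof -
  have "summable (\<lambda>n. real (n + 1) powr (- (3 / 2)))"
    by (subst summable_iff_shift, subst summable_real_powr_iff) auto
  hence "(\<lambda>n::nat. real (n + 1) powr (- (3 / 2))) summable_on UNIV"
    by (intro summable_nonneg_imp_summable_on) auto
  hence *: "(\<lambda>n::nat. (1 + real n) powr (- (3 / 2))) summable_on UNIV"
    by (simp add: add_ac)
  let ?f = "\<lambda>m::int. (1 + \<bar>of_int m\<bar> :: real) powr (- (3 / 2))"
  have "?f summable_on (range int)"
    by (subst summable_on_reindex) (use * in \<open>auto simp: o_def\<close>)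
  moreover have "?f summable_on (range (\<lambda>n. - int n))"
    by (subst summable_on_reindex) (use * in \<open>auto simp: o_def inj_on_def\<close>)
  ultimately have "?f summable_on (range int \<union> range (\<lambda>n. - int n))"
    by (subst Un_Diff_cancel[symmetric], intro summable_on_Un_disjoint)
       (auto intro: summable_on_subset_banach)
  moreover have "range int \<union> range (\<lambda>n. - int n) = UNIV"
  proof (intro equalityI subsetI UNIV_I)
    fix m :: int
    show "m \<in> range int \<union> range (\<lambda>n. - int n)"
      by (cases m rule: int_cases2) auto
  qed
  ultimately show ?thesis by simp
qed

text \<open>With M = max |m| |n| a lattice point has norm at least a constant times M. Both 1 + |m|
  and 1 + |n| are at most 2 M, so M^-3 is dominated by a product of two one-dimensional terms with
  exponent -3/2, each of which is summable.\<close>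

lemma summable_lattice: "(\<lambda>w. 1 / norm w ^ 3) summable_on (Lat - {0})"
proof -
  define g :: "int \<Rightarrow> real" where "g = (\<lambda>m. (1 + \<bar>of_int m\<bar>) powr (- (3 / 2)))"
  have g_sum: "g summable_on UNIV" unfolding g_def by (rule summable_on_int_powr)
  have g_nonneg: "g m \<ge> 0" for m by (simp add: g_def)
  have "(\<lambda>p. g (fst p) * g (snd p)) summable_on (UNIV \<times> UNIV)"
  proof (rule summable_on_SigmaI[where g = "\<lambda>m. g m * (\<Sum>\<^sub>\<infinity>n. g n)"])
    fix m :: int
    have "((\<lambda>n. g m * g n) has_sum (g m * (\<Sum>\<^sub>\<infinity>n. g n))) UNIV"
      by (rule has_sum_cmult_right[OF has_sum_infsum[OF g_sum]])
    thus "((\<lambda>n. g (fst (m, n)) * g (snd (m, n))) has_sum (g m * (\<Sum>\<^sub>\<infinity>n. g n))) UNIV"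
      by (simp only: fst_conv snd_conv)
  next
    show "(\<lambda>m. g m * (\<Sum>\<^sub>\<infinity>n. g n)) summable_on UNIV"
      by (rule summable_on_cmult_left[OF g_sum])
  next
    fix m n :: int
    show "g (fst (m, n)) * g (snd (m, n)) \<ge> 0" by (intro mult_nonneg_nonneg g_nonneg)
  qed
  hence "(\<lambda>p. g (fst p) * g (snd p)) summable_on (UNIV - {(0,0)})"
    by (rule summable_on_subset_banach) (simp only: UNIV_Times_UNIV subset_UNIV)
  hence "(\<lambda>p. 8 / lattice_const ^ 3 * (g (fst p) * g (snd p))) summable_on (UNIV - {(0,0)})"
    by (rule summable_on_cmult_right)
  hence "(\<lambda>p. 1 / norm (lattice_point p) ^ 3) summable_on (UNIV - {(0,0)})"
  proof (rule summable_on_comparison_test)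
    fix p :: "int \<times> int" assume p: "p \<in> UNIV - {(0,0)}"
    obtain m n where mn: "p = (m, n)" by force
    define M where "M = max \<bar>of_int m\<bar> \<bar>of_int n :: real\<bar>"
    have M1: "M \<ge> 1" using p mn by (auto simp: M_def max_def)
    have *: "norm (lattice_point p) \<ge> lattice_const * M"
      using norm_ge_lattice_const_int[of m n] mn by (simp add: M_def)
    have pos: "lattice_const * M > 0" using M1 lattice_const_pos by simp
    have g: "g k \<ge> (2 * M) powr (- (3 / 2))" if "\<bar>of_int k\<bar> \<le> M" for k
      unfolding g_def using that M1 by (intro powr_mono2') auto
    have "(2 * M) powr (- (3 / 2)) * (2 * M) powr (- (3 / 2)) \<le> g m * g n"
      by (intro mult_mono g) (auto simp: M_def g_nonneg)
    moreover have "(2 * M) powr (- (3 / 2)) * (2 * M) powr (- (3 / 2)) = 1 / (2 * M) ^ 3"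
      using M1 powr_realpow[of "2 * M" 3] by (simp add: powr_add[symmetric] powr_minus_divide)
    ultimately have gg: "1 / (2 * M) ^ 3 \<le> g m * g n" by simp
    have "1 / norm (lattice_point p) ^ 3 \<le> 1 / (lattice_const * M) ^ 3"
      using * pos less_le_trans[OF pos *]
      by (intro divide_left_mono power_mono mult_pos_pos[of "_ ^ 3"] zero_less_power) simp_all
    also have "\<dots> = 8 / lattice_const ^ 3 * (1 / (2 * M) ^ 3)"
      by (simp add: power_mult_distrib)
    also have "\<dots> \<le> 8 / lattice_const ^ 3 * (g m * g n)"
      using gg lattice_const_pos by (intro mult_left_mono) auto
    finally show "1 / norm (lattice_point p) ^ 3 \<le> 8 / lattice_const ^ 3 * (g (fst p) * g (snd p))"
      by (simp add: mn)
  qed auto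
  hence "(\<lambda>w. 1 / norm w ^ 3) summable_on (lattice_point ` (UNIV - {(0,0)}))"
    by (subst summable_on_reindex) (auto simp: o_def intro: inj_on_subset[OF inj_lattice_point])
  moreover have "lattice_point ` (UNIV - {(0,0)}) = Lat - {0}"
    using inj_lattice_point
    by (subst image_set_diff) (auto simp: Lat_eq_range)
  ultimately show ?thesis by simp
qed

end

section \<open>The Weierstrass functions\<close>

lemma higher_deriv_sum:
  fixes z :: complex
  assumes "finite A" "\<And>a. a \<in> A \<Longrightarrow> f a holomorphic_on U" "open U" "z \<in> U"
  shows "(deriv ^^ n) (\<lambda>w. \<Sum>a\<in>A. f a w) z = (\<Sum>a\<in>A. (deriv ^^ n) (f a) z)"
  using assms(1,2)
proof (induction A rule: finite_induct)
  case empty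
  have "(deriv ^^ n) (\<lambda>w. 0 :: complex) z = 0" by (induction n arbitrary: z) (simp_all add: funpow_Suc_right del: funpow.simps)
  thus ?case by simp
next
  case (insert a A)
  have "(deriv ^^ n) (\<lambda>w. f a w + (\<Sum>a\<in>A. f a w)) z = (deriv ^^ n) (f a) z + (deriv ^^ n) (\<lambda>w. \<Sum>a\<in>A. f a w) z"
    by (rule higher_deriv_add[OF _ _ assms(3,4)]) (use insert in \<open>auto intro!: holomorphic_intros\<close>)
  thus ?case using insert by simp
qed

text \<open>Writing each derivative as \<open>f a z * g a\<close> turns the product rule into a sum
  of the \<open>g a\<close> without dividing by factors that may be zero.\<close>

lemma has_field_derivative_prod_log:
  fixes f :: "'b \<Rightarrow> complex \<Rightarrow> complex"
  assumes "finite A" "\<And>a. a \<in> A \<Longrightarrow> (f a has_field_derivative f a z * g a) (at z)"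
  shows "((\<lambda>z. \<Prod>a\<in>A. f a z) has_field_derivative (\<Prod>a\<in>A. f a z) * (\<Sum>a\<in>A. g a)) (at z)"
  using assms
proof (induction A rule: finite_induct)
  case (insert a A)
  have "((\<lambda>z. f a z * (\<Prod>a\<in>A. f a z)) has_field_derivative
     f a z * g a * (\<Prod>a\<in>A. f a z) + (\<Prod>a\<in>A. f a z) * (\<Sum>a\<in>A. g a) * f a z) (at z)"
    by (rule DERIV_mult) (use insert in auto)
  thus ?case using insert by (simp add: algebra_simps)
qed auto

lemma deriv_eq_on_open:
  assumes "open U" "z \<in> U" "\<And>w. w \<in> U \<Longrightarrow> f w = g w"
  shows "deriv f z = deriv g z"
  by (rule deriv_cong_ev) (use assms in \<open>auto simp: eventually_nhds\<close>)

context period_pair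
begin

text \<open>On the ball of radius R a lattice point of norm at least 2 R gives |z / w| at most 1/2,
  where the Weierstrass factor is close enough to 1 to have a principal logarithm. Apart from the
  origin, only the finitely many \<open>small_points\<close> can contribute zeros or poles in the
  ball.\<close>

definition large_points :: "real \<Rightarrow> complex set" where
  "large_points R = {w \<in> Lat. norm w \<ge> 2 * R}"

definition small_points :: "real \<Rightarrow> complex set" where
  "small_points R = {w \<in> Lat - {0}. norm w < 2 * R}"

lemma finite_small_points [simp]: "finite (small_points R)"
  by (rule finite_subset[OF _ finite_Lat_bounded[of "2 * R"]]) (auto simp: small_points_def)

lemma small_large_points:
  assumes "R > 0"
  shows "small_points R \<union> large_points R = Lat - {0}" "small_points R \<inter> large_points R = {}"
  using assms by (auto simp: small_points_def large_points_def)

text \<open>One family of logarithms serves all three functions: its successive derivatives are the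
  summands of zeta and, up to sign, those of wp and wp'.\<close>

definition log_factor :: "complex \<Rightarrow> complex \<Rightarrow> complex" where
  "log_factor w z = Ln (weierstrass_factor 2 (z / w))"

lemma weierstrass_factor_near_1:
  assumes R: "R > 0" and w: "w \<in> large_points R" and z: "z \<in> ball 0 R"
  shows "norm (weierstrass_factor 2 (z / w) - 1) \<le> 3 * R ^ 3 / norm w ^ 3"
    "norm (weierstrass_factor 2 (z / w) - 1) < 1 / 2"
    "w \<noteq> 0" "z \<noteq> w"
proof -
  have w': "norm w \<ge> 2 * R" "norm w > 0" using w R by (auto simp: large_points_def)
  have "norm (z / w) \<le> R / (2 * R)"
    unfolding norm_divide using w' R z by (intro frac_le) auto
  hence half: "norm (z / w) \<le> 1 / 2" using R by simp
  have b: "norm (weierstrass_factor 2 (z / w) - 1) \<le> 3 * norm (z / w) ^ 3"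
    using weierstrass_factor_bound[OF half, of 2] by (simp add: numeral_3_eq_3)
  also have "\<dots> \<le> 3 * (R ^ 3 / norm w ^ 3)"
    unfolding norm_divide power_divide using w' R z by (intro mult_left_mono divide_right_mono power_mono) auto
  finally show "norm (weierstrass_factor 2 (z / w) - 1) \<le> 3 * R ^ 3 / norm w ^ 3" by simp
  have "3 * norm (z / w) ^ 3 \<le> 3 * (1 / 2) ^ 3"
    using half by (intro mult_left_mono power_mono) auto
  with b show "norm (weierstrass_factor 2 (z / w) - 1) < 1 / 2" by (simp add: power3_eq_cube)
  show "w \<noteq> 0" "z \<noteq> w" using w' z R by auto
qed

lemma weierstrass_factor_Re_pos:
  assumes "R > 0" "w \<in> large_points R" "z \<in> ball 0 R"
  shows "Re (weierstrass_factor 2 (z / w)) > 0"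
proof -
  have "\<bar>Re (weierstrass_factor 2 (z / w) - 1)\<bar> < 1 / 2"
    using abs_Re_le_cmod weierstrass_factor_near_1(2)[OF assms] by (rule le_less_trans)
  thus ?thesis by (simp add: abs_if split: if_splits)
qed

lemma weierstrass_factor_derivative:
  assumes "w \<noteq> 0" "z \<noteq> w"
  shows "((\<lambda>z. weierstrass_factor 2 (z / w)) has_field_derivative
           weierstrass_factor 2 (z / w) * (1 / (z - w) + 1 / w + z / w ^ 2)) (at z)"
proof -
  have *: "weierstrass_factor 2 u = (1 - u) * exp (u + u ^ 2 / 2)" for u
    by (simp add: weierstrass_factor_def numeral_2_eq_2)
  have zw: "z - w \<noteq> 0" using assms by simp
  have "(1 - z / w) * (1 / (z - w) + 1 / w + z / w ^ 2) = - 1 / w + (1 - z / w) * (1 / w + z / w ^ 2)"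
    using assms zw by (simp add: divide_simps) algebra
  hence e: "weierstrass_factor 2 (z / w) * (1 / (z - w) + 1 / w + z / w ^ 2) =
     (- 1 / w) * exp (z / w + (z / w) ^ 2 / 2) + (1 - z / w) * (exp (z / w + (z / w) ^ 2 / 2) * (1 / w + z / w ^ 2))"
    unfolding * by algebra
  show ?thesis unfolding e unfolding *
    by (rule derivative_eq_intros refl | simp add: assms)+ (simp add: assms field_simps power2_eq_square)
qed

lemma log_factor_derivative:
  assumes "R > 0" "w \<in> large_points R" "z \<in> ball 0 R"
  shows "(log_factor w has_field_derivative (1 / (z - w) + 1 / w + z / w ^ 2)) (at z)"
proof -
  note n = weierstrass_factor_near_1[OF assms]
  have nz: "weierstrass_factor 2 (z / w) \<notin> \<real>\<^sub>\<le>\<^sub>0"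
    using weierstrass_factor_Re_pos[OF assms] by (auto simp: complex_nonpos_Reals_iff)
  have nz': "weierstrass_factor 2 (z / w) \<noteq> 0" using nz by auto
  have "(Ln has_field_derivative inverse (weierstrass_factor 2 (z / w))) (at (weierstrass_factor 2 (z / w)))"
    by (rule has_field_derivative_Ln[OF nz])
  from DERIV_chain2[OF this weierstrass_factor_derivative[OF n(3,4)]]
  have "((\<lambda>z. Ln (weierstrass_factor 2 (z / w))) has_field_derivative
     inverse (weierstrass_factor 2 (z / w)) *
     (weierstrass_factor 2 (z / w) * (1 / (z - w) + 1 / w + z / w ^ 2))) (at z)" .
  moreover have "inverse (weierstrass_factor 2 (z / w)) *
     (weierstrass_factor 2 (z / w) * (1 / (z - w) + 1 / w + z / w ^ 2)) = 1 / (z - w) + 1 / w + z / w ^ 2"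
    using nz' by (simp only: mult.assoc[symmetric] left_inverse[OF nz'] mult_1_left)
  moreover have "log_factor w = (\<lambda>z. Ln (weierstrass_factor 2 (z / w)))"
    by (rule ext) (simp add: log_factor_def)
  ultimately show ?thesis by simp
qed

lemma log_factor_holomorphic:
  assumes "R > 0" "w \<in> large_points R"
  shows "log_factor w holomorphic_on ball 0 R"
  unfolding holomorphic_on_open[OF open_ball] using log_factor_derivative[OF assms] by blast

lemma log_factor_derivs:
  assumes "R > 0" "w \<in> large_points R" "z \<in> ball 0 R"
  shows "deriv (log_factor w) z = 1 / (z - w) + 1 / w + z / w ^ 2"
    "(deriv ^^ 2) (log_factor w) z = 1 / w ^ 2 - 1 / (z - w) ^ 2"
    "(deriv ^^ 3) (log_factor w) z = 2 / (z - w) ^ 3"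
proof -
  have 1: "deriv (log_factor w) z = 1 / (z - w) + 1 / w + z / w ^ 2" if "z \<in> ball 0 R" for z
    by (rule DERIV_imp_deriv log_factor_derivative assms that)+
  have 2: "deriv (deriv (log_factor w)) z = 1 / w ^ 2 - 1 / (z - w) ^ 2" if z: "z \<in> ball 0 R" for z
  proof -
    have "deriv (deriv (log_factor w)) z = deriv (\<lambda>z. 1 / (z - w) + 1 / w + z / w ^ 2) z"
      by (rule deriv_eq_on_open[OF open_ball z 1])
    also have "\<dots> = 1 / w ^ 2 - 1 / (z - w) ^ 2"
      using weierstrass_factor_near_1(3,4)[OF assms(1,2) z]
      by (intro DERIV_imp_deriv) (auto intro!: derivative_eq_intros simp: power2_eq_square)
    finally show ?thesis .
  qed
  have 3: "deriv (deriv (deriv (log_factor w))) z = 2 / (z - w) ^ 3" if z: "z \<in> ball 0 R" for z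
  proof -
    have "deriv (deriv (deriv (log_factor w))) z = deriv (\<lambda>z. 1 / w ^ 2 - 1 / (z - w) ^ 2) z"
      by (rule deriv_eq_on_open[OF open_ball z 2])
    also have "\<dots> = 2 / (z - w) ^ 3"
      using weierstrass_factor_near_1(3,4)[OF assms(1,2) z]
      by (intro DERIV_imp_deriv)
         ((rule derivative_eq_intros refl | simp)+, simp add: power2_eq_square power3_eq_cube power4_eq_xxxx divide_simps, (algebra)?)
    finally show ?thesis .
  qed
  show "deriv (log_factor w) z = 1 / (z - w) + 1 / w + z / w ^ 2"
    "(deriv ^^ 2) (log_factor w) z = 1 / w ^ 2 - 1 / (z - w) ^ 2"
    "(deriv ^^ 3) (log_factor w) z = 2 / (z - w) ^ 3"
    using 1 2 3 assms(3) by (simp_all add: numeral_2_eq_2 numeral_3_eq_3)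
qed

definition log_tail :: "real \<Rightarrow> complex \<Rightarrow> complex" where
  "log_tail R z = (\<Sum>\<^sub>\<infinity>w\<in>large_points R. log_factor w z)"

text \<open>M-test: Ln u is bounded by 2 |u - 1| near 1, and the Weierstrass factor differs from 1
  by a cubic term in 1 / w, which reduces the claim to \<open>summable_lattice\<close>.\<close>

lemma log_tail_uniform_limit:
  assumes R: "R > 0"
  shows "uniform_limit (ball 0 R) (\<lambda>X z. \<Sum>w\<in>X. log_factor w z) (log_tail R) (finite_subsets_at_top (large_points R))"
  unfolding log_tail_def[abs_def]
proof (rule Weierstrass_m_test_general)
  fix w z :: complex assume wz: "w \<in> large_points R" "z \<in> ball 0 R"
  note n = weierstrass_factor_near_1[OF R wz]
  have "norm (log_factor w z) \<le> 2 * norm (weierstrass_factor 2 (z / w) - 1)"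
    using norm_Ln_le[OF n(2)] by (simp add: log_factor_def)
  also have "\<dots> \<le> 2 * (3 * R ^ 3 / norm w ^ 3)" using n(1) by simp
  finally show "norm (log_factor w z) \<le> 6 * R ^ 3 * (1 / norm w ^ 3)" by simp
next
  have "large_points R \<subseteq> Lat - {0}" using R by (auto simp: large_points_def)
  from summable_on_subset_banach[OF summable_lattice this]
  show "(\<lambda>w. 6 * R ^ 3 * (1 / norm w ^ 3)) summable_on large_points R"
    by (rule summable_on_cmult_right)
qed

lemma log_tail_holomorphic:
  assumes R: "R > 0"
  shows "log_tail R holomorphic_on ball 0 R"
proof -
  have "log_tail R field_differentiable at z" if z: "z \<in> ball 0 R" for z
  proof -
    obtain r where r: "r > 0" "cball z r \<subseteq> ball 0 R"
      using z by (meson open_ball open_contains_cball)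
    have hol: "(\<lambda>z. \<Sum>w\<in>X. log_factor w z) holomorphic_on ball 0 R" if "X \<subseteq> large_points R" for X
      using that by (auto intro!: holomorphic_intros log_factor_holomorphic[OF R])
    have "\<forall>\<^sub>F X in finite_subsets_at_top (large_points R).
        continuous_on (cball z r) (\<lambda>z. \<Sum>w\<in>X. log_factor w z) \<and>
        (\<lambda>z. \<Sum>w\<in>X. log_factor w z) holomorphic_on ball z r"
    proof (rule eventually_finite_subsets_at_top_weakI)
      fix X assume "X \<subseteq> large_points R"
      from hol[OF this] show "continuous_on (cball z r) (\<lambda>z. \<Sum>w\<in>X. log_factor w z) \<and>
          (\<lambda>z. \<Sum>w\<in>X. log_factor w z) holomorphic_on ball z r"
        using r(2) by (meson ball_subset_cball holomorphic_on_imp_continuous_on holomorphic_on_subset subset_trans)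
    qed
    from holomorphic_uniform_limit[OF this uniform_limit_on_subset[OF log_tail_uniform_limit[OF R] r(2)]]
    have "log_tail R holomorphic_on ball z r" by (auto simp: finite_subsets_at_top_neq_bot)
    thus ?thesis using r(1) by (simp add: holomorphic_on_imp_differentiable_at)
  qed
  thus ?thesis by (simp add: holomorphic_on_def field_differentiable_at_within)
qed

text \<open>A uniform limit of holomorphic functions may be differentiated termwise. The orders 0 to
  3 give the series for sigma, zeta, wp and wp'.\<close>

lemma log_tail_has_sum:
  assumes R: "R > 0" and z: "z \<in> ball 0 R"
  shows "((\<lambda>w. (deriv ^^ m) (log_factor w) z) has_sum (deriv ^^ m) (log_tail R) z) (large_points R)"
proof -
  have ev: "\<forall>\<^sub>F X in finite_subsets_at_top (large_points R). finite X \<and> X \<subseteq> large_points R"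
    by (rule eventually_finite_subsets_at_top_weakI) auto
  have "((\<lambda>X. (deriv ^^ m) (\<lambda>z. \<Sum>w\<in>X. log_factor w z) z) \<longlongrightarrow> (deriv ^^ m) (log_tail R) z)
          (finite_subsets_at_top (large_points R))"
  proof (rule higher_deriv_complex_uniform_limit[OF log_tail_uniform_limit[OF R]])
    show "\<forall>\<^sub>F X in finite_subsets_at_top (large_points R). (\<lambda>z. \<Sum>w\<in>X. log_factor w z) holomorphic_on ball 0 R"
      using ev by eventually_elim (auto intro!: holomorphic_intros log_factor_holomorphic[OF R])
  qed (use z in auto)
  moreover have "\<forall>\<^sub>F X in finite_subsets_at_top (large_points R).
      (deriv ^^ m) (\<lambda>z. \<Sum>w\<in>X. log_factor w z) z = (\<Sum>w\<in>X. (deriv ^^ m) (log_factor w) z)"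
    using ev by eventually_elim
      (rule higher_deriv_sum[OF _ log_factor_holomorphic[OF R] open_ball z], auto)
  ultimately show ?thesis unfolding has_sum_def by (rule Lim_transform_eventually)
qed


lemma log_tail_sums:
  assumes R: "R > 0" and z: "z \<in> ball 0 R"
  shows "((\<lambda>w. 1 / (z - w) + 1 / w + z / w ^ 2) has_sum deriv (log_tail R) z) (large_points R)"
    "((\<lambda>w. 1 / (z - w) ^ 2 - 1 / w ^ 2) has_sum - (deriv ^^ 2) (log_tail R) z) (large_points R)"
    "((\<lambda>w. 1 / (z - w) ^ 3) has_sum (deriv ^^ 3) (log_tail R) z / 2) (large_points R)"
proof -
  have "((\<lambda>w. (deriv ^^ 1) (log_factor w) z) has_sum (deriv ^^ 1) (log_tail R) z) (large_points R)"
    by (rule log_tail_has_sum[OF R z])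
  also have "?this \<longleftrightarrow> ((\<lambda>w. 1 / (z - w) + 1 / w + z / w ^ 2) has_sum deriv (log_tail R) z) (large_points R)"
    by (rule ssubst[of "deriv (log_tail R) z" "(deriv ^^ 1) (log_tail R) z"], simp,
        rule has_sum_cong) (simp add: log_factor_derivs[OF R _ z])
  finally show "((\<lambda>w. 1 / (z - w) + 1 / w + z / w ^ 2) has_sum deriv (log_tail R) z) (large_points R)" .
  have "((\<lambda>w. - ((deriv ^^ 2) (log_factor w) z)) has_sum - (deriv ^^ 2) (log_tail R) z) (large_points R)"
    using log_tail_has_sum[OF R z, of 2] by (simp only: has_sum_uminus minus_minus)
  also have "?this \<longleftrightarrow> ((\<lambda>w. 1 / (z - w) ^ 2 - 1 / w ^ 2) has_sum - (deriv ^^ 2) (log_tail R) z) (large_points R)"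
    by (rule has_sum_cong) (simp only: log_factor_derivs[OF R _ z] minus_diff_eq)
  finally show "((\<lambda>w. 1 / (z - w) ^ 2 - 1 / w ^ 2) has_sum - (deriv ^^ 2) (log_tail R) z) (large_points R)" .
  have "((\<lambda>w. (deriv ^^ 3) (log_factor w) z * (1 / 2)) has_sum (deriv ^^ 3) (log_tail R) z * (1 / 2)) (large_points R)"
    by (rule has_sum_cmult_left[OF log_tail_has_sum[OF R z]])
  also have "?this \<longleftrightarrow> ((\<lambda>w. 1 / (z - w) ^ 3) has_sum (deriv ^^ 3) (log_tail R) z * (1 / 2)) (large_points R)"
    by (rule has_sum_cong) (simp only: log_factor_derivs[OF R _ z], simp)
  finally show "((\<lambda>w. 1 / (z - w) ^ 3) has_sum (deriv ^^ 3) (log_tail R) z / 2) (large_points R)" by simp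
qed

lemma infsum_split_small:
  fixes f :: "complex \<Rightarrow> complex"
  assumes "R > 0" "(f has_sum s) (large_points R)"
  shows "(f has_sum (sum f (small_points R) + s)) (Lat - {0})"
  using has_sum_Un_disjoint[OF has_sum_finite[OF finite_small_points] assms(2) small_large_points(2)[OF assms(1)]]
    small_large_points(1)[OF assms(1)] by simp

lemma wzeta_local:
  assumes "R > 0" "z \<in> ball 0 R"
  shows "Z z = 1 / z + ((\<Sum>w\<in>small_points R. 1 / (z - w) + 1 / w + z / w ^ 2) + deriv (log_tail R) z)"
  unfolding wzeta_def using infsumI[OF infsum_split_small[OF assms(1) log_tail_sums(1)[OF assms]]] by simp

lemma wp_local:
  assumes "R > 0" "z \<in> ball 0 R"
  shows "P z = 1 / z ^ 2 + ((\<Sum>w\<in>small_points R. 1 / (z - w) ^ 2 - 1 / w ^ 2) - (deriv ^^ 2) (log_tail R) z)"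
  unfolding wp_def using infsumI[OF infsum_split_small[OF assms(1) log_tail_sums(2)[OF assms]]] by simp

lemma wsigma_local:
  assumes R: "R > 0" and z: "z \<in> ball 0 R"
  shows "S z = z * (\<Prod>w\<in>small_points R. weierstrass_factor 2 (z / w)) * exp (log_tail R z)"
proof -
  \<comment> \<open>Extension by zero turns the sum over the large points into one over the whole
    punctured lattice, so that it runs along the same net of finite subsets as the product defining
    \<open>S\<close>.\<close>
  define g where "g w = (if w \<in> large_points R then log_factor w z else 0)" for w
  have "((\<lambda>w. log_factor w z) has_sum log_tail R z) (large_points R)"
    using log_tail_has_sum[OF R z, of 0] by simp
  also have "?this \<longleftrightarrow> (g has_sum log_tail R z) (Lat - {0})"
    by (rule has_sum_cong_neutral) (use small_large_points[OF R] in \<open>auto simp: g_def\<close>)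
  finally have "(sum g \<longlongrightarrow> log_tail R z) (finite_subsets_at_top (Lat - {0}))"
    by (simp add: has_sum_def)
  hence "((\<lambda>F. (\<Prod>w\<in>small_points R. weierstrass_factor 2 (z / w)) * exp (sum g F)) \<longlongrightarrow>
      (\<Prod>w\<in>small_points R. weierstrass_factor 2 (z / w)) * exp (log_tail R z)) (finite_subsets_at_top (Lat - {0}))"
    by (intro tendsto_intros)
  moreover have "\<forall>\<^sub>F F in finite_subsets_at_top (Lat - {0}).
      (\<Prod>w\<in>small_points R. weierstrass_factor 2 (z / w)) * exp (sum g F) = (\<Prod>w\<in>F. weierstrass_factor 2 (z / w))"
    unfolding eventually_finite_subsets_at_top
  proof (intro exI[of _ "small_points R"] conjI allI impI)
    show "small_points R \<subseteq> Lat - {0}" by (auto simp: small_points_def)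
    fix F assume F: "finite F \<and> small_points R \<subseteq> F \<and> F \<subseteq> Lat - {0}"
    define G where "G = F - small_points R"
    have G: "finite G" "G \<subseteq> large_points R" "F = small_points R \<union> G" "small_points R \<inter> G = {}"
      using F small_large_points[OF R] by (auto simp: G_def)
    have "exp (sum g F) = exp (sum g G)"
      using G small_large_points(2)[OF R] by (simp add: sum.union_disjoint g_def) (subst sum.neutral, auto)
    also have "\<dots> = (\<Prod>w\<in>G. exp (g w))" by (rule exp_sum[OF G(1)])
    also have "\<dots> = (\<Prod>w\<in>G. weierstrass_factor 2 (z / w))"
    proof (rule prod.cong[OF refl])
      fix w assume "w \<in> G"
      hence w: "w \<in> large_points R" using G by auto
      have "weierstrass_factor 2 (z / w) \<noteq> 0"
        using weierstrass_factor_Re_pos[OF R w z] by force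
      thus "exp (g w) = weierstrass_factor 2 (z / w)" using w by (simp add: g_def log_factor_def)
    qed
    finally show "(\<Prod>w\<in>small_points R. weierstrass_factor 2 (z / w)) * exp (sum g F) = (\<Prod>w\<in>F. weierstrass_factor 2 (z / w))"
      using G by (simp add: prod.union_disjoint)
  qed simp
  ultimately have "((\<lambda>F. \<Prod>w\<in>F. weierstrass_factor 2 (z / w)) \<longlongrightarrow>
      (\<Prod>w\<in>small_points R. weierstrass_factor 2 (z / w)) * exp (log_tail R z)) (finite_subsets_at_top (Lat - {0}))"
    by (rule Lim_transform_eventually)
  hence "Lim (finite_subsets_at_top (Lat - {0})) (\<lambda>F. \<Prod>w\<in>F. weierstrass_factor 2 (z / w)) =
      (\<Prod>w\<in>small_points R. weierstrass_factor 2 (z / w)) * exp (log_tail R z)"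
    by (intro tendsto_Lim) (auto simp: finite_subsets_at_top_neq_bot)
  thus ?thesis by (simp add: wsigma_def mult.assoc)
qed

section \<open>Holomorphy, zeros and derivatives of sigma, zeta and wp\<close>

lemma ball_cover: obtains R where "R > 0" "z \<in> ball (0::complex) R"
  by (rule that[of "norm z + 1"]) (auto simp: add_nonneg_pos)

lemma wsigma_holomorphic [holomorphic_intros]: "S holomorphic_on U"
proof -
  have "S field_differentiable at z" for z
  proof -
    obtain R where R: "R > 0" "z \<in> ball 0 R" by (rule ball_cover)
    have "(\<lambda>z. z * (\<Prod>w\<in>small_points R. weierstrass_factor 2 (z / w)) * exp (log_tail R z)) holomorphic_on ball 0 R"
      by (intro holomorphic_intros log_tail_holomorphic R(1)) (auto simp: small_points_def)
    hence "S holomorphic_on ball 0 R"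
      by (rule holomorphic_transform) (simp add: wsigma_local[OF R(1)])
    thus ?thesis using R(2) by (simp add: holomorphic_on_imp_differentiable_at)
  qed
  thus ?thesis by (simp add: holomorphic_on_def field_differentiable_at_within)
qed

lemma wsigma_eq_0_iff: "S z = 0 \<longleftrightarrow> z \<in> Lat"
proof -
  obtain R where R: "R > 0" "z \<in> ball 0 R" by (rule ball_cover)
  have "S z = 0 \<longleftrightarrow> z = 0 \<or> (\<exists>w\<in>small_points R. z / w = 1)"
    by (simp add: wsigma_local[OF R])
  also have "(\<exists>w\<in>small_points R. z / w = 1) \<longleftrightarrow> z \<in> small_points R"
    by (auto simp: small_points_def)
  also have "z = 0 \<or> z \<in> small_points R \<longleftrightarrow> z \<in> Lat"
    using R by (auto simp: small_points_def)
  finally show ?thesis .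
qed

lemma wsigma_derivative:
  assumes "z \<notin> Lat"
  shows "(S has_field_derivative S z * Z z) (at z)"
proof -
  obtain R where R: "R > 0" "z \<in> ball 0 R" by (rule ball_cover)
  let ?f = "\<lambda>z. (\<Prod>w\<in>small_points R. weierstrass_factor 2 (z / w))"
  let ?g = "\<Sum>w\<in>small_points R. 1 / (z - w) + 1 / w + z / w ^ 2"
  have z: "z \<noteq> 0" using assms by auto
  have d1: "(?f has_field_derivative ?f z * ?g) (at z)"
    by (rule has_field_derivative_prod_log[OF finite_small_points])
       (rule weierstrass_factor_derivative, use assms in \<open>auto simp: small_points_def\<close>)
  have d2: "(log_tail R has_field_derivative deriv (log_tail R) z) (at z)"
    by (rule holomorphic_derivI[OF log_tail_holomorphic[OF R(1)] open_ball R(2)])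
  have "((\<lambda>z. z * ?f z * exp (log_tail R z)) has_field_derivative
      (1 * ?f z + (?f z * ?g) * z) * exp (log_tail R z) + (exp (log_tail R z) * deriv (log_tail R) z) * (z * ?f z)) (at z)"
    by (intro DERIV_mult DERIV_ident d1 DERIV_fun_exp d2)
  also have "(1 * ?f z + (?f z * ?g) * z) * exp (log_tail R z) + (exp (log_tail R z) * deriv (log_tail R) z) * (z * ?f z)
      = S z * Z z"
    unfolding wsigma_local[OF R] wzeta_local[OF R] using z by (simp add: field_simps)
  finally show ?thesis
    by (rule has_field_derivative_transform_within_open[OF _ open_ball R(2)]) (simp add: wsigma_local[OF R(1)])
qed

lemma log_tail_0 [simp]: "log_tail R 0 = 0"
  unfolding log_tail_def by (simp add: log_factor_def)

lemma wsigma_derivative_0: "(S has_field_derivative 1) (at 0)"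
proof -
  let ?k = "\<lambda>z. (\<Prod>w\<in>small_points 1. weierstrass_factor 2 (z / w)) * exp (log_tail 1 z)"
  have "?k holomorphic_on ball 0 1"
    by (intro holomorphic_intros log_tail_holomorphic) (auto simp: small_points_def)
  hence "(?k has_field_derivative deriv ?k 0) (at 0)"
    by (rule holomorphic_derivI) auto
  from DERIV_mult[OF DERIV_ident this]
  have "((\<lambda>z. z * ?k z) has_field_derivative 1) (at 0)" by simp
  thus ?thesis
    by (rule has_field_derivative_transform_within_open[OF _ open_ball[of 0 1]]) (auto simp: wsigma_local[of 1])
qed

lemma wzeta_derivative:
  assumes "z \<notin> Lat"
  shows "(Z has_field_derivative - P z) (at z)"
proof -
  obtain R where R: "R > 0" "z \<in> ball 0 R" by (rule ball_cover)
  have z: "z \<noteq> 0" using assms by auto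
  have nz: "z \<noteq> w" "w \<noteq> 0" if "w \<in> small_points R" for w using that assms by (auto simp: small_points_def)
  have hol: "deriv (log_tail R) holomorphic_on ball 0 R"
    by (intro holomorphic_deriv log_tail_holomorphic R) auto
  have d2: "(deriv (log_tail R) has_field_derivative (deriv ^^ 2) (log_tail R) z) (at z)"
    using holomorphic_derivI[OF hol open_ball R(2)] by (simp add: numeral_2_eq_2)
  have d1: "((\<lambda>z. 1 / (z - w) + 1 / w + z / w ^ 2) has_field_derivative - (1 / (z - w) ^ 2 - 1 / w ^ 2)) (at z)"
    if "w \<in> small_points R" for w
    by ((rule derivative_eq_intros refl | simp add: nz[OF that])+,
        simp add: nz[OF that] power2_eq_square power4_eq_xxxx)
  have "((\<lambda>z. 1 / z + ((\<Sum>w\<in>small_points R. 1 / (z - w) + 1 / w + z / w ^ 2) + deriv (log_tail R) z)) has_field_derivative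
     - 1 / z ^ 2 + ((\<Sum>w\<in>small_points R. - (1 / (z - w) ^ 2 - 1 / w ^ 2)) + (deriv ^^ 2) (log_tail R) z)) (at z)"
    by (intro DERIV_add DERIV_sum d1 d2) (use z in \<open>auto intro!: derivative_eq_intros simp: power2_eq_square\<close>)
  also have "- 1 / z ^ 2 + ((\<Sum>w\<in>small_points R. - (1 / (z - w) ^ 2 - 1 / w ^ 2)) + (deriv ^^ 2) (log_tail R) z) = - P z"
    unfolding wp_local[OF R] sum_negf by simp
  finally show ?thesis
    by (rule has_field_derivative_transform_within_open[OF _ open_ball R(2)]) (simp only: wzeta_local[OF R(1)])
qed

lemma wp_derivative:
  assumes "z \<notin> Lat"
  shows "(P has_field_derivative - 2 * (\<Sum>\<^sub>\<infinity>w\<in>Lat. 1 / (z - w) ^ 3)) (at z)"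
proof -
  obtain R where R: "R > 0" "z \<in> ball 0 R" by (rule ball_cover)
  have z: "z \<noteq> 0" using assms by auto
  have nz: "z \<noteq> w" "w \<noteq> 0" if "w \<in> small_points R" for w using that assms by (auto simp: small_points_def)
  have hol: "(deriv ^^ 2) (log_tail R) holomorphic_on ball 0 R"
    by (intro holomorphic_higher_deriv log_tail_holomorphic R) auto
  have d2: "((deriv ^^ 2) (log_tail R) has_field_derivative (deriv ^^ 3) (log_tail R) z) (at z)"
    using holomorphic_derivI[OF hol open_ball R(2)] by (simp add: numeral_2_eq_2 numeral_3_eq_3)
  have d1: "((\<lambda>z. 1 / (z - w) ^ 2 - 1 / w ^ 2) has_field_derivative - 2 * (1 / (z - w) ^ 3)) (at z)"
    if "w \<in> small_points R" for w
    by ((rule derivative_eq_intros refl | simp add: nz[OF that])+,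
        simp add: nz[OF that] power2_eq_square power3_eq_cube power4_eq_xxxx divide_simps, (algebra)?)
  have "((\<lambda>z. 1 / z ^ 2 + ((\<Sum>w\<in>small_points R. 1 / (z - w) ^ 2 - 1 / w ^ 2) - (deriv ^^ 2) (log_tail R) z)) has_field_derivative
     - 2 * (1 / z ^ 3) + ((\<Sum>w\<in>small_points R. - 2 * (1 / (z - w) ^ 3)) - (deriv ^^ 3) (log_tail R) z)) (at z)"
    by (intro DERIV_add DERIV_diff DERIV_sum d1 d2)
       (use z in \<open>auto intro!: derivative_eq_intros simp: power2_eq_square power3_eq_cube divide_simps\<close>)
  also have "- 2 * (1 / z ^ 3) + ((\<Sum>w\<in>small_points R. - 2 * (1 / (z - w) ^ 3)) - (deriv ^^ 3) (log_tail R) z)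
     = - 2 * (\<Sum>\<^sub>\<infinity>w\<in>Lat. 1 / (z - w) ^ 3)"
  proof -
    have "((\<lambda>w. 1 / (z - w) ^ 3) has_sum ((\<Sum>w\<in>small_points R. 1 / (z - w) ^ 3) + (deriv ^^ 3) (log_tail R) z / 2)) (Lat - {0})"
      by (rule infsum_split_small[OF R(1) log_tail_sums(3)[OF R]])
    from has_sum_Un_disjoint[OF has_sum_finite[of "{0}"] this]
    have "((\<lambda>w. 1 / (z - w) ^ 3) has_sum (1 / z ^ 3 + ((\<Sum>w\<in>small_points R. 1 / (z - w) ^ 3) + (deriv ^^ 3) (log_tail R) z / 2))) Lat"
      by (simp add: insert_absorb)
    from infsumI[OF this] show ?thesis unfolding sum_distrib_left[symmetric] by (simp add: algebra_simps)
  qed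
  finally show ?thesis
    by (rule has_field_derivative_transform_within_open[OF _ open_ball R(2)]) (simp only: wp_local[OF R(1)])
qed

end

section \<open>Quasi-periods\<close>

text \<open>Every ball is uncountable, so the complement of a countable set is dense. The sets of
  poles and zeros met later are all countable, which makes this one criterion enough to extend
  identities across them.\<close>

lemma eq_off_countable:
  fixes f g :: "complex \<Rightarrow> complex"
  assumes "continuous_on UNIV f" "continuous_on UNIV g" "countable H" "\<And>x. x \<notin> H \<Longrightarrow> f x = g x"
  shows "f x = g x"
proof (rule ccontr)
  assume "f x \<noteq> g x"
  have "open {x. f x - g x \<noteq> 0}"
    by (intro open_Collect_neq continuous_intros assms)
  with \<open>f x \<noteq> g x\<close> obtain e where e: "e > 0" "ball x e \<subseteq> {x. f x - g x \<noteq> 0}"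
    unfolding open_contains_ball by auto
  hence "ball x e \<subseteq> H" using assms(4) by fastforce
  thus False using uncountable_ball[OF e(1)] assms(3) countable_subset by blast
qed

lemma cancel_off_countable:
  fixes f g h :: "complex \<Rightarrow> complex"
  assumes "continuous_on UNIV f" "continuous_on UNIV g" "countable {x. h x = 0}" "\<And>x. h x * f x = h x * g x"
  shows "f x = g x"
  by (rule eq_off_countable[OF assms(1-3)]) (use assms(4) in auto)

context period_pair
begin

lemma wsigma_continuous [continuous_intros]: "continuous_on U f \<Longrightarrow> continuous_on U (\<lambda>x. S (f x))"
  by (rule continuous_on_compose2[OF holomorphic_on_imp_continuous_on[OF wsigma_holomorphic[of UNIV]]]) auto

lemma wsigma_holomorphic' [holomorphic_intros]: "f holomorphic_on U \<Longrightarrow> (\<lambda>x. S (f x)) holomorphic_on U"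
  using holomorphic_on_compose[OF _ wsigma_holomorphic] by (simp add: o_def)

lemma wsigma_0 [simp]: "S 0 = 0"
  by (simp add: wsigma_eq_0_iff)

lemma closed_Lat: "closed Lat"
proof -
  have "closed (S -` {0})"
    by (intro continuous_closed_vimage) (use wsigma_continuous[OF continuous_on_id, of UNIV] in \<open>auto simp: continuous_on_eq_continuous_at\<close>)
  also have "S -` {0} = Lat" by (auto simp: wsigma_eq_0_iff)
  finally show ?thesis .
qed

lemma connected_off_Lat: "connected (- Lat)"
  using connected_open_diff_countable[of UNIV Lat] countable_Lat by (simp add: Compl_eq_Diff_UNIV convex_connected)

text \<open>Removing a countable set leaves the plane connected.\<close>

lemma constant_off_Lat:
  assumes "\<And>z. z \<notin> Lat \<Longrightarrow> (f has_field_derivative 0) (at z)"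
  shows "\<exists>c. \<forall>z. z \<notin> Lat \<longrightarrow> f z = c"
proof -
  have "f constant_on (- Lat)"
    by (rule has_field_derivative_0_imp_constant_on[OF _ connected_off_Lat]) (use assms closed_Lat in \<open>auto simp: open_closed\<close>)
  thus ?thesis by (auto simp: constant_on_def)
qed

lemma countable_shifted_Lat: "countable {x. x - p \<in> Lat}" "countable {x. x + p \<in> Lat}"
proof -
  show 1: "countable {x. x - p \<in> Lat}" for p
  proof (rule countable_subset)
    show "{x. x - p \<in> Lat} \<subseteq> (\<lambda>x. x + p) ` Lat"
      by (auto simp: image_iff) (metis diff_add_cancel)
  qed (simp add: countable_Lat)
  show "countable {x. x + p \<in> Lat}" using 1[of "- p"] by simp
qed

lemma Lat_of_real:
  assumes "2 * of_real a * \<omega>1 + 2 * of_real b * \<omega>3 \<in> Lat"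
  shows "a \<in> \<int>" "b \<in> \<int>"
proof -
  obtain m n :: int where "2 * of_real a * \<omega>1 + 2 * of_real b * \<omega>3 = 2 * of_int m * \<omega>1 + 2 * of_int n * \<omega>3"
    using assms unfolding Lat_iff by blast
  hence "2 * of_real (a - m) * \<omega>1 + 2 * of_real (b - n) * \<omega>3 = 0"
    by (simp add: algebra_simps)
  hence "lattice_const * max \<bar>a - m\<bar> \<bar>b - n\<bar> \<le> 0"
    using norm_ge_lattice_const[of "a - m" "b - n"] by simp
  hence "max \<bar>a - m\<bar> \<bar>b - n\<bar> \<le> 0"
    using lattice_const_pos by (simp add: mult_le_0_iff)
  hence "a = of_int m" "b = of_int n" by (auto simp: max_def split: if_splits)
  thus "a \<in> \<int>" "b \<in> \<int>" by auto
qed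

lemma half_notin_Ints: "(1 / 2 :: real) \<notin> \<int>" "(- 1 / 2 :: real) \<notin> \<int>"
proof -
  have "frac (1 / 2 :: real) = 1 / 2" by (simp add: frac_eq)
  thus *: "(1 / 2 :: real) \<notin> \<int>" by (metis frac_eq_0_iff half_gt_zero_iff less_irrefl zero_less_one)
  show "(- 1 / 2 :: real) \<notin> \<int>" using * minus_in_Ints_iff[of "1/2 :: real"] by simp
qed

lemma half_sum_notin_Lat: "\<omega>1 \<notin> Lat" "\<omega>3 \<notin> Lat" "\<omega>1 + \<omega>3 \<notin> Lat" "\<omega>1 - \<omega>3 \<notin> Lat"
  using Lat_of_real[of "1/2" 0] Lat_of_real[of 0 "1/2"] Lat_of_real[of "1/2" "1/2"] Lat_of_real[of "1/2" "-1/2"] half_notin_Ints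
  by auto

lemma half_period_simps [simp]:
  "hp 0 = 0" "hp (Suc 0) = \<omega>1" "hp 2 = - \<omega>1 - \<omega>3" "hp 3 = \<omega>3"
  by (simp_all add: half_period_def)

lemma le_3_cases: "i \<le> 3 \<Longrightarrow> i = 0 \<or> i = Suc 0 \<or> i = 2 \<or> i = (3::nat)"
  by auto

lemma two_half_period: "2 * hp i \<in> Lat"
proof -
  have "2 * (- \<omega>1 - \<omega>3) = - (2 * \<omega>1) - 2 * \<omega>3" by simp
  also have "\<dots> \<in> Lat" by (intro Lat_diff) (auto intro: two_\<omega>1_in_Lat two_\<omega>3_in_Lat)
  finally show ?thesis by (auto simp: half_period_def two_\<omega>1_in_Lat two_\<omega>3_in_Lat)
qed

lemma half_period_diff_notin:
  assumes "i \<le> 3" "k \<le> 3" "i \<noteq> k"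
  shows "hp i - hp k \<notin> Lat"
proof -
  have a: "- \<omega>1 - \<omega>3 \<notin> Lat" using half_sum_notin_Lat(3) Lat_uminus_iff[of "\<omega>1 + \<omega>3"] by simp
  have b: "\<omega>3 + (\<omega>1 + \<omega>1) \<notin> Lat"
    using half_sum_notin_Lat(2) two_\<omega>1_in_Lat Lat_add_iff[of "2 * \<omega>1" \<omega>3] by (simp add: algebra_simps)
  have c: "\<omega>1 + (\<omega>3 + \<omega>3) \<notin> Lat"
    using half_sum_notin_Lat(1) two_\<omega>3_in_Lat Lat_add_iff[of "2 * \<omega>3" \<omega>1] by (simp add: algebra_simps)
  have d: "\<omega>3 - \<omega>1 \<notin> Lat" using half_sum_notin_Lat(4) Lat_minus_commute by blast
  have b': "- \<omega>1 - \<omega>3 - \<omega>1 \<notin> Lat" using b Lat_uminus_iff[of "\<omega>3 + (\<omega>1 + \<omega>1)"] by (simp add: algebra_simps)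
  have c': "- \<omega>1 - \<omega>3 - \<omega>3 \<notin> Lat" using c Lat_uminus_iff[of "\<omega>1 + (\<omega>3 + \<omega>3)"] by (simp add: algebra_simps)
  show ?thesis
    using le_3_cases[OF assms(1)] le_3_cases[OF assms(2)] assms(3) a b c d b' c' half_sum_notin_Lat
    by (elim disjE) (simp_all add: algebra_simps)
qed

lemma half_period_sum_iff: "x + hp i \<in> Lat \<longleftrightarrow> x - hp i \<in> Lat"
  using Lat_add_iff[OF two_half_period[of i], of "x - hp i"] by (simp add: algebra_simps)

lemma half_period_notin: "i \<in> {1..3} \<Longrightarrow> hp i \<notin> Lat"
  using half_period_diff_notin[of i 0] by auto

lemma Hpts_iff: "x \<in> Hpts \<longleftrightarrow> (\<exists>i\<le>3. x + hp i \<in> Lat)"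
  by (simp add: half_points_def half_period_sum_iff)

lemma Hpts_add_iff [simp]: "\<tau> \<in> Lat \<Longrightarrow> x + \<tau> \<in> Hpts \<longleftrightarrow> x \<in> Hpts"
  unfolding Hpts_iff by (metis Lat_add_iff add.assoc add.commute)

lemma Hpts_uminus_iff [simp]: "- x \<in> Hpts \<longleftrightarrow> x \<in> Hpts"
proof -
  have "- x + hp i \<in> Lat \<longleftrightarrow> x + hp i \<in> Lat" for i
    using Lat_uminus_iff[of "x - hp i"] half_period_sum_iff[of x i] by simp
  thus ?thesis unfolding Hpts_iff by blast
qed

lemma Hpts_Lat: "x \<notin> Hpts \<Longrightarrow> x \<notin> Lat"
  unfolding Hpts_iff by (metis add.right_neutral half_period_simps(1) le0)

lemma countable_Hpts: "countable Hpts"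
proof -
  have "Hpts = (\<Union>i\<in>{..3}. {x. x + hp i \<in> Lat})" by (auto simp: Hpts_iff)
  thus ?thesis by (simp add: countable_shifted_Lat)
qed

lemma closed_Hpts: "closed Hpts"
proof -
  have "Hpts = (\<Union>i\<in>{..3}. (\<lambda>x. x + hp i) -` Lat)" by (auto simp: Hpts_iff)
  thus ?thesis by (auto intro!: closed_UN continuous_closed_vimage closed_Lat continuous_intros)
qed

lemma open_off_Hpts: "open (- Hpts)"
  using closed_Hpts by (simp add: open_closed)

section \<open>Parity and behaviour under lattice translations\<close>

lemma wp_uminus [simp]: "P (- z) = P z"
proof -
  have "(\<Sum>\<^sub>\<infinity>w\<in>Lat - {0}. 1 / (- z - w) ^ 2 - 1 / w ^ 2) = (\<Sum>\<^sub>\<infinity>w\<in>Lat - {0}. 1 / (z - w) ^ 2 - 1 / w ^ 2)"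
  proof (rule infsum_reindex_bij_witness[of _ uminus uminus])
    fix a show "1 / (z - - a) ^ 2 - 1 / (- a) ^ 2 = 1 / (- z - a) ^ 2 - 1 / a ^ 2"
      by (simp add: power2_eq_square algebra_simps)
  qed auto
  thus ?thesis unfolding wp_def by simp
qed

lemma wzeta_uminus [simp]: "Z (- z) = - Z z"
proof -
  have "(\<Sum>\<^sub>\<infinity>w\<in>Lat - {0}. 1 / (- z - w) + 1 / w + - z / w ^ 2) = (\<Sum>\<^sub>\<infinity>w\<in>Lat - {0}. - (1 / (z - w) + 1 / w + z / w ^ 2))"
  proof (rule infsum_reindex_bij_witness[of _ uminus uminus])
    fix a
    have "- z - a = - (z + a)" by simp
    hence "1 / (- z - a) = - (1 / (z + a))" by (simp only: divide_minus_right)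
    thus "- (1 / (z - - a) + 1 / - a + z / (- a) ^ 2) = 1 / (- z - a) + 1 / a + - z / a ^ 2"
      by simp
  qed auto
  thus ?thesis unfolding wzeta_def by (simp only: infsum_uminus) simp
qed

text \<open>As zeta is odd, S(-z) / S(z) has derivative zero; its constant value is read off from
  the derivatives of numerator and denominator at 0.\<close>

lemma wsigma_uminus [simp]: "S (- z) = - S z"
proof -
  have "((\<lambda>z. S (- z) / S z) has_field_derivative 0) (at z)" if "z \<notin> Lat" for z
  proof -
    have "((\<lambda>z. S (- z)) has_field_derivative (S (- z) * Z (- z) * - 1)) (at z)"
      by (rule DERIV_chain2[of S], rule wsigma_derivative) (use that in \<open>auto intro!: derivative_eq_intros\<close>)
    from DERIV_divide[OF this wsigma_derivative[OF that]] show ?thesis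
      using that by (simp add: wsigma_eq_0_iff)
  qed
  from constant_off_Lat[OF this] obtain c where c: "\<And>z. z \<notin> Lat \<Longrightarrow> S (- z) / S z = c" by blast
  have eq: "S (- z) = c * S z" for z
  proof (cases "z \<in> Lat")
    case True
    thus ?thesis using wsigma_eq_0_iff[of z] wsigma_eq_0_iff[of "- z"] by simp
  next
    case False
    thus ?thesis using c[OF False] wsigma_eq_0_iff[of z] by (simp add: field_simps)
  qed
  have "((\<lambda>z. S (- z)) has_field_derivative 1 * - 1) (at 0)"
    by (rule DERIV_chain2[of S]) (use wsigma_derivative_0 in \<open>auto intro!: derivative_eq_intros\<close>)
  moreover have "((\<lambda>z. S (- z)) has_field_derivative c * 1) (at 0)"
    unfolding eq by (rule DERIV_cmult[OF wsigma_derivative_0])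
  ultimately have "c = - 1" by (metis DERIV_unique mult.commute mult_1)
  with eq show ?thesis by simp
qed

lemma wp_deriv_periodic:
  assumes "\<tau> \<in> Lat"
  shows "(\<Sum>\<^sub>\<infinity>w\<in>Lat. 1 / (z + \<tau> - w) ^ 3) = (\<Sum>\<^sub>\<infinity>w\<in>Lat. 1 / (z - w) ^ 3)"
  by (rule infsum_reindex_bij_witness[of _ "\<lambda>w. w + \<tau>" "\<lambda>w. w - \<tau>"]) (use assms in \<open>auto simp: algebra_simps\<close>)

text \<open>The derivative of wp is a lattice sum and visibly periodic, so P(z + 2 \<omega>) - P(z)
  is constant, and evenness at z = -\<omega> makes the constant zero. That point must lie off the
  lattice, hence the restriction to a period whose half is none.\<close>

lemma wp_periodic_half:
  assumes "\<omega> \<notin> Lat" "2 * \<omega> \<in> Lat" "z \<notin> Lat"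
  shows "P (z + 2 * \<omega>) = P z"
proof -
  have "((\<lambda>z. P (z + 2 * \<omega>) - P z) has_field_derivative 0) (at z)" if "z \<notin> Lat" for z
  proof -
    have "((\<lambda>z. P (z + 2 * \<omega>)) has_field_derivative (- 2 * (\<Sum>\<^sub>\<infinity>w\<in>Lat. 1 / (z - w) ^ 3)) * 1) (at z)"
      by (rule DERIV_chain2[of P], subst wp_deriv_periodic[OF assms(2), symmetric], rule wp_derivative)
         (use that assms in \<open>auto intro!: derivative_eq_intros\<close>)
    from DERIV_diff[OF this wp_derivative[OF that]] show ?thesis by simp
  qed
  from constant_off_Lat[OF this] obtain c where c: "\<And>z. z \<notin> Lat \<Longrightarrow> P (z + 2 * \<omega>) - P z = c" by blast
  from c[of "- \<omega>"] assms(1) have "c = 0" by simp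
  with c[OF assms(3)] show ?thesis by simp
qed

lemma wp_periodic:
  assumes "\<tau> \<in> Lat" and False: "z \<notin> Lat"
  shows "P (z + \<tau>) = P z"
proof -
  have nat: "P (z + of_nat n * (2 * \<omega>)) = P z" if "\<omega> \<notin> Lat" "2 * \<omega> \<in> Lat" "z \<notin> Lat" for z \<omega> n
  proof (induction n)
    case (Suc n)
    have "z + of_nat n * (2 * \<omega>) \<notin> Lat" using that Lat_of_nat_mult[OF that(2), of n] by simp
    from wp_periodic_half[OF that(1,2) this] Suc show ?case by (simp add: algebra_simps)
  qed auto
  have int: "P (z + of_int m * (2 * \<omega>)) = P z" if "\<omega> \<notin> Lat" "2 * \<omega> \<in> Lat" "z \<notin> Lat" for z \<omega> m
  proof (cases m rule: int_cases2)
    case (nonneg n)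
    thus ?thesis using nat[OF that, of n] by simp
  next
    case (nonpos n)
    have "z + of_int m * (2 * \<omega>) \<notin> Lat"
      using that Lat_of_nat_mult[OF that(2), of n] nonpos by simp
    from nat[OF that(1,2) this, of n] nonpos show ?thesis by simp
  qed
  obtain m n :: int where mn: "\<tau> = 2 * of_int m * \<omega>1 + 2 * of_int n * \<omega>3"
    using assms(1) by (auto simp: Lat_iff)
  have "z + of_int m * (2 * \<omega>1) \<notin> Lat"
  proof -
    have "of_int m * (2 * \<omega>1) \<in> Lat" unfolding Lat_iff by (rule exI[of _ m], rule exI[of _ 0]) simp
    thus ?thesis using False by simp
  qed
  hence "P ((z + of_int m * (2 * \<omega>1)) + of_int n * (2 * \<omega>3)) = P (z + of_int m * (2 * \<omega>1))"
    by (intro int half_sum_notin_Lat two_\<omega>3_in_Lat)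
  also have "\<dots> = P z" by (intro int half_sum_notin_Lat two_\<omega>1_in_Lat False)
  finally show ?thesis by (simp add: mn algebra_simps)
qed

text \<open>Two integrations: periodicity of wp makes Z(z + \<tau>) - Z(z) a constant a, and then
  S(z + \<tau>) / (S(z) exp(a z)) has derivative zero. Its value is nonzero, so a logarithm of it
  serves as b.\<close>

lemma quasi_periods_exist:
  assumes "\<tau> \<in> Lat"
  shows "\<exists>a b. (\<forall>z. S (z + \<tau>) = exp (a * z + b) * S z) \<and> (\<forall>z. z \<notin> Lat \<longrightarrow> Z (z + \<tau>) = Z z + a)"
proof -
  have "((\<lambda>z. Z (z + \<tau>) - Z z) has_field_derivative 0) (at z)" if "z \<notin> Lat" for z
  proof -
    have "((\<lambda>z. Z (z + \<tau>)) has_field_derivative (- P (z + \<tau>)) * 1) (at z)"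
      by (rule DERIV_chain2[of Z], rule wzeta_derivative)
         (use that assms in \<open>auto intro!: derivative_eq_intros\<close>)
    from DERIV_diff[OF this wzeta_derivative[OF that]] show ?thesis using wp_periodic[OF assms] that by simp
  qed
  from constant_off_Lat[OF this] obtain a where a: "\<And>z. z \<notin> Lat \<Longrightarrow> Z (z + \<tau>) - Z z = a" by blast
  have "((\<lambda>z. S (z + \<tau>) / (S z * exp (a * z))) has_field_derivative 0) (at z)" if "z \<notin> Lat" for z
  proof -
    have 1: "((\<lambda>z. S (z + \<tau>)) has_field_derivative (S (z + \<tau>) * Z (z + \<tau>)) * 1) (at z)"
      by (rule DERIV_chain2[of S], rule wsigma_derivative)
         (use that assms in \<open>auto intro!: derivative_eq_intros\<close>)
    have 2: "((\<lambda>z. S z * exp (a * z)) has_field_derivative S z * Z z * exp (a * z) + exp (a * z) * a * S z) (at z)"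
      by (rule DERIV_mult[OF wsigma_derivative[OF that]]) (auto intro!: derivative_eq_intros)
    have "Z (z + \<tau>) = Z z + a" using a[OF that] by (simp add: algebra_simps)
    with DERIV_divide[OF 1 2] show ?thesis
      using that by (simp add: wsigma_eq_0_iff algebra_simps)
  qed
  from constant_off_Lat[OF this] obtain c where c: "\<And>z. z \<notin> Lat \<Longrightarrow> S (z + \<tau>) / (S z * exp (a * z)) = c" by blast
  have "c \<noteq> 0"
    using c[OF half_sum_notin_Lat(1)] half_sum_notin_Lat(1) assms by (auto simp: wsigma_eq_0_iff)
  have "S (z + \<tau>) = exp (a * z + Ln c) * S z" for z
  proof (cases "z \<in> Lat")
    case True
    thus ?thesis using assms wsigma_eq_0_iff[of z] wsigma_eq_0_iff[of "z + \<tau>"] by simp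
  next
    case False
    thus ?thesis using c[OF False] wsigma_eq_0_iff[of z] \<open>c \<noteq> 0\<close> by (simp add: field_simps exp_add)
  qed
  moreover have "Z (z + \<tau>) = Z z + a" if "z \<notin> Lat" for z
    using a[OF that] by (simp add: algebra_simps)
  ultimately show ?thesis by blast
qed

definition qa :: "complex \<Rightarrow> complex" where
  "qa \<tau> = (SOME a. \<exists>b. (\<forall>z. S (z + \<tau>) = exp (a * z + b) * S z) \<and> (\<forall>z. z \<notin> Lat \<longrightarrow> Z (z + \<tau>) = Z z + a))"

text \<open>Only \<open>exp (qb \<tau>)\<close> is determined. Genuine relations for it, such as
  \<open>exp_qa_qb\<close>, are therefore stated under the exponential.\<close>

definition qb :: "complex \<Rightarrow> complex" where
  "qb \<tau> = (SOME b. \<forall>z. S (z + \<tau>) = exp (qa \<tau> * z + b) * S z)"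

lemma quasi_periods:
  assumes "\<tau> \<in> Lat"
  shows wsigma_add: "S (z + \<tau>) = exp (qa \<tau> * z + qb \<tau>) * S z"
    and wzeta_add: "z \<notin> Lat \<Longrightarrow> Z (z + \<tau>) = Z z + qa \<tau>"
proof -
  have *: "\<exists>b. (\<forall>z. S (z + \<tau>) = exp (qa \<tau> * z + b) * S z) \<and> (\<forall>z. z \<notin> Lat \<longrightarrow> Z (z + \<tau>) = Z z + qa \<tau>)"
    unfolding qa_def by (rule someI_ex) (rule quasi_periods_exist[OF assms])
  hence "\<exists>b. \<forall>z. S (z + \<tau>) = exp (qa \<tau> * z + b) * S z" by blast
  hence "\<forall>z. S (z + \<tau>) = exp (qa \<tau> * z + qb \<tau>) * S z" unfolding qb_def by (rule someI_ex)
  thus "S (z + \<tau>) = exp (qa \<tau> * z + qb \<tau>) * S z" by blast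
  show "z \<notin> Lat \<Longrightarrow> Z (z + \<tau>) = Z z + qa \<tau>" using * by blast
qed

lemma qa_double:
  assumes "\<omega> \<notin> Lat" "2 * \<omega> \<in> Lat"
  shows "qa (2 * \<omega>) = 2 * Z \<omega>"
  using wzeta_add[OF assms(2), of "- \<omega>"] assms by simp

lemma exp_qa_qb_double:
  assumes "\<omega> \<notin> Lat" "2 * \<omega> \<in> Lat"
  shows "exp (qa (2 * \<omega>) * - \<omega> + qb (2 * \<omega>)) = - 1"
proof -
  have "S \<omega> \<noteq> 0" using assms by (simp add: wsigma_eq_0_iff)
  with wsigma_add[OF assms(2), of "- \<omega>"] show ?thesis
    by (simp del: mult_minus_right) (metis mult.commute mult_cancel_left mult_minus1 minus_mult_minus equation_minus_iff)
qed

text \<open>The step from -z - \<tau> to -z is compared, through oddness of sigma, with the step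
  from z to z + \<tau>, at a point z where sigma does not vanish. The result fixes
  \<open>exp (qb \<tau>)\<close> up to sign.\<close>

lemma exp_qa_qb:
  assumes "\<tau> \<in> Lat"
  shows "exp (- qa \<tau> * \<tau> + 2 * qb \<tau>) = 1"
proof -
  let ?z = \<omega>1
  have nz: "S ?z \<noteq> 0" by (simp add: wsigma_eq_0_iff half_sum_notin_Lat)
  have "S (- ?z) = exp (qa \<tau> * (- ?z - \<tau>) + qb \<tau>) * S (- ?z - \<tau>)"
    using wsigma_add[OF assms, of "- ?z - \<tau>"] by simp
  also have "S (- ?z - \<tau>) = - S (?z + \<tau>)"
    using wsigma_uminus[of "?z + \<tau>"] by simp
  also have "S (?z + \<tau>) = exp (qa \<tau> * ?z + qb \<tau>) * S ?z" by (rule wsigma_add[OF assms])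
  finally have "S ?z = exp (qa \<tau> * (- ?z - \<tau>) + qb \<tau>) * exp (qa \<tau> * ?z + qb \<tau>) * S ?z" by simp
  hence "1 = exp (qa \<tau> * (- ?z - \<tau>) + qb \<tau>) * exp (qa \<tau> * ?z + qb \<tau>)"
    using nz by simp
  also have "\<dots> = exp (- qa \<tau> * \<tau> + 2 * qb \<tau>)"
    unfolding exp_add[symmetric] by (rule arg_cong[of _ _ exp]) (simp add: algebra_simps)
  finally show ?thesis by simp
qed

end

section \<open>Entire functions with the quasi-periods of products of \<open>\<sigma>\<close>\<close>

lemma entire_compose:
  assumes "f holomorphic_on UNIV" "g holomorphic_on A"
  shows "(\<lambda>x. f (g x)) holomorphic_on A"
  using holomorphic_on_compose[OF assms(2) holomorphic_on_subset[OF assms(1)]] by (simp add: o_def)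

lemma entire_continuous:
  assumes "f holomorphic_on UNIV" "continuous_on A g"
  shows "continuous_on A (\<lambda>x. f (g x))"
  by (rule continuous_on_compose2[OF holomorphic_on_imp_continuous_on[OF assms(1)] assms(2)]) auto

lemma field_differentiable_eq_on_open:
  assumes "f field_differentiable at z" "open U" "z \<in> U" "\<And>x. x \<in> U \<Longrightarrow> f x = g x"
  shows "g field_differentiable at z"
  using assms unfolding field_differentiable_def by (metis has_field_derivative_transform_within_open)

context period_pair
begin

lemma real_coordinates:
  fixes z :: complex
  obtains a b :: real where "z = 2 * of_real a * \<omega>1 + 2 * of_real b * \<omega>3"
proof
  define a where "a = - Im (cnj \<omega>3 * z) / (2 * area)"
  define b where "b = Im (cnj \<omega>1 * z) / (2 * area)"
  have "of_real area * z = of_real area * (2 * of_real a * \<omega>1 + 2 * of_real b * \<omega>3)"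
  proof -
    have "of_real area * (2 * of_real a * \<omega>1 + 2 * of_real b * \<omega>3) =
      of_real (2 * area * a) * \<omega>1 + of_real (2 * area * b) * \<omega>3" by (simp add: algebra_simps)
    also have "2 * area * a = - Im (cnj \<omega>3 * z)" using area_nonzero by (simp add: a_def)
    also have "2 * area * b = Im (cnj \<omega>1 * z)" using area_nonzero by (simp add: b_def)
    also have "of_real (- Im (cnj \<omega>3 * z)) * \<omega>1 + of_real (Im (cnj \<omega>1 * z)) * \<omega>3 = of_real area * z"
      by (simp add: complex_eq_iff area_def algebra_simps)
    finally show ?thesis by (rule sym)
  qed
  thus "z = 2 * of_real a * \<omega>1 + 2 * of_real b * \<omega>3"
    using area_nonzero by (metis mult_cancel_left of_real_eq_0_iff)
qed

lemma elliptic_entire_constant: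
  assumes F: "F holomorphic_on UNIV" and per: "\<And>\<tau> z. \<tau> \<in> Lat \<Longrightarrow> F (z + \<tau>) = F z"
  shows "\<exists>c. \<forall>z. F z = c"
proof -
  let ?B = "2 * norm \<omega>1 + 2 * norm \<omega>3"
  have "range F \<subseteq> F ` cball 0 ?B"
  proof
    fix y assume "y \<in> range F"
    then obtain z where y: "y = F z" by auto
    obtain a b where z: "z = 2 * of_real a * \<omega>1 + 2 * of_real b * \<omega>3" by (rule real_coordinates)
    \<comment> \<open>Rounding down the real coordinates moves \<open>z\<close> into the fundamental
      parallelogram.\<close>
    define \<tau> where "\<tau> = 2 * of_int (- \<lfloor>a\<rfloor>) * \<omega>1 + 2 * of_int (- \<lfloor>b\<rfloor>) * \<omega>3"
    have \<tau>: "\<tau> \<in> Lat" unfolding Lat_iff \<tau>_def by blast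
    have "z + \<tau> = 2 * of_real (frac a) * \<omega>1 + 2 * of_real (frac b) * \<omega>3"
      by (simp add: z \<tau>_def frac_def algebra_simps)
    also have "norm \<dots> \<le> 2 * frac a * norm \<omega>1 + 2 * frac b * norm \<omega>3"
      by (rule norm_triangle_le) (simp add: norm_mult frac_ge_0)
    also have "\<dots> \<le> ?B"
      using frac_lt_1[of a] frac_lt_1[of b] by (intro add_mono) (auto intro!: mult_left_le_one_le simp: frac_ge_0 less_imp_le)
    finally have "z + \<tau> \<in> cball 0 ?B" by simp
    thus "y \<in> F ` cball 0 ?B" using per[OF \<tau>, of z] y by (metis imageI)
  qed
  moreover have "bounded (F ` cball 0 ?B)"
    by (intro compact_imp_bounded compact_continuous_image compact_cball)
       (use F holomorphic_on_imp_continuous_on continuous_on_subset in blast)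
  ultimately have "bounded (range F)" by (rule bounded_subset[rotated])
  from Liouville_theorem[OF F this] show ?thesis by (auto simp: constant_on_def)
qed

lemma wsigma_deriv_Lat:
  assumes "\<tau> \<in> Lat"
  shows "deriv S \<tau> \<noteq> 0"
proof -
  have "((\<lambda>z. S (z + \<tau>)) has_field_derivative (0 * S 0 + 1 * exp (qa \<tau> * 0 + qb \<tau>))) (at 0)"
  proof -
    have "((\<lambda>z. exp (qa \<tau> * z + qb \<tau>) * S z) has_field_derivative
        (exp (qa \<tau> * 0 + qb \<tau>) * qa \<tau> * S 0 + 1 * exp (qa \<tau> * 0 + qb \<tau>))) (at 0)"
      by (intro DERIV_mult wsigma_derivative_0) (auto intro!: derivative_eq_intros)
    thus ?thesis unfolding wsigma_add[OF assms] by simp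
  qed
  moreover have "((\<lambda>z. S (z + \<tau>)) has_field_derivative (deriv S \<tau> * 1)) (at 0)"
    by (rule DERIV_chain2[of S])
       (use holomorphic_derivI[OF wsigma_holomorphic[of UNIV] open_UNIV, of \<tau>] in \<open>auto intro!: derivative_eq_intros\<close>)
  ultimately have "deriv S \<tau> * 1 = 0 * S 0 + 1 * exp (qa \<tau> * 0 + qb \<tau>)" by (rule DERIV_unique[rotated])
  thus ?thesis by simp
qed

text \<open>The zeros of \<open>S\<close> are simple and form exactly the lattice, so the quotient
  extends holomorphically; its values at the lattice points are quotients of derivatives.\<close>

lemma divide_by_wsigma:
  assumes F: "F holomorphic_on UNIV" and z: "\<And>\<tau>. \<tau> \<in> Lat \<Longrightarrow> F (p + \<tau>) = 0"
  shows "\<exists>G. G holomorphic_on UNIV \<and> (\<forall>z. F z = S (z - p) * G z)"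
proof -
  define K where "K z = F (z + p)" for z
  have K: "K holomorphic_on UNIV" unfolding K_def[abs_def]
    by (intro entire_compose[OF F] holomorphic_intros)
  have K0: "K \<tau> = 0" if "\<tau> \<in> Lat" for \<tau> using z[OF that] by (simp add: K_def add.commute)
  define G where "G z = (if z \<in> Lat then deriv K z / deriv S z else K z / S z)" for z
  have "G field_differentiable at w" for w
  proof (cases "w \<in> Lat")
    case False
    have "(\<lambda>z. K z / S z) holomorphic_on - Lat"
      by (intro holomorphic_intros) (auto simp: wsigma_eq_0_iff intro: holomorphic_on_subset[OF K])
    hence "(\<lambda>z. K z / S z) field_differentiable at w"
      using closed_Lat False by (intro holomorphic_on_imp_differentiable_at[of _ "- Lat"]) (auto simp: open_closed)
    thus ?thesis
      by (rule field_differentiable_eq_on_open[of _ _ "- Lat"])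
         (use closed_Lat False in \<open>auto simp: open_closed G_def\<close>)
  next
    case True
    \<comment> \<open>The difference quotients of \<open>K\<close> and \<open>S\<close> at
      \<open>w\<close> are entire, and \<open>s w\<close> is the nonzero derivative of
      \<open>S\<close>, so near \<open>w\<close> their quotient is holomorphic and agrees with
      \<open>G\<close>.\<close>
    define k where "k z = (if z = w then deriv K w else (K z - K w) / (z - w))" for z
    define s where "s z = (if z = w then deriv S w else (S z - S w) / (z - w))" for z
    have k: "k holomorphic_on UNIV" unfolding k_def[abs_def] by (rule pole_lemma_open[OF K open_UNIV])
    have s: "s holomorphic_on UNIV" unfolding s_def[abs_def] by (rule pole_lemma_open[OF wsigma_holomorphic open_UNIV])
    define U where "U = {z. s z \<noteq> 0}"
    have U: "open U" unfolding U_def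
      by (intro open_Collect_neq continuous_intros holomorphic_on_imp_continuous_on[OF s])
    have wU: "w \<in> U" using wsigma_deriv_Lat[OF True] by (simp add: U_def s_def)
    have "(\<lambda>z. k z / s z) holomorphic_on U"
      by (intro holomorphic_on_divide) (auto simp: U_def intro: holomorphic_on_subset[OF k] holomorphic_on_subset[OF s])
    hence "(\<lambda>z. k z / s z) field_differentiable at w"
      by (rule holomorphic_on_imp_differentiable_at[OF _ U wU])
    thus ?thesis
    proof (rule field_differentiable_eq_on_open[OF _ U wU])
      fix z assume z: "z \<in> U"
      show "k z / s z = G z"
      proof (cases "z = w")
        case True
        thus ?thesis using \<open>w \<in> Lat\<close> by (simp add: k_def s_def G_def)
      next
        case False
        hence Sz: "S z \<noteq> 0" using z \<open>w \<in> Lat\<close> wsigma_eq_0_iff[of w] by (simp add: U_def s_def)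
        hence "z \<notin> Lat" using wsigma_eq_0_iff[of z] by simp
        thus ?thesis using False \<open>w \<in> Lat\<close> K0[of w] wsigma_eq_0_iff[of w] Sz
          by (simp add: k_def s_def G_def)
      qed
    qed
  qed
  hence G: "G holomorphic_on UNIV" by (simp add: holomorphic_on_def field_differentiable_at_within)
  have KG: "K z = S z * G z" for z
    using wsigma_eq_0_iff[of z] K0[of z] by (cases "z \<in> Lat") (simp_all add: G_def)
  have "(\<lambda>z. G (z - p)) holomorphic_on UNIV"
    by (intro entire_compose[OF G] holomorphic_intros)
  moreover have "F z = S (z - p) * G (z - p)" for z
    using KG[of "z - p"] by (simp add: K_def)
  ultimately show ?thesis by blast
qed

lemma divide_by_wsigma_prod:
  assumes "finite A" and F: "F holomorphic_on UNIV"
    and z: "\<And>a \<tau>. a \<in> A \<Longrightarrow> \<tau> \<in> Lat \<Longrightarrow> F (p a + \<tau>) = 0"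
    and d: "\<And>a a'. a \<in> A \<Longrightarrow> a' \<in> A \<Longrightarrow> a \<noteq> a' \<Longrightarrow> p a - p a' \<notin> Lat"
  shows "\<exists>G. G holomorphic_on UNIV \<and> (\<forall>z. F z = (\<Prod>a\<in>A. S (z - p a)) * G z)"
  using assms
proof (induction A rule: finite_induct)
  case empty
  thus ?case by auto
next
  case (insert a A)
  have "\<exists>G. G holomorphic_on UNIV \<and> (\<forall>z. F z = (\<Prod>a\<in>A. S (z - p a)) * G z)"
    by (rule insert.IH[OF F]) (simp_all add: insert.prems)
  then obtain G where G: "G holomorphic_on UNIV" "\<And>z. F z = (\<Prod>a\<in>A. S (z - p a)) * G z"
    by (elim exE conjE) simp
  have "G (p a + \<tau>) = 0" if "\<tau> \<in> Lat" for \<tau>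
  proof -
    have "(\<Prod>a'\<in>A. S (p a + \<tau> - p a')) \<noteq> 0"
    proof
      assume "(\<Prod>a'\<in>A. S (p a + \<tau> - p a')) = 0"
      then obtain a' where a': "a' \<in> A" "p a + \<tau> - p a' \<in> Lat"
        using insert.hyps by (auto simp: wsigma_eq_0_iff)
      hence "p a - p a' \<in> Lat" using Lat_add_iff[OF that, of "p a - p a'"] by (simp add: algebra_simps)
      thus False using insert.prems(3)[of a a'] a' insert.hyps by auto
    qed
    thus ?thesis using G(2)[of "p a + \<tau>"] insert.prems(2)[of a \<tau>] that by simp
  qed
  from divide_by_wsigma[OF G(1) this] obtain K where "K holomorphic_on UNIV" "\<And>z. G z = S (z - p a) * K z" by blast
  moreover from this have "F z = (\<Prod>a\<in>insert a A. S (z - p a)) * K z" for z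
    using G(2)[of z] insert.hyps by simp
  ultimately show ?case by blast
qed

section \<open>Theta functions of order one\<close>

lemma wsigma_eq_0_countable: "countable {x. S (x - p) = 0}" "countable {x. S (x + p) = 0}"
  by (simp_all add: wsigma_eq_0_iff countable_shifted_Lat)

text \<open>The difficulty is N(0) = 0; afterwards N / S is elliptic and entire, hence constant. The
  even part M has the same quasi-periods and vanishes at the half periods off the lattice. Dividing
  out the zeros at \<omega>1 and \<omega>3 leaves B, whose multipliers are inverse to those of S(x -
  \<omega>1 - \<omega>3). The product of the two is entire and elliptic, hence constant, and it
  vanishes at \<omega>1 + \<omega>3. Therefore B and M are zero.\<close>

lemma theta_one_aux:
  assumes N: "N holomorphic_on UNIV"
    and per: "\<And>\<tau> x. \<tau> \<in> Lat \<Longrightarrow> N (x + \<tau>) = exp (qa \<tau> * x + qb \<tau>) * N x"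
  shows "\<exists>c. \<forall>x. N x = c * S x"
proof -
  define M where "M x = N x + N (- x)" for x
  have M: "M holomorphic_on UNIV" unfolding M_def[abs_def]
    by (intro holomorphic_intros N entire_compose[OF N])
  have Mper: "M (x + \<tau>) = exp (qa \<tau> * x + qb \<tau>) * M x" if \<tau>: "\<tau> \<in> Lat" for x \<tau>
  proof -
    have "exp (qa \<tau> * x + qb \<tau>) * N (- x) =
        (exp (qa \<tau> * x + qb \<tau>) * exp (qa \<tau> * (- x - \<tau>) + qb \<tau>)) * N (- x - \<tau>)"
      using per[OF \<tau>, of "- x - \<tau>"] by simp
    also have "exp (qa \<tau> * x + qb \<tau>) * exp (qa \<tau> * (- x - \<tau>) + qb \<tau>) = exp (- qa \<tau> * \<tau> + 2 * qb \<tau>)"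
      unfolding exp_add[symmetric] by (rule arg_cong[of _ _ exp]) (simp add: algebra_simps)
    also have "\<dots> = 1" by (rule exp_qa_qb[OF \<tau>])
    finally have "exp (qa \<tau> * x + qb \<tau>) * N (- x) = N (- (x + \<tau>))" by simp
    thus ?thesis unfolding M_def using per[OF \<tau>, of x] by (simp only: distrib_left)
  qed
  \<comment> \<open>\<open>M\<close> is even, and passing from -\<omega> to \<omega> multiplies it
    by the value -1 of \<open>exp_qa_qb_double\<close>.\<close>
  have Mhalf: "M (\<omega> + \<tau>) = 0" if "\<omega> \<notin> Lat" "2 * \<omega> \<in> Lat" "\<tau> \<in> Lat" for \<omega> \<tau>
  proof -
    have "M \<omega> = - M (- \<omega>)"
      using Mper[OF that(2), of "- \<omega>"] exp_qa_qb_double[OF that(1,2)] by simp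
    moreover have "M (- \<omega>) = M \<omega>" by (simp add: M_def)
    ultimately have "M \<omega> = 0" by simp
    thus ?thesis using Mper[OF that(3), of \<omega>] by simp
  qed
  have "\<exists>B. B holomorphic_on UNIV \<and> (\<forall>z. M z = (\<Prod>a\<in>{\<omega>1, \<omega>3}. S (z - id a)) * B z)"
  proof (rule divide_by_wsigma_prod[OF _ M])
    show "M (id a + \<tau>) = 0" if "a \<in> {\<omega>1, \<omega>3}" "\<tau> \<in> Lat" for a \<tau>
      using that Mhalf half_sum_notin_Lat two_\<omega>1_in_Lat two_\<omega>3_in_Lat by auto
    show "id a - id a' \<notin> Lat" if "a \<in> {\<omega>1, \<omega>3}" "a' \<in> {\<omega>1, \<omega>3}" "a \<noteq> a'" for a a'
      using that half_sum_notin_Lat(4) Lat_minus_commute[of \<omega>1 \<omega>3] by auto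
  qed auto
  then obtain B where B: "B holomorphic_on UNIV" "\<And>z. M z = S (z - \<omega>1) * S (z - \<omega>3) * B z"
    using distinct_periods by (auto simp: mult.assoc)
  have Bc: "continuous_on U B" for U using B(1) holomorphic_on_imp_continuous_on continuous_on_subset by blast
  have c2: "countable {x. S (x - \<omega>1) * S (x - \<omega>3) = 0}"
    using wsigma_eq_0_countable by (simp add: Collect_disj_eq)
  have Bper: "B (x + \<tau>) * exp (qa \<tau> * (x - \<omega>1 - \<omega>3) + qb \<tau>) = B x" if \<tau>: "\<tau> \<in> Lat" for x \<tau>
  proof (rule cancel_off_countable[OF _ Bc c2])
    show "continuous_on UNIV (\<lambda>x. B (x + \<tau>) * exp (qa \<tau> * (x - \<omega>1 - \<omega>3) + qb \<tau>))"
      by (intro continuous_intros entire_continuous[OF B(1)])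
    fix x
    have "exp (qa \<tau> * x + qb \<tau>) * (S (x - \<omega>1) * S (x - \<omega>3) * B x) = M (x + \<tau>)"
      using Mper[OF \<tau>, of x] B(2)[of x] by simp
    also have "\<dots> = S ((x - \<omega>1) + \<tau>) * S ((x - \<omega>3) + \<tau>) * B (x + \<tau>)"
      using B(2)[of "x + \<tau>"] by (simp add: algebra_simps)
    also have "\<dots> = (exp (qa \<tau> * (x - \<omega>1) + qb \<tau>) * exp (qa \<tau> * (x - \<omega>3) + qb \<tau>)) * (S (x - \<omega>1) * S (x - \<omega>3)) * B (x + \<tau>)"
      unfolding wsigma_add[OF \<tau>] by (simp add: algebra_simps)
    also have "exp (qa \<tau> * (x - \<omega>1) + qb \<tau>) * exp (qa \<tau> * (x - \<omega>3) + qb \<tau>) =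
        exp (qa \<tau> * x + qb \<tau>) * exp (qa \<tau> * (x - \<omega>1 - \<omega>3) + qb \<tau>)"
      unfolding exp_add[symmetric] by (rule arg_cong[of _ _ exp]) (simp add: algebra_simps)
    finally have "exp (qa \<tau> * x + qb \<tau>) * (S (x - \<omega>1) * S (x - \<omega>3) * B x) =
       exp (qa \<tau> * x + qb \<tau>) * (S (x - \<omega>1) * S (x - \<omega>3) * (B (x + \<tau>) * exp (qa \<tau> * (x - \<omega>1 - \<omega>3) + qb \<tau>)))"
      by (simp add: mult_ac)
    thus "S (x - \<omega>1) * S (x - \<omega>3) * (B (x + \<tau>) * exp (qa \<tau> * (x - \<omega>1 - \<omega>3) + qb \<tau>)) =
        S (x - \<omega>1) * S (x - \<omega>3) * B x" by (simp only: mult_left_cancel[OF exp_not_eq_zero])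
  qed
  have "\<exists>c. \<forall>x. B x * S (x - \<omega>1 - \<omega>3) = c"
  proof (intro elliptic_entire_constant)
    show "(\<lambda>x. B x * S (x - \<omega>1 - \<omega>3)) holomorphic_on UNIV" by (intro holomorphic_intros B(1))
    fix \<tau> x assume \<tau>: "\<tau> \<in> Lat"
    have "S (x + \<tau> - \<omega>1 - \<omega>3) = exp (qa \<tau> * (x - \<omega>1 - \<omega>3) + qb \<tau>) * S (x - \<omega>1 - \<omega>3)"
      using wsigma_add[OF \<tau>, of "x - \<omega>1 - \<omega>3"] by (simp add: algebra_simps)
    with Bper[OF \<tau>, of x] show "B (x + \<tau>) * S (x + \<tau> - \<omega>1 - \<omega>3) = B x * S (x - \<omega>1 - \<omega>3)"
      by (metis mult.assoc)
  qed
  then obtain c where "\<forall>x. B x * S (x - \<omega>1 - \<omega>3) = c" ..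
  hence c: "B x * S (x - \<omega>1 - \<omega>3) = c" for x by (rule spec)
  have "c = 0" using c[of "\<omega>1 + \<omega>3"] by simp
  have "B x = 0" for x
    by (rule cancel_off_countable[OF Bc _ wsigma_eq_0_countable(1)[of "\<omega>1 + \<omega>3"]])
       (use c \<open>c = 0\<close> in \<open>auto simp: algebra_simps\<close>)
  hence "M 0 = 0" by (simp add: B(2))
  hence "N 0 = 0" by (simp add: M_def)
  hence "N (0 + \<tau>) = 0" if "\<tau> \<in> Lat" for \<tau> using per[OF that, of 0] by simp
  from divide_by_wsigma[OF N this] obtain G where G: "G holomorphic_on UNIV" "\<And>z. N z = S z * G z" by auto
  have G': "continuous_on UNIV (\<lambda>x. G (x + \<tau>))" for \<tau>
    by (intro entire_continuous[OF G(1)] continuous_intros)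
  have "G (x + \<tau>) = G x" if \<tau>: "\<tau> \<in> Lat" for x \<tau>
  proof (rule cancel_off_countable[OF G' holomorphic_on_imp_continuous_on[OF G(1)]])
    show "countable {x. S x = 0}" using wsigma_eq_0_countable(1)[of 0] by simp
    show "S x * G (x + \<tau>) = S x * G x" for x
      using per[OF \<tau>, of x] G(2)[of x] G(2)[of "x + \<tau>"] wsigma_add[OF \<tau>, of x] by simp
  qed
  from elliptic_entire_constant[OF G(1) this] obtain c where "\<forall>z. G z = c" ..
  hence "N x = c * S x" for x using G(2)[of x] by simp
  thus ?thesis by (intro exI[of _ c] allI)
qed

lemma theta_one:
  assumes N: "N holomorphic_on UNIV"
    and per: "\<And>\<tau> x. \<tau> \<in> Lat \<Longrightarrow> N (x + \<tau>) = exp (qa \<tau> * (x + \<beta>) + qb \<tau>) * N x"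
  shows "\<exists>c. \<forall>x. N x = c * S (x + \<beta>)"
proof -
  have 1: "(\<lambda>x. N (x - \<beta>)) holomorphic_on UNIV"
    by (intro entire_compose[OF N] holomorphic_intros)
  have 2: "N (x + \<tau> - \<beta>) = exp (qa \<tau> * x + qb \<tau>) * N (x - \<beta>)" if "\<tau> \<in> Lat" for \<tau> x
    using per[OF that, of "x - \<beta>"] by (simp add: algebra_simps)
  from theta_one_aux[of "\<lambda>x. N (x - \<beta>)", OF 1 2] obtain c where c: "\<forall>x. N (x - \<beta>) = c * S x" ..
  have "N x = c * S (x + \<beta>)" for x using spec[OF c, of "x + \<beta>"] by simp
  thus ?thesis by (intro exI[of _ c] allI)
qed

section \<open>Differences of values of wp as quotients of sigma\<close>

lemma wsigma_deriv_eq: "z \<notin> Lat \<Longrightarrow> deriv S z = S z * Z z"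
  by (rule DERIV_imp_deriv[OF wsigma_derivative])

lemma wsigma_deriv_0 [simp]: "deriv S 0 = 1"
  by (rule DERIV_imp_deriv[OF wsigma_derivative_0])

lemma wsigma_deriv_has_derivative: "(S has_field_derivative deriv S z) (at z)"
  by (rule holomorphic_derivI[OF wsigma_holomorphic[of UNIV]]) auto

lemma wsigma_deriv_holomorphic: "deriv S holomorphic_on U"
  by (rule holomorphic_on_subset[OF holomorphic_deriv[OF wsigma_holomorphic[of UNIV]]]) auto

lemma wsigma_deriv2_eq:
  assumes "z \<notin> Lat"
  shows "deriv (deriv S) z = S z * (Z z ^ 2 - P z)"
proof -
  have "deriv (deriv S) z = deriv (\<lambda>z. S z * Z z) z"
    by (rule deriv_eq_on_open[of "- Lat"]) (use assms closed_Lat wsigma_deriv_eq in \<open>auto simp: open_closed\<close>)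
  also have "\<dots> = S z * Z z * Z z + (- P z) * S z"
    by (rule DERIV_imp_deriv[OF DERIV_mult[OF wsigma_derivative[OF assms] wzeta_derivative[OF assms]]])
  finally show ?thesis by (simp add: algebra_simps power2_eq_square)
qed

lemma wp_numerator: "z \<notin> Lat \<Longrightarrow> P z * S z ^ 2 = deriv S z ^ 2 - S z * deriv (deriv S) z"
  by (simp add: wsigma_deriv_eq wsigma_deriv2_eq algebra_simps power2_eq_square)

text \<open>After clearing the double pole the numerator N is entire, has the squared multiplier of
  \<open>S\<close> and vanishes at the translates of \<open>y\<close>. Removing S(x - y) leaves the
  quasi-periods of S(x + y), which \<open>theta_one\<close> identifies; N(0) = 1 shows that c is not
  zero. Half periods \<open>y\<close>, where both zeros coincide, are covered as well.\<close>

lemma wp_diff_factor: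
  assumes y: "y \<notin> Lat"
  obtains c where "c \<noteq> 0" "\<forall>x. x \<notin> Lat \<longrightarrow> P x - P y = c * S (x - y) * S (x + y) / S x ^ 2"
proof -
  define N where "N x = deriv S x ^ 2 - S x * deriv (deriv S) x - P y * S x ^ 2" for x
  have N: "N holomorphic_on UNIV" unfolding N_def[abs_def]
    by (intro holomorphic_intros wsigma_deriv_holomorphic holomorphic_deriv) auto
  have Neq: "N x = (P x - P y) * S x ^ 2" if "x \<notin> Lat" for x
    using wp_numerator[OF that] by (simp add: N_def algebra_simps)
  have Nper: "N (x + \<tau>) = exp (qa \<tau> * x + qb \<tau>) ^ 2 * N x" if \<tau>: "\<tau> \<in> Lat" for x \<tau>
  proof (rule eq_off_countable[of "\<lambda>x. N (x + \<tau>)" "\<lambda>x. exp (qa \<tau> * x + qb \<tau>) ^ 2 * N x", OF _ _ countable_Lat])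
    show "continuous_on UNIV (\<lambda>x. N (x + \<tau>))"
      by (intro entire_continuous[OF N] continuous_intros)
    show "continuous_on UNIV (\<lambda>x. exp (qa \<tau> * x + qb \<tau>) ^ 2 * N x)"
      by (intro continuous_intros holomorphic_on_imp_continuous_on[OF N])
    show "N (x + \<tau>) = exp (qa \<tau> * x + qb \<tau>) ^ 2 * N x" if "x \<notin> Lat" for x
      using that \<tau> by (simp add: Neq wp_periodic wsigma_add power_mult_distrib)
  qed
  have "N (y + \<tau>) = 0" if "\<tau> \<in> Lat" for \<tau>
    using y that by (simp add: Neq wp_periodic)
  from divide_by_wsigma[OF N this] obtain G where G: "G holomorphic_on UNIV" "\<And>z. N z = S (z - y) * G z" by blast
  have "G (x + \<tau>) = exp (qa \<tau> * (x + y) + qb \<tau>) * G x" if \<tau>: "\<tau> \<in> Lat" for x \<tau>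
  proof (rule cancel_off_countable[of "\<lambda>x. G (x + \<tau>)" "\<lambda>x. exp (qa \<tau> * (x + y) + qb \<tau>) * G x",
        OF _ _ wsigma_eq_0_countable(1)[of y]])
    show "continuous_on UNIV (\<lambda>x. G (x + \<tau>))"
      by (intro entire_continuous[OF G(1)] continuous_intros)
    show "continuous_on UNIV (\<lambda>x. exp (qa \<tau> * (x + y) + qb \<tau>) * G x)"
      by (intro continuous_intros holomorphic_on_imp_continuous_on[OF G(1)])
    fix x
    have "exp (qa \<tau> * (x - y) + qb \<tau>) * (S (x - y) * G (x + \<tau>)) = N (x + \<tau>)"
      using G(2)[of "x + \<tau>"] wsigma_add[OF \<tau>, of "x - y"] by (simp add: algebra_simps)
    also have "\<dots> = exp (qa \<tau> * x + qb \<tau>) ^ 2 * (S (x - y) * G x)"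
      using Nper[OF \<tau>, of x] G(2)[of x] by simp
    also have "exp (qa \<tau> * x + qb \<tau>) ^ 2 = exp (qa \<tau> * (x - y) + qb \<tau>) * exp (qa \<tau> * (x + y) + qb \<tau>)"
      unfolding power2_eq_square exp_add[symmetric] by (rule arg_cong[of _ _ exp]) (simp add: algebra_simps)
    finally show "S (x - y) * G (x + \<tau>) = S (x - y) * (exp (qa \<tau> * (x + y) + qb \<tau>) * G x)"
      by (simp add: mult_ac)
  qed
  from theta_one[OF G(1) this] obtain c where "\<forall>x. G x = c * S (x + y)" ..
  hence c: "G x = c * S (x + y)" for x by (rule spec)
  have "N 0 = 1" by (simp add: N_def)
  hence "c \<noteq> 0" using G(2)[of 0] c[of 0] by auto
  have "P x - P y = c * S (x - y) * S (x + y) / S x ^ 2" if "x \<notin> Lat" for x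
  proof -
    have "S x \<noteq> 0" using that by (simp add: wsigma_eq_0_iff)
    thus ?thesis using Neq[OF that] G(2)[of x] c[of x] by (simp add: field_simps)
  qed
  with \<open>c \<noteq> 0\<close> show ?thesis by (intro that allI impI)
qed

lemma wp_eq_iff:
  assumes "x \<notin> Lat" "y \<notin> Lat"
  shows "P x = P y \<longleftrightarrow> x - y \<in> Lat \<or> x + y \<in> Lat"
proof -
  obtain c where c: "c \<noteq> 0" "\<forall>x. x \<notin> Lat \<longrightarrow> P x - P y = c * S (x - y) * S (x + y) / S x ^ 2"
    by (rule wp_diff_factor[OF assms(2)])
  have "S x \<noteq> 0" using assms(1) by (simp add: wsigma_eq_0_iff)
  moreover have "P x - P y = c * S (x - y) * S (x + y) / S x ^ 2" by (rule c(2)[rule_format, OF assms(1)])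
  ultimately have "P x - P y = 0 \<longleftrightarrow> S (x - y) = 0 \<or> S (x + y) = 0"
    using c(1) by (simp only: divide_eq_0_iff mult_eq_0_iff power_eq_0_iff) simp
  thus ?thesis by (simp add: wsigma_eq_0_iff)
qed

text \<open>When the factorisation is differentiated at \<open>y\<close>, only the simple zero of
  S(x - y) contributes, and the cofactor at \<open>y\<close> is a nonzero multiple of S(2
  y).\<close>

lemma wp_deriv_nonzero:
  assumes y: "y \<notin> Lat" "2 * y \<notin> Lat"
  shows "deriv P y \<noteq> 0"
proof -
  obtain c where c: "c \<noteq> 0" "\<forall>x. x \<notin> Lat \<longrightarrow> P x - P y = c * S (x - y) * S (x + y) / S x ^ 2"
    by (rule wp_diff_factor[OF y(1)])
  define h where "h x = c * S (x + y) / S x ^ 2" for x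
  have "h holomorphic_on - Lat"
    unfolding h_def[abs_def] by (intro holomorphic_intros) (auto simp: wsigma_eq_0_iff)
  hence h: "(h has_field_derivative deriv h y) (at y)"
    by (rule holomorphic_derivI) (use closed_Lat y in \<open>auto simp: open_closed\<close>)
  have s: "((\<lambda>x. S (x - y)) has_field_derivative 1 * 1) (at y)"
    by (rule DERIV_chain2[of S]) (use wsigma_derivative_0 in \<open>auto intro!: derivative_eq_intros\<close>)
  have "((\<lambda>x. P y + S (x - y) * h x) has_field_derivative 0 + (1 * 1 * h y + deriv h y * S (y - y))) (at y)"
    by (intro DERIV_add DERIV_const DERIV_mult s h)
  hence "(P has_field_derivative 0 + (1 * 1 * h y + deriv h y * S (y - y))) (at y)"
  proof (rule has_field_derivative_transform_within_open[of _ _ _ "- Lat"])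
    fix x assume "x \<in> - Lat"
    thus "P y + S (x - y) * h x = P x" using c(2)[rule_format, of x] by (simp add: h_def mult_ac diff_eq_eq)
  qed (use closed_Lat y in \<open>auto simp: open_closed\<close>)
  from DERIV_imp_deriv[OF this] have "deriv P y = h y" by simp
  moreover have "h y \<noteq> 0" using c(1) y by (simp add: h_def wsigma_eq_0_iff flip: mult_2)
  ultimately show ?thesis by simp
qed

section \<open>Poles in the half periods\<close>

text \<open>The common denominator of functions with poles in the half periods. As 2
  \<open>hp i\<close> is a period, S(x + hp i) vanishes exactly at the points congruent to
  \<open>hp i\<close>, so the sign of the shift is immaterial.\<close>

definition Theta :: "(nat \<Rightarrow> nat) \<Rightarrow> complex \<Rightarrow> complex" where
  "Theta n x = (\<Prod>i\<le>3. S (x + hp i) ^ n i)"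

definition theta_exponent :: "(nat \<Rightarrow> nat) \<Rightarrow> complex \<Rightarrow> complex \<Rightarrow> complex" where
  "theta_exponent n \<tau> x = (\<Sum>i\<le>3. of_nat (n i) * (qa \<tau> * (x + hp i) + qb \<tau>))"

lemma Theta_holomorphic: "Theta n holomorphic_on U"
  unfolding Theta_def[abs_def] by (intro holomorphic_intros)

lemma Theta_nonzero: "x \<notin> Hpts \<Longrightarrow> Theta n x \<noteq> 0"
  by (auto simp: Theta_def wsigma_eq_0_iff Hpts_iff)

lemma wsigma_half_nonzero: "x \<notin> Hpts \<Longrightarrow> i \<le> 3 \<Longrightarrow> S (x + hp i) \<noteq> 0"
  by (auto simp: wsigma_eq_0_iff Hpts_iff)

lemma wsigma_nonzero: "x \<notin> Hpts \<Longrightarrow> S x \<noteq> 0"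
  using wsigma_half_nonzero[of x 0] by simp

lemma Theta_quasi_periodic:
  assumes "\<tau> \<in> Lat"
  shows "Theta n (x + \<tau>) = exp (theta_exponent n \<tau> x) * Theta n x"
proof -
  have "S (x + \<tau> + hp i) ^ n i = exp (of_nat (n i) * (qa \<tau> * (x + hp i) + qb \<tau>)) * S (x + hp i) ^ n i" for i
  proof -
    have "S (x + \<tau> + hp i) = exp (qa \<tau> * (x + hp i) + qb \<tau>) * S (x + hp i)"
      using wsigma_add[OF assms, of "x + hp i"] by (simp add: algebra_simps)
    thus ?thesis by (simp add: power_mult_distrib exp_of_nat_mult)
  qed
  thus ?thesis by (simp add: Theta_def theta_exponent_def exp_sum prod.distrib)
qed

lemma Theta_remove:
  assumes "i \<le> 3"
  shows "Theta n x = S (x + hp i) ^ n i * (\<Prod>k\<in>{..3} - {i}. S (x + hp k) ^ n k)"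
  unfolding Theta_def by (rule prod.remove) (use assms in auto)

lemma Theta_decrease:
  assumes "i \<le> 3" "n i > 0"
  shows "Theta n x = S (x + hp i) * Theta (n(i := n i - 1)) x"
proof -
  have "S (x + hp i) ^ n i = S (x + hp i) * S (x + hp i) ^ (n i - 1)"
    using assms(2) by (cases "n i") auto
  thus ?thesis using assms(1) by (simp add: Theta_remove[OF assms(1)])
qed

lemma Theta_add: "Theta (\<lambda>i. n i + m i) x = Theta n x * Theta m x"
  by (simp add: Theta_def power_add prod.distrib)

text \<open>A pole of order at most \<open>n i\<close> at \<open>- hp i\<close>, and holomorphic elsewhere.\<close>
definition pole_le :: "(nat \<Rightarrow> nat) \<Rightarrow> (complex \<Rightarrow> complex) \<Rightarrow> bool" where
  "pole_le n f \<longleftrightarrow> (\<exists>F. F holomorphic_on UNIV \<and> (\<forall>x. x \<notin> Hpts \<longrightarrow> f x * Theta n x = F x))"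

definition numer :: "(nat \<Rightarrow> nat) \<Rightarrow> (complex \<Rightarrow> complex) \<Rightarrow> complex \<Rightarrow> complex" where
  "numer n f = (SOME F. F holomorphic_on UNIV \<and> (\<forall>x. x \<notin> Hpts \<longrightarrow> f x * Theta n x = F x))"

lemma numer:
  assumes "pole_le n f"
  shows numer_holomorphic: "numer n f holomorphic_on UNIV"
    and numer_eq: "x \<notin> Hpts \<Longrightarrow> f x * Theta n x = numer n f x"
proof -
  have "numer n f holomorphic_on UNIV \<and> (\<forall>x. x \<notin> Hpts \<longrightarrow> f x * Theta n x = numer n f x)"
    unfolding numer_def by (rule someI_ex[OF assms[unfolded pole_le_def]])
  thus "numer n f holomorphic_on UNIV" "x \<notin> Hpts \<Longrightarrow> f x * Theta n x = numer n f x" by auto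
qed

lemma pole_leI:
  assumes "F holomorphic_on UNIV" "\<And>x. x \<notin> Hpts \<Longrightarrow> f x * Theta n x = F x"
  shows "pole_le n f"
  using assms unfolding pole_le_def by auto

lemma entire_eq_off_Hpts:
  assumes "F holomorphic_on UNIV" "G holomorphic_on UNIV" "\<And>x. x \<notin> Hpts \<Longrightarrow> F x = G x"
  shows "F x = G x"
  by (rule eq_off_countable[OF _ _ countable_Hpts assms(3)])
     (use assms in \<open>auto intro: holomorphic_on_imp_continuous_on\<close>)

lemma numer_unique:
  assumes "F holomorphic_on UNIV" "\<And>x. x \<notin> Hpts \<Longrightarrow> f x * Theta n x = F x"
  shows "numer n f = F"
proof
  fix x
  have p: "pole_le n f" by (rule pole_leI[OF assms])
  show "numer n f x = F x"
    by (rule entire_eq_off_Hpts[OF numer_holomorphic[OF p] assms(1)])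
       (use numer_eq[OF p] assms(2) in simp)
qed

lemma pole_le_holomorphic:
  assumes "pole_le n f"
  shows "f holomorphic_on - Hpts"
proof -
  have "(\<lambda>x. numer n f x / Theta n x) holomorphic_on - Hpts"
    by (intro holomorphic_intros Theta_holomorphic holomorphic_on_subset[OF numer_holomorphic[OF assms]])
       (auto simp: Theta_nonzero)
  thus ?thesis
    by (rule holomorphic_transform) (use numer_eq[OF assms] Theta_nonzero in \<open>auto simp: field_simps\<close>)
qed

lemma pole_le_diff:
  assumes "pole_le n f" "pole_le n g"
  shows "pole_le n (\<lambda>x. f x - c * g x)"
    and "numer n (\<lambda>x. f x - c * g x) = (\<lambda>x. numer n f x - c * numer n g x)"
proof -
  have h: "(\<lambda>x. numer n f x - c * numer n g x) holomorphic_on UNIV"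
    by (intro holomorphic_intros numer_holomorphic assms)
  have e: "(f x - c * g x) * Theta n x = numer n f x - c * numer n g x" if "x \<notin> Hpts" for x
    using numer_eq[OF assms(1) that] numer_eq[OF assms(2) that] by (simp add: algebra_simps)
  show "pole_le n (\<lambda>x. f x - c * g x)" by (rule pole_leI[OF h e])
  show "numer n (\<lambda>x. f x - c * g x) = (\<lambda>x. numer n f x - c * numer n g x)"
    by (rule numer_unique[OF h e])
qed

lemma pole_le_add:
  assumes "pole_le n f" "pole_le n g"
  shows "pole_le n (\<lambda>x. f x + g x)"
  using pole_le_diff(1)[OF assms, of "- 1"] by simp

lemma pole_le_mult:
  assumes "pole_le n f" "pole_le m g"
  shows "pole_le (\<lambda>i. n i + m i) (\<lambda>x. f x * g x)"
proof (rule pole_leI)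
  show "(\<lambda>x. numer n f x * numer m g x) holomorphic_on UNIV"
    by (intro holomorphic_intros numer_holomorphic assms)
  show "f x * g x * Theta (\<lambda>i. n i + m i) x = numer n f x * numer m g x" if "x \<notin> Hpts" for x
  proof -
    have "f x * g x * Theta (\<lambda>i. n i + m i) x = (f x * Theta n x) * (g x * Theta m x)"
      by (simp add: Theta_add)
    thus ?thesis using numer_eq[OF assms(1) that] numer_eq[OF assms(2) that] by simp
  qed
qed

lemma pole_le_entire: "f holomorphic_on UNIV \<Longrightarrow> pole_le (\<lambda>_. 0) f"
  by (rule pole_leI[of f]) (simp_all add: Theta_def)

lemma pole_le_mono:
  assumes "pole_le n f" "\<And>i. i \<le> 3 \<Longrightarrow> n i \<le> m i"
  shows "pole_le m f"
proof (rule pole_leI)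
  show "(\<lambda>x. numer n f x * Theta (\<lambda>i. m i - n i) x) holomorphic_on UNIV"
    by (intro holomorphic_intros numer_holomorphic assms Theta_holomorphic)
  show "f x * Theta m x = numer n f x * Theta (\<lambda>i. m i - n i) x" if "x \<notin> Hpts" for x
  proof -
    have "Theta m x = Theta (\<lambda>i. n i + (m i - n i)) x"
      unfolding Theta_def by (rule prod.cong) (use assms(2) in auto)
    thus ?thesis using numer_eq[OF assms(1) that] by (simp add: Theta_add algebra_simps)
  qed
qed

section \<open>Multiplicative quasi-periods and the removal of poles\<close>

definition qper :: "(complex \<Rightarrow> complex) \<Rightarrow> (complex \<Rightarrow> complex) \<Rightarrow> bool" where
  "qper \<rho> f \<longleftrightarrow> (\<forall>\<tau>\<in>Lat. \<forall>x. x \<notin> Hpts \<longrightarrow> f (x + \<tau>) = \<rho> \<tau> * f x)"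

lemma qperD: "qper \<rho> f \<Longrightarrow> \<tau> \<in> Lat \<Longrightarrow> x \<notin> Hpts \<Longrightarrow> f (x + \<tau>) = \<rho> \<tau> * f x"
  by (simp add: qper_def)

lemma qper_diff: "qper \<rho> f \<Longrightarrow> qper \<rho> g \<Longrightarrow> qper \<rho> (\<lambda>x. f x - c * g x)"
  by (simp add: qper_def algebra_simps)

lemma qper_deriv:
  assumes "qper \<rho> f" "f holomorphic_on - Hpts"
  shows "qper \<rho> (deriv f)"
  unfolding qper_def
proof (intro ballI allI impI)
  fix \<tau> x assume \<tau>: "\<tau> \<in> Lat" and x: "x \<notin> Hpts"
  have d: "(f has_field_derivative deriv f y) (at y)" if "y \<notin> Hpts" for y
    by (rule holomorphic_derivI[OF assms(2) open_off_Hpts]) (use that in auto)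
  have "((\<lambda>y. f (y + \<tau>)) has_field_derivative deriv f (x + \<tau>) * 1) (at x)"
    by (rule DERIV_chain2[of f], rule d) (use x \<tau> in \<open>auto intro!: derivative_eq_intros\<close>)
  hence "((\<lambda>y. \<rho> \<tau> * f y) has_field_derivative deriv f (x + \<tau>) * 1) (at x)"
    by (rule has_field_derivative_transform_within_open[OF _ open_off_Hpts])
       (use x qperD[OF assms(1) \<tau>] in auto)
  moreover have "((\<lambda>y. \<rho> \<tau> * f y) has_field_derivative \<rho> \<tau> * deriv f x) (at x)"
    by (intro DERIV_cmult d x)
  ultimately show "deriv f (x + \<tau>) = \<rho> \<tau> * deriv f x" using DERIV_unique by fastforce
qed

lemma numer_quasi_periodic:
  assumes "pole_le n f" "qper \<rho> f" "\<tau> \<in> Lat"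
  shows "numer n f (x + \<tau>) = \<rho> \<tau> * exp (theta_exponent n \<tau> x) * numer n f x"
proof (rule entire_eq_off_Hpts[of "\<lambda>x. numer n f (x + \<tau>)" "\<lambda>x. \<rho> \<tau> * exp (theta_exponent n \<tau> x) * numer n f x"])
  show "(\<lambda>x. numer n f (x + \<tau>)) holomorphic_on UNIV"
    by (intro entire_compose[OF numer_holomorphic[OF assms(1)]] holomorphic_intros)
  show "(\<lambda>x. \<rho> \<tau> * exp (theta_exponent n \<tau> x) * numer n f x) holomorphic_on UNIV"
    unfolding theta_exponent_def by (intro holomorphic_intros numer_holomorphic assms)
  fix x assume x: "x \<notin> Hpts"
  hence "numer n f (x + \<tau>) = f (x + \<tau>) * Theta n (x + \<tau>)"
    using numer_eq[OF assms(1), of "x + \<tau>"] assms(3) by simp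
  also have "\<dots> = \<rho> \<tau> * exp (theta_exponent n \<tau> x) * (f x * Theta n x)"
    using qperD[OF assms(2,3) x] Theta_quasi_periodic[OF assms(3)] by simp
  finally show "numer n f (x + \<tau>) = \<rho> \<tau> * exp (theta_exponent n \<tau> x) * numer n f x"
    using numer_eq[OF assms(1) x] by simp
qed

text \<open>The scalar cancels the two numerators at \<open>- hp i\<close>. Quasi-periodicity
  spreads this zero over all lattice translates, so a factor S(x + hp i) divides out.\<close>

lemma reduce_pole:
  assumes "pole_le n f" "pole_le n g" "qper \<rho> f" "qper \<rho> g" "i \<le> 3" "n i > 0" "numer n g (- hp i) \<noteq> 0"
  shows "\<exists>c. pole_le (n(i := n i - 1)) (\<lambda>x. f x - c * g x)"
proof -
  define c where "c = numer n f (- hp i) / numer n g (- hp i)"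
  define h where "h x = f x - c * g x" for x
  have h: "pole_le n h" "qper \<rho> h" "numer n h (- hp i) = 0"
    unfolding h_def[abs_def] using pole_le_diff[OF assms(1,2), of c] qper_diff[OF assms(3,4), of c] assms(7)
    by (simp_all add: c_def)
  have "numer n h (- hp i + \<tau>) = 0" if "\<tau> \<in> Lat" for \<tau>
    using numer_quasi_periodic[OF h(1,2) that, of "- hp i"] h(3) by simp
  from divide_by_wsigma[OF numer_holomorphic[OF h(1)] this]
  obtain G where G: "G holomorphic_on UNIV" "\<And>z. numer n h z = S (z + hp i) * G z" by auto
  have "pole_le (n(i := n i - 1)) h"
  proof (rule pole_leI[OF G(1)])
    fix x assume x: "x \<notin> Hpts"
    have "S (x + hp i) * (h x * Theta (n(i := n i - 1)) x) = S (x + hp i) * G x"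
      using numer_eq[OF h(1) x] G(2)[of x] Theta_decrease[of i n x] assms(5,6) by (simp only: mult_ac)
    thus "h x * Theta (n(i := n i - 1)) x = G x" using wsigma_half_nonzero[OF x assms(5)] by simp
  qed
  thus ?thesis unfolding h_def[abs_def] by (rule exI)
qed

text \<open>In contrast to \<open>pole_le\<close> this looks at a single half period and fixes the
  order there, so it yields both pole bound and nonzero leading coefficient for every order function
  \<open>n\<close> with \<open>n i = m\<close>.\<close>

definition exact :: "nat \<Rightarrow> nat \<Rightarrow> (complex \<Rightarrow> complex) \<Rightarrow> bool" where
  "exact i m g \<longleftrightarrow> (\<exists>N. N holomorphic_on UNIV \<and> (\<forall>x. x \<notin> Hpts \<longrightarrow> g x * S (x + hp i) ^ m = N x) \<and> N (- hp i) \<noteq> 0)"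

lemma exact_pole_le:
  assumes "exact i (n i) g" "i \<le> 3"
  shows "pole_le n g" "numer n g (- hp i) \<noteq> 0"
proof -
  obtain N where N: "N holomorphic_on UNIV" "\<And>x. x \<notin> Hpts \<Longrightarrow> g x * S (x + hp i) ^ n i = N x" "N (- hp i) \<noteq> 0"
    using assms(1) unfolding exact_def by (elim exE conjE) simp
  let ?R = "\<lambda>x. \<Prod>k\<in>{..3} - {i}. S (x + hp k) ^ n k"
  have h: "(\<lambda>x. N x * ?R x) holomorphic_on UNIV"
    by (intro holomorphic_intros N(1))
  have e: "g x * Theta n x = N x * ?R x" if "x \<notin> Hpts" for x
    using N(2)[OF that] by (simp add: Theta_remove[OF assms(2)] mult_ac flip: N(2)[OF that])
  show "pole_le n g" by (rule pole_leI[OF h e])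
  have "S (- hp i + hp k) \<noteq> 0" if "k \<le> 3" "k \<noteq> i" for k
    using half_period_diff_notin[OF that(1) assms(2) that(2)] by (simp add: wsigma_eq_0_iff)
  hence "?R (- hp i) \<noteq> 0" by auto
  moreover have "numer n g = (\<lambda>x. N x * ?R x)" by (rule numer_unique[OF h e])
  ultimately show "numer n g (- hp i) \<noteq> 0" using N(3) by simp
qed

lemma exact_holomorphic: "exact i m g \<Longrightarrow> i \<le> 3 \<Longrightarrow> g holomorphic_on - Hpts"
  using exact_pole_le(1)[of i "\<lambda>_. m" g] pole_le_holomorphic by blast

text \<open>At the pole the numerator of the derivative has the value -m N(- hp i): S'(0) = 1, and
  the other term carries a factor S. This is nonzero because m is positive.\<close>

lemma exact_deriv:
  assumes "exact i m g" "m > 0" "i \<le> 3"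
  shows "exact i (Suc m) (deriv g)"
proof -
  obtain N where N: "N holomorphic_on UNIV" "\<And>x. x \<notin> Hpts \<Longrightarrow> g x * S (x + hp i) ^ m = N x" "N (- hp i) \<noteq> 0"
    using assms(1) unfolding exact_def by (elim exE conjE) simp
  obtain k where k: "m = Suc k" using assms(2) by (cases m) auto
  have dS: "((\<lambda>x. S (x + hp i)) has_field_derivative deriv S (x + hp i)) (at x)" for x
  proof -
    have "((\<lambda>x. S (x + hp i)) has_field_derivative deriv S (x + hp i) * 1) (at x)"
      by (rule DERIV_chain2[of S], rule wsigma_deriv_has_derivative) (auto intro!: derivative_eq_intros)
    thus ?thesis by simp
  qed
  define M where "M x = deriv N x * S (x + hp i) - of_nat m * (N x * deriv S (x + hp i))" for x
  have "M holomorphic_on UNIV" unfolding M_def[abs_def]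
    by (intro holomorphic_intros holomorphic_deriv N(1) entire_compose[OF wsigma_deriv_holomorphic]) auto
  moreover have "M (- hp i) \<noteq> 0" using N(3) assms(2) by (simp add: M_def)
  moreover have "deriv g x * S (x + hp i) ^ Suc m = M x" if x: "x \<notin> Hpts" for x
  proof -
    have g: "(g has_field_derivative deriv g x) (at x)"
      by (rule holomorphic_derivI[OF exact_holomorphic[OF assms(1,3)] open_off_Hpts]) (use x in auto)
    have "((\<lambda>x. g x * S (x + hp i) ^ m) has_field_derivative
        deriv g x * S (x + hp i) ^ m + of_nat m * (deriv S (x + hp i) * S (x + hp i) ^ (m - 1)) * g x) (at x)"
      using DERIV_mult[OF g DERIV_power[OF dS, of m]] by simp
    hence "(N has_field_derivative
        deriv g x * S (x + hp i) ^ m + of_nat m * (deriv S (x + hp i) * S (x + hp i) ^ (m - 1)) * g x) (at x)"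
      by (rule has_field_derivative_transform_within_open[OF _ open_off_Hpts]) (use x N(2) in auto)
    from DERIV_imp_deriv[OF this]
    have "deriv N x = deriv g x * S (x + hp i) ^ m + of_nat m * (deriv S (x + hp i) * S (x + hp i) ^ (m - 1)) * g x" .
    thus ?thesis using N(2)[OF x] by (simp add: M_def k algebra_simps flip: N(2)[OF x])
  qed
  ultimately show ?thesis unfolding exact_def by (intro exI[of _ M]) simp
qed

lemma exact_higher_deriv:
  assumes "exact i m g" "m > 0" "i \<le> 3"
  shows "exact i (m + j) ((deriv ^^ j) g)"
  using assms by (induction j) (auto intro: exact_deriv)

lemma qper_higher_deriv:
  assumes "qper \<rho> g" "exact i m g" "m > 0" "i \<le> 3"
  shows "qper \<rho> ((deriv ^^ j) g)"
proof (induction j)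
  case (Suc j)
  show ?case using qper_deriv[OF Suc exact_holomorphic[OF exact_higher_deriv[OF assms(2-4)] assms(4)]] by simp
qed (use assms in simp)

definition pole_index :: "(nat \<Rightarrow> nat) \<Rightarrow> (nat \<Rightarrow> nat) \<Rightarrow> (nat \<times> nat) set" where
  "pole_index m n = (SIGMA i:{..3}. {m i..<n i})"

lemma finite_pole_index [simp]: "finite (pole_index m n)"
  by (simp add: pole_index_def)

text \<open>Induction on the total excess of n over m, lowering one pole order per step with
  \<open>reduce_pole\<close>. The family \<open>B\<close>, the floor \<open>m\<close> and the base
  function \<open>B0\<close> are left open, so that the same induction yields the expansion in
  derivatives of Phi and the one in derivatives of wp.\<close>

lemma principal_part_expansion:
  assumes red: "\<And>n i. i \<le> 3 \<Longrightarrow> m i < n i \<Longrightarrow> (\<forall>k\<le>3. m k \<le> n k) \<Longrightarrow>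
      pole_le n (B (i, n i - 1)) \<and> numer n (B (i, n i - 1)) (- hp i) \<noteq> 0"
    and per: "\<And>i j. i \<le> 3 \<Longrightarrow> m i \<le> j \<Longrightarrow> qper \<rho> (B (i, j))"
    and base: "\<And>f. pole_le m f \<Longrightarrow> qper \<rho> f \<Longrightarrow> \<exists>c. \<forall>x. x \<notin> Hpts \<longrightarrow> f x = c * B0 x"
    and n: "\<And>k. k \<le> 3 \<Longrightarrow> m k \<le> n k" and f: "pole_le n f" "qper \<rho> f"
  shows "\<exists>c0 c. \<forall>x. x \<notin> Hpts \<longrightarrow> f x = c0 * B0 x + (\<Sum>p\<in>pole_index m n. c p * B p x)"
  using n f
proof (induction "\<Sum>i\<le>3. n i - m i" arbitrary: n f)
  case 0
  hence eq: "n i = m i" if "i \<le> 3" for i using that by (simp add: le_antisym)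
  have "pole_index m n = {}" using eq by (auto simp: pole_index_def)
  moreover have "pole_le m f" by (rule pole_le_mono[OF \<open>pole_le n f\<close>]) (simp add: eq)
  ultimately show ?case using base[OF _ \<open>qper \<rho> f\<close>] by simp
next
  case (Suc d)
  obtain i where i: "i \<le> 3" "m i < n i"
  proof -
    have "(\<Sum>i\<le>3. n i - m i) \<noteq> 0" using Suc.hyps(2) by linarith
    then obtain i where "i \<in> {..3}" "n i - m i \<noteq> 0" by (meson sum.neutral)
    thus ?thesis using that[of i] by auto
  qed
  let ?n = "n(i := n i - 1)"
  let ?g = "B (i, n i - 1)"
  have g: "pole_le n ?g" "numer n ?g (- hp i) \<noteq> 0" using red[of i n, OF i] Suc.prems(1) by auto
  have gper: "qper \<rho> ?g" by (rule per) (use i in auto)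
  obtain c where c: "pole_le ?n (\<lambda>x. f x - c * ?g x)"
    using reduce_pole[OF Suc.prems(2) g(1) Suc.prems(3) gper i(1) _ g(2)] i(2) by auto
  have "d = (\<Sum>i\<le>3. ?n i - m i)"
  proof -
    have "(\<Sum>k\<le>3. n k - m k) = (n i - m i) + (\<Sum>k\<in>{..3}-{i}. n k - m k)"
      by (rule sum.remove) (use i in auto)
    moreover have "(\<Sum>k\<le>3. ?n k - m k) = (n i - 1 - m i) + (\<Sum>k\<in>{..3}-{i}. ?n k - m k)"
      using sum.remove[of "{..3}" i "\<lambda>k. ?n k - m k"] i by simp
    moreover have "(\<Sum>k\<in>{..3}-{i}. ?n k - m k) = (\<Sum>k\<in>{..3}-{i}. n k - m k)"
      by (rule sum.cong) auto
    ultimately show ?thesis using Suc.hyps(2) i by linarith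
  qed
  moreover have "m k \<le> ?n k" if "k \<le> 3" for k using Suc.prems(1)[OF that] i by auto
  ultimately have "\<exists>c0 c'. \<forall>x. x \<notin> Hpts \<longrightarrow> f x - c * ?g x = c0 * B0 x + (\<Sum>p\<in>pole_index m ?n. c' p * B p x)"
    by (intro Suc.hyps(1) c qper_diff Suc.prems(3) gper) auto
  then obtain c0 c' where c': "\<forall>x. x \<notin> Hpts \<longrightarrow> f x - c * ?g x = c0 * B0 x + (\<Sum>p\<in>pole_index m ?n. c' p * B p x)"
    by (elim exE)
  have I: "pole_index m n = insert (i, n i - 1) (pole_index m ?n)" "(i, n i - 1) \<notin> pole_index m ?n"
    using i by (auto simp: pole_index_def split: if_splits)
  have "f x = c0 * B0 x + (\<Sum>p\<in>pole_index m n. (c'((i, n i - 1) := c)) p * B p x)" if "x \<notin> Hpts" for x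
  proof -
    have "(\<Sum>p\<in>pole_index m n. (c'((i, n i - 1) := c)) p * B p x) =
        c * ?g x + (\<Sum>p\<in>pole_index m ?n. (c'((i, n i - 1) := c)) p * B p x)"
      unfolding I(1) using I(2) by (subst sum.insert) simp_all
    also have "(\<Sum>p\<in>pole_index m ?n. (c'((i, n i - 1) := c)) p * B p x) = (\<Sum>p\<in>pole_index m ?n. c' p * B p x)"
      by (rule sum.cong) (use I(2) in auto)
    finally show ?thesis using c'[rule_format, OF that] by (simp only: diff_eq_eq) (simp only: add_ac)
  qed
  thus ?case by (intro exI allI impI)
qed

section \<open>Elliptic functions with poles in the half periods\<close>

lemma entire_shift: "f holomorphic_on UNIV \<Longrightarrow> (\<lambda>x. f (x + a)) holomorphic_on UNIV"
  by (rule entire_compose[of f]) (auto intro!: holomorphic_intros)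

lemma Hpts_half: "x \<notin> Hpts \<Longrightarrow> i \<le> 3 \<Longrightarrow> x + hp i \<notin> Lat"
  by (auto simp: Hpts_iff)

lemma exact_wp_shift:
  assumes "i \<le> 3"
  shows "exact i 2 (\<lambda>x. P (x + hp i))"
  unfolding exact_def
proof (intro exI[of _ "\<lambda>x. deriv S (x + hp i) ^ 2 - S (x + hp i) * deriv (deriv S) (x + hp i)"] conjI allI impI)
  show "(\<lambda>x. deriv S (x + hp i) ^ 2 - S (x + hp i) * deriv (deriv S) (x + hp i)) holomorphic_on UNIV"
    by (intro holomorphic_intros entire_shift[of "deriv S"] entire_shift[of "deriv (deriv S)"]
        wsigma_deriv_holomorphic holomorphic_deriv) auto
  show "P (x + hp i) * S (x + hp i) ^ 2 = deriv S (x + hp i) ^ 2 - S (x + hp i) * deriv (deriv S) (x + hp i)"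
    if "x \<notin> Hpts" for x
    by (rule wp_numerator) (rule Hpts_half[OF that assms])
qed simp

abbreviation trivial_character :: "complex \<Rightarrow> complex" where
  "trivial_character \<equiv> \<lambda>_. 1"

lemma qper_wp_shift:
  assumes "i \<le> 3"
  shows "qper trivial_character (\<lambda>x. P (x + hp i))"
  unfolding qper_def
proof (intro ballI allI impI)
  fix \<tau> x assume "\<tau> \<in> Lat" "x \<notin> Hpts"
  thus "P (x + \<tau> + hp i) = 1 * P (x + hp i)"
    using wp_periodic[of \<tau> "x + hp i"] Hpts_half[of x i] assms by (simp add: add_ac)
qed

lemma wp_neq_e_val: "x \<notin> Hpts \<Longrightarrow> k \<in> {1..3} \<Longrightarrow> P x \<noteq> e_val \<omega>1 \<omega>3 k"
  using wp_eq_iff[of x "hp k"] Hpts_Lat[of x] half_period_notin[of k] Hpts_half[of x k] half_period_sum_iff[of x k]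
  by (auto simp: e_val_def)

abbreviation wp_logderiv :: "nat \<Rightarrow> complex \<Rightarrow> complex" where
  "wp_logderiv k \<equiv> \<lambda>x. deriv P x / (P x - e_val \<omega>1 \<omega>3 k)"

text \<open>Logarithmic derivative of the sigma factorisation of P(x) - P(hp k). It produces Z(x -
  hp k) + Z(x + hp k) - 2 Z(x), and replacing x - hp k by x + hp k introduces the constant
  \<open>qa (2 * hp k)\<close>.\<close>

lemma wp_logderiv_eq:
  assumes x: "x \<notin> Hpts" and k: "k \<in> {1..3}"
  shows "wp_logderiv k x = 2 * Z (x + hp k) - 2 * Z x - qa (2 * hp k)"
proof -
  obtain c where c: "c \<noteq> 0" "\<forall>x. x \<notin> Lat \<longrightarrow> P x - P (hp k) = c * S (x - hp k) * S (x + hp k) / S x ^ 2"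
    by (rule wp_diff_factor[OF half_period_notin[OF k]])
  have xk: "x + hp k \<notin> Lat" "x - hp k \<notin> Lat" "x \<notin> Lat"
    using x k Hpts_half[of x k] half_period_sum_iff[of x k] Hpts_Lat[of x] by auto
  have d1: "((\<lambda>x. S (x - hp k)) has_field_derivative S (x - hp k) * Z (x - hp k) * 1) (at x)"
    by (rule DERIV_chain2[of S], rule wsigma_derivative[OF xk(2)]) (auto intro!: derivative_eq_intros)
  have d2: "((\<lambda>x. S (x + hp k)) has_field_derivative S (x + hp k) * Z (x + hp k) * 1) (at x)"
    by (rule DERIV_chain2[of S], rule wsigma_derivative[OF xk(1)]) (auto intro!: derivative_eq_intros)
  have S: "S x \<noteq> 0" using xk by (simp add: wsigma_eq_0_iff)
  let ?q = "c * S (x - hp k) * S (x + hp k) / S x ^ 2"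
  have "((\<lambda>x. P (hp k) + c * (S (x - hp k) * S (x + hp k)) / (S x * S x)) has_field_derivative
      0 + ((c * (S (x - hp k) * Z (x - hp k) * 1 * S (x + hp k) + S (x + hp k) * Z (x + hp k) * 1 * S (x - hp k))) * (S x * S x)
        - (c * (S (x - hp k) * S (x + hp k))) * (S x * Z x * S x + S x * Z x * S x)) / ((S x * S x) * (S x * S x))) (at x)"
    by (intro DERIV_add DERIV_const DERIV_divide DERIV_cmult DERIV_mult d1 d2 wsigma_derivative xk) (use S in auto)
  also have "0 + ((c * (S (x - hp k) * Z (x - hp k) * 1 * S (x + hp k) + S (x + hp k) * Z (x + hp k) * 1 * S (x - hp k))) * (S x * S x)
        - (c * (S (x - hp k) * S (x + hp k))) * (S x * Z x * S x + S x * Z x * S x)) / ((S x * S x) * (S x * S x))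
     = ?q * (Z (x - hp k) + Z (x + hp k) - 2 * Z x)"
    using S by (simp add: field_simps power2_eq_square)
  finally have "(P has_field_derivative ?q * (Z (x - hp k) + Z (x + hp k) - 2 * Z x)) (at x)"
  proof (rule has_field_derivative_transform_within_open)
    show "open (- Lat)" using closed_Lat by (simp add: open_closed)
    fix y assume "y \<in> - Lat"
    thus "P (hp k) + c * (S (y - hp k) * S (y + hp k)) / (S y * S y) = P y"
      using c(2)[rule_format, of y] by (simp add: power2_eq_square mult.assoc diff_eq_eq)
  qed (use xk in auto)
  from DERIV_imp_deriv[OF this] have "deriv P x = (P x - P (hp k)) * (Z (x - hp k) + Z (x + hp k) - 2 * Z x)"
    using c(2)[rule_format, OF xk(3)] by simp
  hence "wp_logderiv k x = Z (x - hp k) + Z (x + hp k) - 2 * Z x"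
    using wp_neq_e_val[OF x k] by (simp add: e_val_def)
  moreover have "Z (x + hp k) = Z (x - hp k) + qa (2 * hp k)"
    using wzeta_add[OF two_half_period[of k] xk(2)] by (simp add: algebra_simps)
  ultimately show ?thesis by simp
qed

text \<open>There is a second simple pole at 0, which is why \<open>n 0 > 0\<close> is required. At
  \<open>- hp k\<close> only the term with S'(0) S(- hp k) of the numerator survives.\<close>

lemma wp_logderiv_pole:
  assumes k: "k \<in> {1..3}" and n: "n 0 > 0" "n k = 1"
  shows "pole_le n (wp_logderiv k)" "numer n (wp_logderiv k) (- hp k) \<noteq> 0"
proof -
  let ?R = "\<lambda>x. S x ^ (n 0 - 1) * (\<Prod>j\<in>{..3} - {k} - {0}. S (x + hp j) ^ n j)"
  let ?F = "\<lambda>x. (2 * deriv S (x + hp k) * S x - 2 * deriv S x * S (x + hp k) - qa (2 * hp k) * S x * S (x + hp k)) * ?R x"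
  have h: "?F holomorphic_on UNIV"
    by (intro holomorphic_intros entire_shift[of "deriv S"] wsigma_deriv_holomorphic)
  have e: "wp_logderiv k x * Theta n x = ?F x" if x: "x \<notin> Hpts" for x
  proof -
    have xk: "x + hp k \<notin> Lat" "x \<notin> Lat" using x k Hpts_half[of x k] Hpts_Lat[of x] by auto
    have "Theta n x = S (x + hp k) * (\<Prod>j\<in>{..3} - {k}. S (x + hp j) ^ n j)"
      using Theta_remove[of k n x] k n(2) by simp
    also have "(\<Prod>j\<in>{..3} - {k}. S (x + hp j) ^ n j) = S x ^ n 0 * (\<Prod>j\<in>{..3} - {k} - {0}. S (x + hp j) ^ n j)"
      by (subst prod.remove[of _ 0]) (use k in auto)
    also have "S x ^ n 0 = S x * S x ^ (n 0 - 1)" using n(1) by (cases "n 0") auto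
    finally have T: "Theta n x = S (x + hp k) * S x * ?R x" by (simp add: mult_ac)
    show ?thesis unfolding wp_logderiv_eq[OF x k] T
      by (simp add: wsigma_deriv_eq[OF xk(1)] wsigma_deriv_eq[OF xk(2)] algebra_simps)
  qed
  show "pole_le n (wp_logderiv k)" by (rule pole_leI[OF h e])
  have "numer n (wp_logderiv k) = ?F" by (rule numer_unique[OF h e])
  moreover have "S (- hp k + hp j) \<noteq> 0" if "j \<le> 3" "j \<noteq> k" for j
    using half_period_diff_notin[of j k] that k by (simp add: wsigma_eq_0_iff)
  moreover have "S (- hp k) \<noteq> 0" using half_period_notin[OF k] by (simp add: wsigma_eq_0_iff)
  ultimately show "numer n (wp_logderiv k) (- hp k) \<noteq> 0" by auto
qed

text \<open>A basis of the elliptic functions with poles in the half periods. The residues of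
  \<open>wp_logderiv k\<close> are \<open>2\<close> at \<open>\<omega>\<^sub>k\<close> and \<open>-2\<close> at \<open>0\<close>.\<close>
fun basis :: "nat \<times> nat \<Rightarrow> complex \<Rightarrow> complex" where
  "basis (i, 0) = (if i = 0 then (\<lambda>x. 1) else wp_logderiv i)"
| "basis (i, Suc j) = (deriv ^^ j) (\<lambda>x. P (x + hp i))"

text \<open>The floor for elliptic functions: a simple pole at \<open>hp k\<close> can be removed
  only at the cost of one at 0, so one order at 0 stays allowed. An elliptic function with no more
  than that is constant.\<close>

definition base_order :: "nat \<Rightarrow> nat" where
  "base_order k = (if k = 0 then 1 else 0)"

lemma basis_pole:
  assumes "i \<le> 3" "base_order i < n i" "\<forall>k\<le>3. base_order k \<le> n k"
  shows "pole_le n (basis (i, n i - 1))" "numer n (basis (i, n i - 1)) (- hp i) \<noteq> 0"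
proof -
  have n0: "n 0 > 0" using assms(3) by (force simp: base_order_def)
  have "pole_le n (basis (i, n i - 1)) \<and> numer n (basis (i, n i - 1)) (- hp i) \<noteq> 0"
  proof (cases "n i = 1")
    case True
    hence "i \<noteq> 0" using assms(2) by (auto simp: base_order_def split: if_splits)
    hence "i \<in> {1..3}" using assms(1) by auto
    from wp_logderiv_pole[OF this n0 True] show ?thesis using True \<open>i \<noteq> 0\<close> by simp
  next
    case False
    define j where "j = n i - 2"
    have j: "n i = Suc (Suc j)" using assms(2) False by (simp add: j_def)
    have "exact i (n i) ((deriv ^^ j) (\<lambda>x. P (x + hp i)))"
      using exact_higher_deriv[OF exact_wp_shift[OF assms(1)] _ assms(1), of j] j by simp
    from exact_pole_le[of i n, OF this assms(1)] show ?thesis using j by simp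
  qed
  thus "pole_le n (basis (i, n i - 1))" "numer n (basis (i, n i - 1)) (- hp i) \<noteq> 0" by auto
qed

lemma basis_pole_le:
  assumes "i \<le> 3" "j < n i" "n 0 > 0"
  shows "pole_le n (basis (i, j))"
proof (cases "i = 0 \<and> j = 0")
  case True
  thus ?thesis using pole_le_mono[OF pole_le_entire[of "\<lambda>_. 1"], of n] by simp
next
  case False
  let ?m = "\<lambda>k. if k = i then Suc j else if k = 0 then 1 else 0"
  have "pole_le ?m (basis (i, ?m i - 1))"
    by (rule basis_pole(1)) (use assms False in \<open>auto simp: base_order_def\<close>)
  hence "pole_le ?m (basis (i, j))" by simp
  thus ?thesis by (rule pole_le_mono) (use assms in \<open>auto split: if_splits\<close>)
qed

lemma basis_holomorphic: "i \<le> 3 \<Longrightarrow> basis (i, j) holomorphic_on - Hpts"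
  using pole_le_holomorphic[OF basis_pole_le[of i j "\<lambda>_. Suc j"]] by simp

lemma qper_basis:
  assumes "i \<le> 3"
  shows "qper trivial_character (basis (i, j))"
proof (cases j)
  case 0
  have P: "qper trivial_character P" using qper_wp_shift[of 0] by simp
  have "P holomorphic_on - Hpts" using exact_holomorphic[OF exact_wp_shift[of 0]] by simp
  from qper_deriv[OF P this] P show ?thesis using 0 by (auto simp: qper_def)
next
  case (Suc j')
  show ?thesis unfolding Suc basis.simps
    by (rule qper_higher_deriv[OF qper_wp_shift[OF assms] exact_wp_shift[OF assms] _ assms]) simp
qed

lemma Theta_base_order: "Theta base_order x = S x"
proof -
  have "{..3::nat} = {0, 1, 2, 3}" by auto
  thus ?thesis by (simp add: Theta_def base_order_def)
qed

text \<open>The numerator acquires exactly the quasi-periods of \<open>S\<close>, and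
  \<open>theta_one\<close> makes it a multiple of \<open>S\<close>, which is also the
  denominator.\<close>

lemma elliptic_one_pole_constant:
  assumes "pole_le base_order f" "qper trivial_character f"
  shows "\<exists>c. \<forall>x. x \<notin> Hpts \<longrightarrow> f x = c * 1"
proof -
  have te: "theta_exponent base_order \<tau> x = qa \<tau> * (x + 0) + qb \<tau>" for \<tau> x
  proof -
    have "{..3::nat} = {0, 1, 2, 3}" by auto
    thus ?thesis by (simp add: theta_exponent_def base_order_def)
  qed
  have "numer base_order f (x + \<tau>) = exp (qa \<tau> * (x + 0) + qb \<tau>) * numer base_order f x" if "\<tau> \<in> Lat" for \<tau> x
    using numer_quasi_periodic[OF assms that, of x] te by simp
  from theta_one[OF numer_holomorphic[OF assms(1)] this]
  obtain c where c: "\<forall>x. numer base_order f x = c * S (x + 0)" ..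
  have "f x = c * 1" if "x \<notin> Hpts" for x
    using numer_eq[OF assms(1) that] c[rule_format, of x] wsigma_nonzero[OF that] by (simp add: Theta_base_order)
  thus ?thesis by (intro exI[of _ c] allI impI)
qed

lemma elliptic_expansion:
  assumes "n 0 > 0" "pole_le n f" "qper trivial_character f"
  shows "\<exists>c0 c. \<forall>x. x \<notin> Hpts \<longrightarrow> f x = c0 * 1 + (\<Sum>p\<in>pole_index base_order n. c p * basis p x)"
proof (rule principal_part_expansion[where \<rho> = trivial_character])
  show "base_order k \<le> n k" for k using assms(1) by (simp add: base_order_def)
qed (use assms basis_pole qper_basis elliptic_one_pole_constant in auto)

section \<open>Functions with the multiplier of Phi\<close>

definition phi_character :: "complex \<Rightarrow> complex \<Rightarrow> complex" where
  "phi_character \<alpha> \<tau> = exp (Z \<alpha> * \<tau> - qa \<tau> * \<alpha>)"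

abbreviation "Ph \<equiv> Phi \<omega>1 \<omega>3"

lemma qper_Phi:
  assumes "i \<le> 3"
  shows "qper (phi_character \<alpha>) (Ph i \<alpha>)"
  unfolding qper_def
proof (intro ballI allI impI)
  fix \<tau> x assume \<tau>: "\<tau> \<in> Lat" and x: "x \<notin> Hpts"
  have 1: "S (x + \<tau> + hp i - \<alpha>) = exp (qa \<tau> * (x + hp i - \<alpha>) + qb \<tau>) * S (x + hp i - \<alpha>)"
    using wsigma_add[OF \<tau>, of "x + hp i - \<alpha>"] by (simp add: algebra_simps)
  have 2: "S (x + \<tau> + hp i) = exp (qa \<tau> * (x + hp i) + qb \<tau>) * S (x + hp i)"
    using wsigma_add[OF \<tau>, of "x + hp i"] by (simp add: algebra_simps)
  have "exp (qa \<tau> * (x + hp i - \<alpha>) + qb \<tau>) = exp (qa \<tau> * (x + hp i) + qb \<tau>) * exp (- qa \<tau> * \<alpha>)"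
    unfolding exp_add[symmetric] by (rule arg_cong[of _ _ exp]) (simp add: algebra_simps)
  moreover have "exp (Z \<alpha> * (x + \<tau>)) = exp (Z \<alpha> * x) * exp (Z \<alpha> * \<tau>)"
    unfolding exp_add[symmetric] by (rule arg_cong[of _ _ exp]) (simp add: algebra_simps)
  moreover have "phi_character \<alpha> \<tau> = exp (Z \<alpha> * \<tau>) * exp (- qa \<tau> * \<alpha>)"
    unfolding phi_character_def exp_add[symmetric] by simp
  ultimately show "Ph i \<alpha> (x + \<tau>) = phi_character \<alpha> \<tau> * Ph i \<alpha> x"
    unfolding Phi_def 1 2 by simp
qed

lemma exact_Phi:
  assumes "i \<le> 3" "\<alpha> \<notin> Lat"
  shows "exact i 1 (Ph i \<alpha>)"
  unfolding exact_def
proof (intro exI[of _ "\<lambda>x. S (x + hp i - \<alpha>) * exp (Z \<alpha> * x)"] conjI allI impI)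
  show "(\<lambda>x. S (x + hp i - \<alpha>) * exp (Z \<alpha> * x)) holomorphic_on UNIV" by (intro holomorphic_intros)
  show "Ph i \<alpha> x * S (x + hp i) ^ 1 = S (x + hp i - \<alpha>) * exp (Z \<alpha> * x)" if "x \<notin> Hpts" for x
    using wsigma_half_nonzero[OF that assms(1)] by (simp add: Phi_def)
  show "S (- hp i + hp i - \<alpha>) * exp (Z \<alpha> * - hp i) \<noteq> 0"
    using assms(2) by (simp add: wsigma_eq_0_iff)
qed

text \<open>Here the floor is no pole at all. A pole-free function with this multiplier, times S(x)
  exp(- Z(\<alpha>) x), has the quasi-periods of S(x - \<alpha>) and is a multiple of it. At 0 the
  product vanishes while S(-\<alpha>) does not, so the function is zero and no base term
  remains.\<close>

lemma Phi_expansion: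
  assumes \<alpha>: "\<alpha> \<notin> Lat" and f: "pole_le n f" "qper (phi_character \<alpha>) f"
  shows "\<exists>c. \<forall>x. x \<notin> Hpts \<longrightarrow> f x = (\<Sum>i\<le>3. \<Sum>j<n i. c i j * (deriv ^^ j) (Ph i \<alpha>) x)"
proof -
  let ?B = "\<lambda>(i, j). (deriv ^^ j) (Ph i \<alpha>)"
  have "\<exists>c0 c. \<forall>x. x \<notin> Hpts \<longrightarrow> f x = c0 * 0 + (\<Sum>p\<in>pole_index (\<lambda>_. 0) n. c p * ?B p x)"
  proof (rule principal_part_expansion[where \<rho> = "phi_character \<alpha>" and ?B0.0 = "\<lambda>_. 0"])
    fix n :: "nat \<Rightarrow> nat" and i assume i: "i \<le> 3" "0 < n i"
    have "exact i (n i) ((deriv ^^ (n i - 1)) (Ph i \<alpha>))"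
      using exact_higher_deriv[OF exact_Phi[OF i(1) \<alpha>] _ i(1), of "n i - 1"] i(2) by simp
    from exact_pole_le[of i n, OF this i(1)]
    show "pole_le n (?B (i, n i - 1)) \<and> numer n (?B (i, n i - 1)) (- hp i) \<noteq> 0" by simp
  next
    fix i j :: nat assume i: "i \<le> 3"
    show "qper (phi_character \<alpha>) (?B (i, j))"
      using qper_higher_deriv[OF qper_Phi[OF i] exact_Phi[OF i \<alpha>] _ i] by simp
  next
    fix f assume f: "pole_le (\<lambda>_. 0) f" "qper (phi_character \<alpha>) f"
    define N where "N x = numer (\<lambda>_. 0) f x * S x * exp (- Z \<alpha> * x)" for x
    have hol: "N holomorphic_on UNIV" unfolding N_def[abs_def]
      by (intro holomorphic_intros numer_holomorphic f)
    have quasi: "N (x + \<tau>) = exp (qa \<tau> * (x + - \<alpha>) + qb \<tau>) * N x" if \<tau>: "\<tau> \<in> Lat" for \<tau> x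
    proof -
      have "numer (\<lambda>_. 0) f (x + \<tau>) = phi_character \<alpha> \<tau> * numer (\<lambda>_. 0) f x"
        using numer_quasi_periodic[OF f \<tau>, of x] by (simp add: theta_exponent_def)
      hence "N (x + \<tau>) = (phi_character \<alpha> \<tau> * exp (qa \<tau> * x + qb \<tau>) * exp (- Z \<alpha> * (x + \<tau>)))
          * (numer (\<lambda>_. 0) f x * S x)"
        by (simp add: N_def wsigma_add[OF \<tau>])
      also have "phi_character \<alpha> \<tau> * exp (qa \<tau> * x + qb \<tau>) * exp (- Z \<alpha> * (x + \<tau>)) =
          exp (qa \<tau> * (x + - \<alpha>) + qb \<tau>) * exp (- Z \<alpha> * x)"
        unfolding phi_character_def exp_add[symmetric] by (rule arg_cong[of _ _ exp]) (simp add: algebra_simps)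
      finally show ?thesis by (simp add: N_def mult_ac)
    qed
    from theta_one[of N "- \<alpha>", OF hol quasi] obtain c where c: "\<forall>x. N x = c * S (x + - \<alpha>)" ..
    have "c = 0" using c[rule_format, of 0] \<alpha> by (simp add: N_def wsigma_eq_0_iff)
    have "f x = 0 * 0" if "x \<notin> Hpts" for x
      using c[rule_format, of x] \<open>c = 0\<close> numer_eq[OF f(1) that] wsigma_nonzero[OF that]
      by (simp add: N_def Theta_def)
    thus "\<exists>c. \<forall>x. x \<notin> Hpts \<longrightarrow> f x = c * 0" by (intro exI[of _ 0] allI impI)
  qed (use f in auto)
  then obtain c0 c where c: "\<forall>x. x \<notin> Hpts \<longrightarrow> f x = c0 * 0 + (\<Sum>p\<in>pole_index (\<lambda>_. 0) n. c p * ?B p x)"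
    by (elim exE)
  have "f x = (\<Sum>i\<le>3. \<Sum>j<n i. c (i, j) * (deriv ^^ j) (Ph i \<alpha>) x)" if "x \<notin> Hpts" for x
    using c[rule_format, OF that] unfolding pole_index_def
    by (simp add: sum.Sigma atLeast0LessThan case_prod_unfold)
  thus ?thesis by (intro exI[of _ "\<lambda>i j. c (i, j)"] allI impI)
qed

section \<open>Expansions of the solution\<close>

lemma atMost_3_eq: "{..3::nat} = insert 0 {1..3}"
  by auto

lemma pole_le_cmult: "pole_le n f \<Longrightarrow> pole_le n (\<lambda>x. c * f x)"
  using pole_le_diff(1)[OF pole_le_mono[OF pole_le_entire[of "\<lambda>_. 0"], of n], of f "- c"] by simp

definition zero_prod :: "nat \<Rightarrow> (nat \<Rightarrow> complex) \<Rightarrow> complex \<Rightarrow> complex" where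
  "zero_prod L t x = (\<Prod>j=1..L. S (x + t j))"

lemma zero_prod_holomorphic: "zero_prod L t holomorphic_on U"
  unfolding zero_prod_def[abs_def] by (intro holomorphic_intros)

lemma zero_prod_quasi_periodic:
  assumes "\<tau> \<in> Lat"
  shows "zero_prod L t (x + \<tau>) = exp (of_nat L * (qa \<tau> * x + qb \<tau>) + qa \<tau> * (\<Sum>j=1..L. t j)) * zero_prod L t x"
proof -
  have "S (x + \<tau> + t j) = exp (qa \<tau> * x + qb \<tau> + qa \<tau> * t j) * S (x + t j)" for j
    using wsigma_add[OF assms, of "x + t j"] by (simp add: algebra_simps)
  hence "zero_prod L t (x + \<tau>) = exp (\<Sum>j=1..L. qa \<tau> * x + qb \<tau> + qa \<tau> * t j) * zero_prod L t x"
    by (simp add: zero_prod_def prod.distrib exp_sum)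
  also have "(\<Sum>j=1..L. qa \<tau> * x + qb \<tau> + qa \<tau> * t j) = of_nat L * (qa \<tau> * x + qb \<tau>) + qa \<tau> * (\<Sum>j=1..L. t j)"
    by (simp add: sum.distrib sum_distrib_left algebra_simps)
  finally show ?thesis .
qed

lemma theta_exponent_eq:
  "theta_exponent n \<tau> x = of_nat (\<Sum>i\<le>3. n i) * (qa \<tau> * x + qb \<tau>) + qa \<tau> * (\<Sum>k=1..3. of_nat (n k) * hp k)"
  unfolding theta_exponent_def atMost_3_eq
  by (simp add: sum.distrib sum_distrib_left sum_distrib_right algebra_simps)

definition zero_quotient :: "(nat \<Rightarrow> nat) \<Rightarrow> (nat \<Rightarrow> complex) \<Rightarrow> complex \<Rightarrow> complex" where
  "zero_quotient l t x = zero_prod (l_total l) t x / Theta l x"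

lemma zero_quotient_pole_le: "pole_le l (zero_quotient l t)"
  by (rule pole_leI[of "zero_prod (l_total l) t"]) (auto simp: zero_prod_holomorphic zero_quotient_def Theta_nonzero)

text \<open>Numerator and denominator contain equally many sigma factors, so the terms
  \<open>qa \<tau> * x + qb \<tau>\<close> cancel and only the difference of the shifts
  remains.\<close>

lemma zero_quotient_quasi_periodic:
  assumes "\<tau> \<in> Lat"
  shows "zero_quotient l t (x + \<tau>) = exp (- qa \<tau> * alpha \<omega>1 \<omega>3 l t) * zero_quotient l t x"
proof -
  let ?A = "of_nat (l_total l) * (qa \<tau> * x + qb \<tau>) + qa \<tau> * (\<Sum>j=1..l_total l. t j)"
  let ?B = "theta_exponent l \<tau> x"
  have "zero_quotient l t (x + \<tau>) = exp ?A / exp ?B * zero_quotient l t x"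
    unfolding zero_quotient_def zero_prod_quasi_periodic[OF assms] Theta_quasi_periodic[OF assms] by simp
  also have "exp ?A / exp ?B = exp (?A - ?B)" by (rule exp_diff[symmetric])
  also have "?A - ?B = - qa \<tau> * alpha \<omega>1 \<omega>3 l t"
    unfolding theta_exponent_eq alpha_def l_total_def by (simp add: algebra_simps)
  finally show ?thesis .
qed

lemma Lambda_tilde_eq:
  assumes "\<forall>j\<in>{1..l_total l}. t j \<notin> Lat"
  shows "\<exists>C. C \<noteq> 0 \<and> (\<forall>x. Lambda_tilde \<omega>1 \<omega>3 l t x = exp (kappa_bar \<omega>1 \<omega>3 l t * x) * (C * zero_quotient l t x))"
proof -
  let ?K = "\<Prod>k=1..3. S (hp k) ^ l k"
  let ?T = "\<Prod>j=1..l_total l. S (t j)"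
  have K: "?K \<noteq> 0" using half_period_notin by (auto simp: wsigma_eq_0_iff)
  have T: "?T \<noteq> 0" using assms by (auto simp: wsigma_eq_0_iff)
  have "Lambda_tilde \<omega>1 \<omega>3 l t x = exp (kappa_bar \<omega>1 \<omega>3 l t * x) * ((?K / ?T) * zero_quotient l t x)" for x
  proof -
    have "cosigma \<omega>1 \<omega>3 k x ^ l k = exp (of_nat (l k) * (- eta_val \<omega>1 \<omega>3 k * x)) * (S (x + hp k) ^ l k / S (hp k) ^ l k)" for k
      unfolding cosigma_def power_divide power_mult_distrib exp_of_nat_mult by simp
    hence "(\<Prod>k=1..3. cosigma \<omega>1 \<omega>3 k x ^ l k) =
        exp (\<Sum>k=1..3. of_nat (l k) * (- eta_val \<omega>1 \<omega>3 k * x)) * ((\<Prod>k=1..3. S (x + hp k) ^ l k) / ?K)"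
      by (simp only: prod.distrib exp_sum[OF finite_atLeastAtMost] prod_dividef)
    moreover have "Theta l x = S x ^ l 0 * (\<Prod>k=1..3. S (x + hp k) ^ l k)"
      unfolding Theta_def atMost_3_eq by simp
    moreover have "kappa_bar \<omega>1 \<omega>3 l t * x = - x * (\<Sum>j=1..l_total l. Z (t j)) - (\<Sum>k=1..3. of_nat (l k) * (- eta_val \<omega>1 \<omega>3 k * x))"
      by (simp add: kappa_bar_def sum_distrib_left sum_distrib_right sum_negf algebra_simps)
    ultimately show ?thesis
      by (simp only: Lambda_tilde_def zero_quotient_def zero_prod_def exp_diff)
         (simp add: divide_inverse mult_ac)
  qed
  thus ?thesis using K T by (intro exI[of _ "?K / ?T"] conjI allI) auto
qed

lemma kappa_eq: "kappa \<omega>1 \<omega>3 l t = kappa_bar \<omega>1 \<omega>3 l t - Z (alpha \<omega>1 \<omega>3 l t)"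
proof -
  have "(\<Sum>j=1..l_total l. t j) - (\<Sum>k=1..3. of_nat (l k) * hp k) = - alpha \<omega>1 \<omega>3 l t"
    by (simp add: alpha_def)
  thus ?thesis unfolding kappa_def kappa_bar_def by simp
qed

lemma Lambda_tilde_Phi_expansion:
  assumes t: "\<And>j. j \<in> {1..l_total l} \<Longrightarrow> t j \<notin> Lat" and \<alpha>: "alpha \<omega>1 \<omega>3 l t \<notin> Lat"
  shows "\<exists>bt. \<forall>x. x \<notin> Hpts \<longrightarrow> Lambda_tilde \<omega>1 \<omega>3 l t x = exp (kappa \<omega>1 \<omega>3 l t * x) *
     (\<Sum>i\<le>3. \<Sum>j<l i. bt i j * (deriv ^^ j) (Ph i (alpha \<omega>1 \<omega>3 l t)) x)"
proof -
  let ?a = "alpha \<omega>1 \<omega>3 l t"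
  obtain C where C: "\<forall>x. Lambda_tilde \<omega>1 \<omega>3 l t x = exp (kappa_bar \<omega>1 \<omega>3 l t * x) * (C * zero_quotient l t x)"
    using Lambda_tilde_eq[of l t] t by auto
  define f where "f x = C * (zero_quotient l t x * exp (Z ?a * x))" for x
  have "pole_le (\<lambda>i. l i + 0) (\<lambda>x. zero_quotient l t x * exp (Z ?a * x))"
    by (rule pole_le_mult[OF zero_quotient_pole_le pole_le_entire]) (intro holomorphic_intros)
  hence f1: "pole_le l f" unfolding f_def[abs_def] by (intro pole_le_cmult) simp
  have f2: "qper (phi_character ?a) f" unfolding qper_def
  proof (intro ballI allI impI)
    fix \<tau> x assume \<tau>: "\<tau> \<in> Lat"
    have "exp (- qa \<tau> * ?a) * exp (Z ?a * (x + \<tau>)) = phi_character ?a \<tau> * exp (Z ?a * x)"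
      unfolding phi_character_def exp_add[symmetric] by (rule arg_cong[of _ _ exp]) (simp add: algebra_simps)
    thus "f (x + \<tau>) = phi_character ?a \<tau> * f x"
      unfolding f_def zero_quotient_quasi_periodic[OF \<tau>] by (simp add: mult_ac)
  qed
  obtain bt where bt: "\<forall>x. x \<notin> Hpts \<longrightarrow> f x = (\<Sum>i\<le>3. \<Sum>j<l i. bt i j * (deriv ^^ j) (Ph i ?a) x)"
    using Phi_expansion[OF \<alpha> f1 f2] by (elim exE)
  have "Lambda_tilde \<omega>1 \<omega>3 l t x = exp (kappa \<omega>1 \<omega>3 l t * x) * f x" for x
  proof -
    have "exp (kappa_bar \<omega>1 \<omega>3 l t * x) = exp (kappa \<omega>1 \<omega>3 l t * x) * exp (Z ?a * x)"
      unfolding kappa_eq exp_add[symmetric] by (rule arg_cong[of _ _ exp]) (simp add: algebra_simps)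
    thus ?thesis using C by (simp add: f_def mult_ac)
  qed
  with bt show ?thesis by (intro exI[of _ bt] allI impI) simp
qed

text \<open>Each factor S(x + t) / S(t) exp(- x Z(t)) is unchanged when t moves by a period: the
  multipliers of sigma at x + t and at t differ by exp(qa x), which the increment of zeta
  compensates. Representatives may therefore be normalised without altering the solution.\<close>

lemma Lambda_tilde_shift:
  assumes t: "\<And>j. j \<in> {1..l_total l} \<Longrightarrow> t j \<notin> Lat"
    and t': "\<And>j. j \<in> {1..l_total l} \<Longrightarrow> t' j - t j \<in> Lat"
  shows "Lambda_tilde \<omega>1 \<omega>3 l t x = Lambda_tilde \<omega>1 \<omega>3 l t' x"
proof -
  have *: "S (x + t' j) / S (t' j) * exp (- x * Z (t' j)) = S (x + t j) / S (t j) * exp (- x * Z (t j))"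
    if j: "j \<in> {1..l_total l}" for j
  proof -
    define \<tau> where "\<tau> = t' j - t j"
    have \<tau>: "\<tau> \<in> Lat" "t' j = t j + \<tau>" using t'[OF j] by (auto simp: \<tau>_def)
    have 1: "S (x + t' j) = exp (qa \<tau> * (x + t j) + qb \<tau>) * S (x + t j)"
      using wsigma_add[OF \<tau>(1), of "x + t j"] by (simp add: \<tau>(2) algebra_simps)
    have 2: "S (t' j) = exp (qa \<tau> * t j + qb \<tau>) * S (t j)" using wsigma_add[OF \<tau>(1)] by (simp add: \<tau>(2))
    have 3: "Z (t' j) = Z (t j) + qa \<tau>" using wzeta_add[OF \<tau>(1) t[OF j]] by (simp add: \<tau>(2))
    have "exp (qa \<tau> * (x + t j) + qb \<tau>) / exp (qa \<tau> * t j + qb \<tau>) * exp (- x * (Z (t j) + qa \<tau>)) = exp (- x * Z (t j))"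
      unfolding exp_diff[symmetric] exp_add[symmetric] by (rule arg_cong[of _ _ exp]) (simp add: algebra_simps)
    hence "S (x + t j) / S (t j) * (exp (qa \<tau> * (x + t j) + qb \<tau>) / exp (qa \<tau> * t j + qb \<tau>) * exp (- x * (Z (t j) + qa \<tau>)))
       = S (x + t j) / S (t j) * exp (- x * Z (t j))" by simp
    thus ?thesis unfolding 1 2 3 by (simp add: mult_ac)
  qed
  let ?D = "\<lambda>t. \<Prod>j=1..l_total l. S (x + t j) / S (t j) * exp (- x * Z (t j))"
  have L: "Lambda_tilde \<omega>1 \<omega>3 l t x = ?D t / (S x ^ l 0 * (\<Prod>k=1..3. cosigma \<omega>1 \<omega>3 k x ^ l k))" for t
    unfolding Lambda_tilde_def prod.distrib prod_dividef exp_sum[OF finite_atLeastAtMost, symmetric] sum_distrib_left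
    by (simp add: divide_inverse mult_ac)
  have "?D t' = ?D t" by (rule prod.cong[OF refl *])
  thus ?thesis unfolding L by simp
qed

lemma exists_normalised_zeros:
  assumes "l_total l > 0" "alpha \<omega>1 \<omega>3 l t \<in> Lat"
  shows "\<exists>t'. (\<forall>j\<in>{1..l_total l}. t' j - t j \<in> Lat) \<and> alpha \<omega>1 \<omega>3 l t' = 0"
proof -
  let ?a = "alpha \<omega>1 \<omega>3 l t"
  \<comment> \<open>Moving a single zero by the lattice element alpha suffices; one exists because
    \<open>l_total l > 0\<close>.\<close>
  let ?t = "t(1 := t 1 + ?a)"
  have "(\<Sum>j=1..l_total l. ?t j) = ?t 1 + (\<Sum>j\<in>{1..l_total l}-{1}. ?t j)"
    by (rule sum.remove) (use assms(1) in auto)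
  also have "(\<Sum>j\<in>{1..l_total l}-{1}. ?t j) = (\<Sum>j\<in>{1..l_total l}-{1}. t j)"
    by (rule sum.cong) auto
  finally have "(\<Sum>j=1..l_total l. ?t j) = ?a + (t 1 + (\<Sum>j\<in>{1..l_total l}-{1}. t j))" by simp
  also have "t 1 + (\<Sum>j\<in>{1..l_total l}-{1}. t j) = (\<Sum>j=1..l_total l. t j)"
    by (rule sum.remove[symmetric]) (use assms(1) in auto)
  finally have "alpha \<omega>1 \<omega>3 l ?t = ?a - ?a"
    unfolding alpha_def by (simp only: ) (simp add: algebra_simps)
  moreover have "?t j - t j \<in> Lat" for j using assms(2) by simp
  ultimately show ?thesis by (intro exI[of _ ?t]) simp
qed

lemma Lambda_tilde_wp_expansion:
  assumes t: "\<And>j. j \<in> {1..l_total l} \<Longrightarrow> t j \<notin> Lat"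
    and t': "\<And>j. j \<in> {1..l_total l} \<Longrightarrow> t' j - t j \<in> Lat" and \<alpha>: "alpha \<omega>1 \<omega>3 l t' = 0"
  shows "\<exists>c ck bb. \<forall>x. x \<notin> Hpts \<longrightarrow> Lambda_tilde \<omega>1 \<omega>3 l t x = exp (kappa_bar \<omega>1 \<omega>3 l t' * x) *
     (c + (\<Sum>i\<le>3. \<Sum>j<l i - 1. bb i j * (deriv ^^ j) (\<lambda>y. P (y + hp i)) x)
        + (\<Sum>k=1..3. ck k * (deriv P x / (P x - e_val \<omega>1 \<omega>3 k))))"
proof -
  have t'_notin: "t' j \<notin> Lat" if "j \<in> {1..l_total l}" for j
    using t[OF that] Lat_diff_iff'[OF t'[OF that], of "t' j"] Lat_diff[OF _ t'[OF that], of "t' j"] by auto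
  obtain C where C: "\<forall>x. Lambda_tilde \<omega>1 \<omega>3 l t' x = exp (kappa_bar \<omega>1 \<omega>3 l t' * x) * (C * zero_quotient l t' x)"
    using Lambda_tilde_eq[of l t'] t'_notin by auto
  define f where "f x = C * zero_quotient l t' x" for x
  \<comment> \<open>\<open>elliptic_expansion\<close> needs room for one pole at 0 even if
    \<open>l 0 = 0\<close>. In that case no basis function is added beyond the constant, as the
    index range at 0 starts at 1.\<close>
  define n where "n = l(0 := max 1 (l 0))"
  have "pole_le l f" unfolding f_def[abs_def] by (intro pole_le_cmult zero_quotient_pole_le)
  hence f1: "pole_le n f" by (rule pole_le_mono) (simp add: n_def)
  have f2: "qper trivial_character f"
    unfolding qper_def f_def using zero_quotient_quasi_periodic[of _ l t'] \<alpha> by simp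
  have n0: "n 0 > 0" by (simp add: n_def)
  obtain c0 c where c: "\<forall>x. x \<notin> Hpts \<longrightarrow> f x = c0 * 1 + (\<Sum>p\<in>pole_index base_order n. c p * basis p x)"
    using elliptic_expansion[OF n0 f1 f2] by (elim exE)
  let ?D = "\<lambda>i j x. (deriv ^^ j) (\<lambda>y. P (y + hp i)) x"
  \<comment> \<open>The index 0 at k > 0 belongs to \<open>wp_logderiv k\<close> and occurs only for
    \<open>l k > 0\<close>. All other indices belong to derivatives of wp and are shifted by one,
    whence the bound \<open>l i - 1\<close>.\<close>
  define ck where "ck k = (if l k = 0 then 0 else c (k, 0))" for k
  have A: "f x = c0 + (\<Sum>i\<le>3. \<Sum>j<l i - 1. c (i, Suc j) * ?D i j x)
        + (\<Sum>k=1..3. ck k * wp_logderiv k x)" if x: "x \<notin> Hpts" for x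
  proof -
    let ?G = "\<lambda>i. \<Sum>j=base_order i..<n i. c (i, j) * basis (i, j) x"
    have shift: "(\<Sum>j=1..<Suc m. c (i, j) * basis (i, j) x) = (\<Sum>j<m. c (i, Suc j) * ?D i j x)" for i m
      using sum.shift_bounds_Suc_ivl[of "\<lambda>j. c (i, j) * basis (i, j) x" 0 m]
      by (simp add: atLeast0LessThan)
    have G0: "?G 0 = (\<Sum>j<l 0 - 1. c (0, Suc j) * ?D 0 j x)"
    proof -
      have "n 0 = Suc (l 0 - 1)" by (auto simp: n_def)
      thus ?thesis using shift[of 0 "l 0 - 1"] by (simp add: base_order_def)
    qed
    have Gk: "?G k = (\<Sum>j<l k - 1. c (k, Suc j) * ?D k j x) + ck k * wp_logderiv k x" if "k \<in> {1..3}" for k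
    proof (cases "l k")
      case 0
      thus ?thesis using that by (simp add: n_def ck_def)
    next
      case (Suc m)
      have "?G k = c (k, 0) * basis (k, 0) x + (\<Sum>j=1..<Suc m. c (k, j) * basis (k, j) x)"
        using that Suc by (simp add: n_def base_order_def sum.atLeast_Suc_lessThan)
      thus ?thesis unfolding shift using Suc that by (simp add: ck_def)
    qed
    have "(\<Sum>p\<in>pole_index base_order n. c p * basis p x) = (\<Sum>i\<le>3. ?G i)"
      unfolding pole_index_def by (subst sum.Sigma) (simp_all add: case_prod_unfold)
    also have "\<dots> = ?G 0 + (\<Sum>k=1..3. ?G k)" unfolding atMost_3_eq by simp
    also have "(\<Sum>k=1..3. ?G k) = (\<Sum>k=1..3. (\<Sum>j<l k - 1. c (k, Suc j) * ?D k j x) + ck k * wp_logderiv k x)"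
      by (rule sum.cong[OF refl Gk])
    also have "?G 0 + \<dots> = (\<Sum>i\<le>3. \<Sum>j<l i - 1. c (i, Suc j) * ?D i j x) + (\<Sum>k=1..3. ck k * wp_logderiv k x)"
      unfolding atMost_3_eq G0 by (simp add: sum.distrib)
    finally show ?thesis using c[rule_format, OF x] by simp
  qed
  have B: "Lambda_tilde \<omega>1 \<omega>3 l t x = exp (kappa_bar \<omega>1 \<omega>3 l t' * x) * f x" for x
    using Lambda_tilde_shift[of l t t' x, OF t t'] C by (simp add: f_def)
  show ?thesis
    by (intro exI[of _ c0] exI[of _ ck] exI[of _ "\<lambda>i j. c (i, Suc j)"] allI impI) (simp only: B A not_False_eq_True)
qed

end

section \<open>Linear systems with polynomial coefficients\<close>

text \<open>Fraction-free Gaussian elimination, one unknown at a time. A nonzero pivot polynomial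
  has finitely many roots, so without them the reduced system still has nonzero solutions at
  infinitely many points. As the induction runs over the unknowns, there may be infinitely many
  rows; later there are two for every x.\<close>

lemma polynomial_kernel_vector:
  fixes M :: "'r \<Rightarrow> 'i \<Rightarrow> complex poly"
  assumes "finite I" "infinite A"
    and "\<And>e. e \<in> A \<Longrightarrow> \<exists>v. (\<exists>i\<in>I. v i \<noteq> 0) \<and> (\<forall>r\<in>R. (\<Sum>i\<in>I. poly (M r i) e * v i) = 0)"
  shows "\<exists>w. (\<exists>i\<in>I. w i \<noteq> 0) \<and> (\<forall>r\<in>R. (\<Sum>i\<in>I. M r i * w i) = 0)"
  using assms
proof (induction I arbitrary: M A rule: finite_induct)
  case empty
  from empty(1) obtain e where "e \<in> A" by (metis finite.emptyI ex_in_conv)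
  from empty(2)[OF this] show ?case by simp
next
  case (insert j I)
  show ?case
  proof (cases "\<forall>r\<in>R. M r j = 0")
    case True
    let ?w = "\<lambda>i. if i = j then 1 else 0 :: complex poly"
    have "(\<Sum>i\<in>insert j I. M r i * ?w i) = 0" if "r \<in> R" for r
    proof -
      have "(\<Sum>i\<in>I. M r i * ?w i) = 0" by (rule sum.neutral) (use insert.hyps in auto)
      thus ?thesis using True that insert.hyps by simp
    qed
    thus ?thesis by (intro exI[of _ ?w]) auto
  next
    case False
    then obtain r0 where r0: "r0 \<in> R" "M r0 j \<noteq> 0" by auto
    let ?a = "M r0 j"
    define M' where "M' r i = ?a * M r i - M r j * M r0 i" for r i
    define A' where "A' = A - {e. poly ?a e = 0}"
    have "infinite A'" unfolding A'_def using insert.prems(1) poly_roots_finite[OF r0(2)] by (rule Diff_infinite_finite[rotated])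
    moreover have "\<exists>v. (\<exists>i\<in>I. v i \<noteq> 0) \<and> (\<forall>r\<in>R. (\<Sum>i\<in>I. poly (M' r i) e * v i) = 0)" if e: "e \<in> A'" for e
    proof -
      obtain v where v: "\<exists>i\<in>insert j I. v i \<noteq> 0" "\<And>r. r \<in> R \<Longrightarrow> (\<Sum>i\<in>insert j I. poly (M r i) e * v i) = 0"
        using insert.prems(2)[of e] e unfolding A'_def by blast
      have row: "(\<Sum>i\<in>I. poly (M r i) e * v i) = - (poly (M r j) e * v j)" if "r \<in> R" for r
        using v(2)[OF that] insert.hyps by (simp add: eq_neg_iff_add_eq_0 add.commute)
      have "\<exists>i\<in>I. v i \<noteq> 0"
      proof (rule ccontr)
        assume neg: "\<not> (\<exists>i\<in>I. v i \<noteq> 0)"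
        hence "poly ?a e * v j = 0" using row[OF r0(1)] by simp
        hence "v j = 0" using e by (simp add: A'_def)
        thus False using v(1) neg by auto
      qed
      moreover have "(\<Sum>i\<in>I. poly (M' r i) e * v i) = 0" if "r \<in> R" for r
      proof -
        have "(\<Sum>i\<in>I. poly (M' r i) e * v i) = poly ?a e * (\<Sum>i\<in>I. poly (M r i) e * v i) - poly (M r j) e * (\<Sum>i\<in>I. poly (M r0 i) e * v i)"
          by (simp add: M'_def sum_distrib_left sum_subtractf[symmetric] algebra_simps)
        thus ?thesis by (simp add: row[OF that] row[OF r0(1)])
      qed
      ultimately show ?thesis by blast
    qed
    ultimately obtain w where w: "\<exists>i\<in>I. w i \<noteq> 0" "\<And>r. r \<in> R \<Longrightarrow> (\<Sum>i\<in>I. M' r i * w i) = 0"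
      using insert.IH[of A' M'] by blast
    \<comment> \<open>Back substitution without division: scaling by the pivot \<open>?a\<close>
      makes row \<open>r0\<close> hold by construction and reduces row \<open>r\<close> to row
      \<open>r\<close> of \<open>M'\<close>.\<close>
    let ?w = "\<lambda>i. if i = j then - (\<Sum>i\<in>I. M r0 i * w i) else ?a * w i"
    have "(\<Sum>i\<in>insert j I. M r i * ?w i) = 0" if "r \<in> R" for r
    proof -
      have "(\<Sum>i\<in>I. M r i * ?w i) = (\<Sum>i\<in>I. M r i * (?a * w i))"
        by (rule sum.cong) (use insert.hyps in auto)
      hence "(\<Sum>i\<in>insert j I. M r i * ?w i) = (\<Sum>i\<in>I. M' r i * w i)"
        using insert.hyps by (simp add: M'_def sum_distrib_left sum_subtractf algebra_simps)
      thus ?thesis using w(2)[OF that] by simp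
    qed
    moreover obtain i where "i \<in> I" "w i \<noteq> 0" using w(1) by auto
    hence "?w i \<noteq> 0" using insert.hyps r0(2) by auto
    with \<open>i \<in> I\<close> have "\<exists>i\<in>insert j I. ?w i \<noteq> 0" by blast
    ultimately show ?thesis by (intro exI[of _ ?w]) simp
  qed
qed

text \<open>A common root of all components is a common linear factor, and it can be divided out of
  a homogeneous system. The total degree drops, so the process ends with a vector that vanishes
  nowhere.\<close>

lemma primitive_kernel_vector:
  fixes M :: "'r \<Rightarrow> 'i \<Rightarrow> complex poly"
  assumes "finite I" "\<exists>i\<in>I. w i \<noteq> 0" "\<forall>r\<in>R. (\<Sum>i\<in>I. M r i * w i) = 0"
  shows "\<exists>w. (\<forall>e. \<exists>i\<in>I. poly (w i) e \<noteq> 0) \<and> (\<forall>r\<in>R. (\<Sum>i\<in>I. M r i * w i) = 0)"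
  using assms(2,3)
proof (induction "\<Sum>i\<in>I. degree (w i)" arbitrary: w rule: less_induct)
  case less
  show ?case
  proof (cases "\<forall>e. \<exists>i\<in>I. poly (w i) e \<noteq> 0")
    case False
    then obtain e where e: "\<And>i. i \<in> I \<Longrightarrow> poly (w i) e = 0" by auto
    define u where "u i = (if i \<in> I then w i div [:- e, 1:] else 0)" for i
    have u: "w i = [:- e, 1:] * u i" if "i \<in> I" for i
      using e[OF that] that unfolding poly_eq_0_iff_dvd u_def by (simp only: if_True dvd_mult_div_cancel)
    obtain i where i: "i \<in> I" "w i \<noteq> 0" using less.prems(1) by auto
    have deg: "degree (w j) = Suc (degree (u j))" if "j \<in> I" "w j \<noteq> 0" for j
    proof -
      have "u j \<noteq> 0" using u[OF that(1)] that(2) by auto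
      hence "degree ([:- e, 1:] * u j) = degree [:- e, 1:] + degree (u j)" by (intro degree_mult_eq) auto
      thus ?thesis using u[OF that(1)] by simp
    qed
    have "(\<Sum>i\<in>I. degree (u i)) < (\<Sum>i\<in>I. degree (w i))"
    proof (rule sum_strict_mono_ex1[OF assms(1)])
      show "\<forall>j\<in>I. degree (u j) \<le> degree (w j)"
      proof
        fix j assume "j \<in> I"
        thus "degree (u j) \<le> degree (w j)"
          using deg[of j] by (cases "w j = 0") (auto simp: u_def)
      qed
      show "\<exists>j\<in>I. degree (u j) < degree (w j)" using deg[OF i] i by (intro bexI[of _ i]) simp_all
    qed
    moreover have "u i \<noteq> 0" using u[OF i(1)] i(2) by auto
    hence "\<exists>i\<in>I. u i \<noteq> 0" using i(1) by blast
    moreover have "(\<Sum>i\<in>I. M r i * u i) = 0" if "r \<in> R" for r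
    proof -
      have "[:- e, 1:] * (\<Sum>i\<in>I. M r i * u i) = (\<Sum>i\<in>I. M r i * w i)"
        unfolding sum_distrib_left by (rule sum.cong) (simp_all only: u mult.left_commute)
      hence "[:- e, 1:] * (\<Sum>i\<in>I. M r i * u i) = 0" using less.prems(2) that by simp
      thus ?thesis by (simp only: mult_eq_0_iff) simp
    qed
    ultimately show ?thesis using less.hyps[of u] by blast
  next
    case True
    thus ?thesis using less.prems(2) by (intro exI[of _ w]) simp
  qed
qed

lemma polynomial_interpolation:
  fixes f :: "complex \<Rightarrow> complex"
  assumes "finite A"
  shows "\<exists>p. \<forall>e\<in>A. poly p e = f e"
  using assms
proof (induction A rule: finite_induct)
  case (insert a A)
  then obtain p where p: "\<forall>e\<in>A. poly p e = f e" by auto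
  let ?r = "\<Prod>e\<in>A. [:- e, 1:]"
  have r: "poly ?r a \<noteq> 0" "\<And>e. e \<in> A \<Longrightarrow> poly ?r e = 0"
    using insert.hyps by (auto simp: poly_prod)
  let ?p = "p + smult ((f a - poly p a) / poly ?r a) ?r"
  have "poly ?p e = f e" if "e \<in> insert a A" for e
    using that p r insert.hyps by (cases "e = a") auto
  thus ?case by blast
qed auto

text \<open>Nothing is assumed about the size of A. If A is infinite, a solution over the
  polynomials is made primitive; if A is finite, the pointwise solutions are interpolated.\<close>

lemma polynomial_kernel_everywhere:
  fixes M :: "'r \<Rightarrow> 'i \<Rightarrow> complex poly"
  assumes I: "finite I"
    and ker: "\<And>e. e \<in> A \<Longrightarrow> \<exists>v. (\<exists>i\<in>I. v i \<noteq> 0) \<and> (\<forall>r\<in>R. (\<Sum>i\<in>I. poly (M r i) e * v i) = 0)"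
  shows "\<exists>w. \<forall>e\<in>A. (\<exists>i\<in>I. poly (w i) e \<noteq> 0) \<and> (\<forall>r\<in>R. (\<Sum>i\<in>I. poly (M r i) e * poly (w i) e) = 0)"
proof (cases "finite A")
  case True
  have "\<forall>e\<in>A. \<exists>v. (\<exists>i\<in>I. v i \<noteq> 0) \<and> (\<forall>r\<in>R. (\<Sum>i\<in>I. poly (M r i) e * v i) = 0)" using ker by blast
  from bchoice[OF this] obtain v where v: "\<forall>e\<in>A. (\<exists>i\<in>I. v e i \<noteq> 0) \<and> (\<forall>r\<in>R. (\<Sum>i\<in>I. poly (M r i) e * v e i) = 0)" ..
  have "\<forall>i. \<exists>p. \<forall>e\<in>A. poly p e = v e i" by (intro allI polynomial_interpolation[OF True])
  from choice[OF this] obtain w where "\<forall>i. \<forall>e\<in>A. poly (w i) e = v e i" ..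
  thus ?thesis using v by (intro exI[of _ w]) simp
next
  case False
  obtain w where w: "\<exists>i\<in>I. w i \<noteq> 0" "\<forall>r\<in>R. (\<Sum>i\<in>I. M r i * w i) = 0"
    using polynomial_kernel_vector[OF I False ker] by blast
  obtain w where w: "\<forall>e. \<exists>i\<in>I. poly (w i) e \<noteq> 0" "\<forall>r\<in>R. (\<Sum>i\<in>I. M r i * w i) = 0"
    using primitive_kernel_vector[OF I w] by blast
  have "(\<Sum>i\<in>I. poly (M r i) e * poly (w i) e) = 0" if "r \<in> R" for r e
  proof -
    have "poly (\<Sum>i\<in>I. M r i * w i) e = 0" using w(2) that by simp
    thus ?thesis by (simp add: poly_sum)
  qed
  thus ?thesis using w(1) by (intro exI[of _ w]) simp
qed

text \<open>Independence is extracted from a family rather than verified for concrete functions: a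
  maximal independent part still spans. It is what makes a nonzero coefficient vector represent a
  nonzero function.\<close>

lemma maximal_independent_subset_on:
  fixes B :: "'i \<Rightarrow> 'x \<Rightarrow> complex"
  assumes "finite I"
  shows "\<exists>J\<subseteq>I. (\<forall>c. (\<forall>x\<in>D. (\<Sum>j\<in>J. c j * B j x) = 0) \<longrightarrow> (\<forall>j\<in>J. c j = 0)) \<and>
      (\<forall>c. \<exists>c'. \<forall>x\<in>D. (\<Sum>i\<in>I. c i * B i x) = (\<Sum>j\<in>J. c' j * B j x))"
  using assms
proof (induction I rule: finite_induct)
  case empty
  thus ?case by (intro exI[of _ "{}"]) auto
next
  case (insert a I)
  then obtain J where J: "J \<subseteq> I" "\<And>c. (\<forall>x\<in>D. (\<Sum>j\<in>J. c j * B j x) = 0) \<Longrightarrow> (\<forall>j\<in>J. c j = 0)"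
      "\<And>c. \<exists>c'. \<forall>x\<in>D. (\<Sum>i\<in>I. c i * B i x) = (\<Sum>j\<in>J. c' j * B j x)" by blast
  have fJ: "finite J" "a \<notin> J" using J(1) insert.hyps finite_subset by auto
  show ?case
  proof (cases "\<exists>d. \<forall>x\<in>D. B a x = (\<Sum>j\<in>J. d j * B j x)")
    case True
    then obtain d where d: "\<forall>x\<in>D. B a x = (\<Sum>j\<in>J. d j * B j x)" ..
    have "\<exists>c'. \<forall>x\<in>D. (\<Sum>i\<in>insert a I. c i * B i x) = (\<Sum>j\<in>J. c' j * B j x)" for c
    proof -
      obtain c' where c': "\<forall>x\<in>D. (\<Sum>i\<in>I. c i * B i x) = (\<Sum>j\<in>J. c' j * B j x)" using J(3)[of c] ..
      have "(\<Sum>i\<in>insert a I. c i * B i x) = (\<Sum>j\<in>J. (c a * d j + c' j) * B j x)" if "x \<in> D" for x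
        using c' d that insert.hyps by (simp add: sum_distrib_left sum.distrib algebra_simps)
      thus ?thesis by (intro exI[of _ "\<lambda>j. c a * d j + c' j"]) simp
    qed
    thus ?thesis using J by (intro exI[of _ J]) auto
  next
    case False
    have "\<forall>j\<in>insert a J. c j = 0" if c: "\<forall>x\<in>D. (\<Sum>j\<in>insert a J. c j * B j x) = 0" for c
    proof -
      have c': "c a * B a x + (\<Sum>j\<in>J. c j * B j x) = 0" if "x \<in> D" for x
        using c that fJ by simp
      have "c a = 0"
      proof (rule ccontr)
        assume ca: "c a \<noteq> 0"
        have "B a x = (\<Sum>j\<in>J. (- c j / c a) * B j x)" if "x \<in> D" for x
        proof -
          have "c a * B a x = - (\<Sum>j\<in>J. c j * B j x)" using c'[OF that] by (simp add: eq_neg_iff_add_eq_0)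
          hence "B a x = - (\<Sum>j\<in>J. c j * B j x) / c a" using ca by (simp add: field_simps)
          thus ?thesis by (simp add: sum_negf[symmetric] sum_divide_distrib)
        qed
        hence "\<forall>x\<in>D. B a x = (\<Sum>j\<in>J. (- c j / c a) * B j x)" by blast
        thus False using False by (elim notE) (rule exI)
      qed
      thus ?thesis using J(2)[of c] c' by simp
    qed
    moreover have "\<exists>c'. \<forall>x\<in>D. (\<Sum>i\<in>insert a I. c i * B i x) = (\<Sum>j\<in>insert a J. c' j * B j x)" for c
    proof -
      obtain c' where c': "\<forall>x\<in>D. (\<Sum>i\<in>I. c i * B i x) = (\<Sum>j\<in>J. c' j * B j x)" using J(3)[of c] ..
      have "(\<Sum>j\<in>J. (c'(a := c a)) j * B j x) = (\<Sum>j\<in>J. c' j * B j x)" for x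
        by (rule sum.cong) (use fJ in auto)
      hence "(\<Sum>i\<in>insert a I. c i * B i x) = (\<Sum>j\<in>insert a J. (c'(a := c a)) j * B j x)" if "x \<in> D" for x
        using c' that insert.hyps fJ by simp
      thus ?thesis by (intro exI[of _ "c'(a := c a)"]) simp
    qed
    ultimately show ?thesis using J(1) by (intro exI[of _ "insert a J"]) auto
  qed
qed

text \<open>Functions of \<open>E\<close> and \<open>s = \<surd>(-Q(E))\<close>; the involution \<open>\<nu>\<close> accompanies the change of sign of \<open>s\<close>.\<close>
locale root_extension =
  fixes A :: "(complex \<times> complex \<times> 't) set" and Q :: "complex poly" and \<nu> :: "'t \<Rightarrow> 't"
  assumes square: "(E, s, t) \<in> A \<Longrightarrow> s ^ 2 = - poly Q E"
    and involution: "(E, s, t) \<in> A \<Longrightarrow> (E, - s, \<nu> t) \<in> A"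
begin

text \<open>Elements of the extension of the rational functions of E by s, with a denominator that
  vanishes at no point of A. This keeps the final formulas free of exceptional E.\<close>

definition rat :: "(complex \<Rightarrow> complex \<Rightarrow> 't \<Rightarrow> complex) \<Rightarrow> bool" where
  "rat F \<longleftrightarrow> (\<exists>p q r. r \<noteq> 0 \<and> (\<forall>E s t. (E, s, t) \<in> A \<longrightarrow> poly r E \<noteq> 0 \<and> F E s t = (poly p E + s * poly q E) / poly r E))"

lemma ratI:
  assumes "r \<noteq> 0" "\<And>E s t. (E, s, t) \<in> A \<Longrightarrow> poly r E \<noteq> 0"
    "\<And>E s t. (E, s, t) \<in> A \<Longrightarrow> F E s t = (poly p E + s * poly q E) / poly r E"
  shows "rat F"
  unfolding rat_def using assms by blast

lemma ratE:
  assumes "rat F"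
  obtains p q r where "r \<noteq> 0" "\<And>E s t. (E, s, t) \<in> A \<Longrightarrow> poly r E \<noteq> 0"
    "\<And>E s t. (E, s, t) \<in> A \<Longrightarrow> F E s t = (poly p E + s * poly q E) / poly r E"
  using assms unfolding rat_def by blast

lemma rat_poly: "rat (\<lambda>E s t. poly p E)"
  by (rule ratI[of 1 _ p 0]) auto

lemma rat_const: "rat (\<lambda>E s t. c)"
  using rat_poly[of "[:c:]"] by simp

lemma rat_root: "rat (\<lambda>E s t. s)"
  by (rule ratI[of 1 _ 0 1]) auto

lemma rat_cong:
  assumes "rat F" "\<And>E s t. (E, s, t) \<in> A \<Longrightarrow> F E s t = G E s t"
  shows "rat G"
  using assms unfolding rat_def by simp

lemma rat_add:
  assumes "rat F" "rat G"
  shows "rat (\<lambda>E s t. F E s t + G E s t)"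
proof -
  obtain p q r where F: "r \<noteq> 0" "\<And>E s t. (E, s, t) \<in> A \<Longrightarrow> poly r E \<noteq> 0"
    "\<And>E s t. (E, s, t) \<in> A \<Longrightarrow> F E s t = (poly p E + s * poly q E) / poly r E" using assms(1) by (rule ratE) blast
  obtain p' q' r' where G: "r' \<noteq> 0" "\<And>E s t. (E, s, t) \<in> A \<Longrightarrow> poly r' E \<noteq> 0"
    "\<And>E s t. (E, s, t) \<in> A \<Longrightarrow> G E s t = (poly p' E + s * poly q' E) / poly r' E" using assms(2) by (rule ratE) blast
  show ?thesis
  proof (rule ratI[of "r * r'" _ "p * r' + p' * r" "q * r' + q' * r"])
    fix E s t assume *: "(E, s, t) \<in> A"
    show "F E s t + G E s t = (poly (p * r' + p' * r) E + s * poly (q * r' + q' * r) E) / poly (r * r') E"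
      unfolding F(3)[OF *] G(3)[OF *] using F(2)[OF *] G(2)[OF *] by (simp add: field_simps)
  qed (use F G in auto)
qed

lemma rat_mult:
  assumes "rat F" "rat G"
  shows "rat (\<lambda>E s t. F E s t * G E s t)"
proof -
  obtain p q r where F: "r \<noteq> 0" "\<And>E s t. (E, s, t) \<in> A \<Longrightarrow> poly r E \<noteq> 0"
    "\<And>E s t. (E, s, t) \<in> A \<Longrightarrow> F E s t = (poly p E + s * poly q E) / poly r E" using assms(1) by (rule ratE) blast
  obtain p' q' r' where G: "r' \<noteq> 0" "\<And>E s t. (E, s, t) \<in> A \<Longrightarrow> poly r' E \<noteq> 0"
    "\<And>E s t. (E, s, t) \<in> A \<Longrightarrow> G E s t = (poly p' E + s * poly q' E) / poly r' E" using assms(2) by (rule ratE) blast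
  show ?thesis
  proof (rule ratI[of "r * r'" _ "p * p' - Q * q * q'" "p * q' + q * p'"])
    fix E s t assume *: "(E, s, t) \<in> A"
    have "poly Q E = - (s * s)" using square[OF *] by (simp add: power2_eq_square)
    thus "F E s t * G E s t = (poly (p * p' - Q * q * q') E + s * poly (p * q' + q * p') E) / poly (r * r') E"
      unfolding F(3)[OF *] G(3)[OF *] by (simp add: algebra_simps)
  qed (use F G in auto)
qed

lemma rat_diff: "rat F \<Longrightarrow> rat G \<Longrightarrow> rat (\<lambda>E s t. F E s t - G E s t)"
  using rat_add[OF _ rat_mult[OF rat_const[of "- 1"]], of F G] by simp

lemma rat_sum:
  assumes "finite I" "\<And>i. i \<in> I \<Longrightarrow> rat (F i)"
  shows "rat (\<lambda>E s t. \<Sum>i\<in>I. F i E s t)"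
  using assms by (induction I rule: finite_induct) (auto intro: rat_const rat_add)

text \<open>Rationalising the denominator: the norm p^2 + Q q^2 equals (p + s q)(p - s q). The
  conjugate factor belongs to the value of F at the point paired by the involution, so it is nonzero
  too.\<close>

lemma rat_inverse:
  assumes "rat F" and nz: "\<And>E s t. (E, s, t) \<in> A \<Longrightarrow> F E s t \<noteq> 0"
  shows "rat (\<lambda>E s t. inverse (F E s t))"
proof (cases "A = {}")
  \<comment> \<open>The norm is known to be a nonzero polynomial only if A has a point.\<close>
  case True
  thus ?thesis by (intro ratI[of 1]) auto
next
  case False
  obtain p q r where F: "r \<noteq> 0" "\<And>E s t. (E, s, t) \<in> A \<Longrightarrow> poly r E \<noteq> 0"
    "\<And>E s t. (E, s, t) \<in> A \<Longrightarrow> F E s t = (poly p E + s * poly q E) / poly r E" using assms(1) by (rule ratE) blast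
  let ?N = "p * p + Q * q * q"
  have N: "poly ?N E = (poly p E + s * poly q E) * (poly p E - s * poly q E)" if "(E, s, t) \<in> A" for E s t
  proof -
    have "poly Q E = - (s * s)" using square[OF that] by (simp add: power2_eq_square)
    thus ?thesis by (simp add: algebra_simps)
  qed
  have nz': "poly p E + s * poly q E \<noteq> 0" "poly p E - s * poly q E \<noteq> 0" if *: "(E, s, t) \<in> A" for E s t
    using nz[OF *] nz[OF involution[OF *]] F(3)[OF *] F(3)[OF involution[OF *]] by auto
  have N0: "poly ?N E \<noteq> 0" if "(E, s, t) \<in> A" for E s t
    unfolding N[OF that] using nz'[OF that] by simp
  have "?N \<noteq> 0" using False N0 by fastforce
  thus ?thesis
  proof (rule ratI[of ?N _ "r * p" "- (r * q)"])
    fix E s t assume *: "(E, s, t) \<in> A"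
    have "inverse (F E s t) = poly r E / (poly p E + s * poly q E)" unfolding F(3)[OF *] by simp
    also have "\<dots> = (poly r E * (poly p E - s * poly q E)) / poly ?N E"
      unfolding N[OF *] using nz'[OF *] by simp
    finally show "inverse (F E s t) = (poly (r * p) E + s * poly (- (r * q)) E) / poly ?N E"
      by (simp add: algebra_simps)
  qed (rule N0)
qed

lemma rat_divide:
  assumes "rat F" "rat G" "\<And>E s t. (E, s, t) \<in> A \<Longrightarrow> G E s t \<noteq> 0"
  shows "rat (\<lambda>E s t. F E s t / G E s t)"
  unfolding divide_inverse by (intro rat_mult assms(1) rat_inverse assms(2,3))

text \<open>The points with (s, t) and (-s, \<nu> t) share E and thus the values of p, q and r;
  equality of the two values of F kills the part with s.\<close>

lemma rat_even:
  assumes "rat F" "\<And>E s t. (E, s, t) \<in> A \<Longrightarrow> F E (- s) (\<nu> t) = F E s t"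
  shows "\<exists>p r. r \<noteq> 0 \<and> (\<forall>E s t. (E, s, t) \<in> A \<longrightarrow> poly r E \<noteq> 0 \<and> F E s t = poly p E / poly r E)"
proof -
  obtain p q r where F: "r \<noteq> 0" "\<And>E s t. (E, s, t) \<in> A \<Longrightarrow> poly r E \<noteq> 0"
    "\<And>E s t. (E, s, t) \<in> A \<Longrightarrow> F E s t = (poly p E + s * poly q E) / poly r E" using assms(1) by (rule ratE) blast
  have "F E s t = poly p E / poly r E" if *: "(E, s, t) \<in> A" for E s t
  proof -
    have "poly p E - s * poly q E = poly p E + s * poly q E"
      using assms(2)[OF *] F(3)[OF *] F(3)[OF involution[OF *]] F(2)[OF *] by simp
    hence "s * poly q E = 0" by (simp add: algebra_simps)
    thus ?thesis using F(3)[OF *] by simp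
  qed
  thus ?thesis using F(1,2) by blast
qed

lemma rat_odd:
  assumes "rat F" "\<And>E s t. (E, s, t) \<in> A \<Longrightarrow> F E (- s) (\<nu> t) = - F E s t"
  shows "\<exists>p r. r \<noteq> 0 \<and> (\<forall>E s t. (E, s, t) \<in> A \<longrightarrow> poly r E \<noteq> 0 \<and> F E s t = poly p E / poly r E * s)"
proof -
  obtain p q r where F: "r \<noteq> 0" "\<And>E s t. (E, s, t) \<in> A \<Longrightarrow> poly r E \<noteq> 0"
    "\<And>E s t. (E, s, t) \<in> A \<Longrightarrow> F E s t = (poly p E + s * poly q E) / poly r E" using assms(1) by (rule ratE) blast
  have "F E s t = poly q E / poly r E * s" if *: "(E, s, t) \<in> A" for E s t
  proof -
    have "poly p E - s * poly q E = - (poly p E + s * poly q E)"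
      using assms(2)[OF *] F(3)[OF *] F(3)[OF involution[OF *]] F(2)[OF *] by (simp add: field_simps)
    hence "poly p E = 0" by (simp add: algebra_simps)
    thus ?thesis using F(3)[OF *] by (simp add: mult.commute)
  qed
  thus ?thesis using F(1,2) by blast
qed

end

section \<open>The function \<open>\<Xi>\<close> and its zeros\<close>

context period_pair
begin

lemma deriv_reflect:
  assumes f: "f holomorphic_on - Hpts" and refl: "\<And>x. x \<notin> Hpts \<Longrightarrow> f (- x) = \<epsilon> * f x" and x: "x \<notin> Hpts"
  shows "deriv f (- x) = - \<epsilon> * deriv f x"
proof -
  have d: "(f has_field_derivative deriv f y) (at y)" if "y \<notin> Hpts" for y
    by (rule holomorphic_derivI[OF f open_off_Hpts]) (use that in auto)
  have "((\<lambda>y. f (- y)) has_field_derivative deriv f (- x) * - 1) (at x)"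
    by (rule DERIV_chain2[of f], rule d) (use x in \<open>auto intro!: derivative_eq_intros\<close>)
  hence "((\<lambda>y. \<epsilon> * f y) has_field_derivative deriv f (- x) * - 1) (at x)"
    by (rule has_field_derivative_transform_within_open[OF _ open_off_Hpts]) (use x refl in auto)
  moreover have "((\<lambda>y. \<epsilon> * f y) has_field_derivative \<epsilon> * deriv f x) (at x)"
    by (intro DERIV_cmult d x)
  ultimately have "deriv f (- x) * - 1 = \<epsilon> * deriv f x" by (rule DERIV_unique)
  thus ?thesis by (metis minus_mult_left mult.commute mult_minus1 minus_minus)
qed

lemma wp_shift_reflect:
  assumes "x \<notin> Hpts" "i \<le> 3"
  shows "P (- x + hp i) = P (x + hp i)"
proof -
  have "P (- x + hp i) = P (x - hp i)" using wp_uminus[of "x - hp i"] by simp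
  also have "\<dots> = P (x - hp i + 2 * hp i)"
    by (rule wp_periodic[symmetric, OF two_half_period])
       (use Hpts_half[OF assms] half_period_sum_iff in simp)
  finally show ?thesis by (simp add: add.commute)
qed

lemma wp_derivative': "x \<notin> Lat \<Longrightarrow> (P has_field_derivative deriv P x) (at x)"
  using wp_derivative[of x] DERIV_imp_deriv by fastforce

lemma wp_deriv_periodic': "x \<notin> Lat \<Longrightarrow> \<tau> \<in> Lat \<Longrightarrow> deriv P (x + \<tau>) = deriv P x"
  using DERIV_imp_deriv[OF wp_derivative[of x]] DERIV_imp_deriv[OF wp_derivative[of "x + \<tau>"]] wp_deriv_periodic[of \<tau> x]
  by simp

lemma wp_deriv_uminus:
  assumes "x \<notin> Lat"
  shows "deriv P (- x) = - deriv P x"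
proof -
  have "(\<Sum>\<^sub>\<infinity>w\<in>Lat. 1 / (- x - w) ^ 3) = (\<Sum>\<^sub>\<infinity>w\<in>Lat. - (1 / (x - w) ^ 3))"
  proof (rule infsum_reindex_bij_witness[of _ uminus uminus])
    fix w
    have "(- x - w) ^ 3 = - ((x - - w) ^ 3)" by (simp add: power3_eq_cube algebra_simps)
    thus "- (1 / (x - - w) ^ 3) = 1 / (- x - w) ^ 3" by simp
  qed auto
  thus ?thesis
    using DERIV_imp_deriv[OF wp_derivative[OF assms]] DERIV_imp_deriv[OF wp_derivative[of "- x"]] assms
    by (simp add: infsum_uminus)
qed

lemma zero_prod_deriv: "(zero_prod L t has_field_derivative deriv (zero_prod L t) x) (at x)"
  by (rule holomorphic_derivI[OF zero_prod_holomorphic[of L t UNIV]]) auto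

lemma Theta_deriv: "(Theta n has_field_derivative deriv (Theta n) x) (at x)"
  by (rule holomorphic_derivI[OF Theta_holomorphic[of n UNIV]]) auto

lemma zero_prod_deriv_quasi_periodic:
  assumes "\<tau> \<in> Lat"
  shows "deriv (zero_prod L t) (x + \<tau>) = exp (of_nat L * (qa \<tau> * x + qb \<tau>) + qa \<tau> * (\<Sum>j=1..L. t j))
     * (of_nat L * qa \<tau> * zero_prod L t x + deriv (zero_prod L t) x)"
proof -
  let ?A = "\<lambda>x. of_nat L * (qa \<tau> * x + qb \<tau>) + qa \<tau> * (\<Sum>j=1..L. t j)"
  have "((\<lambda>x. zero_prod L t (x + \<tau>)) has_field_derivative deriv (zero_prod L t) (x + \<tau>) * 1) (at x)"
    by (rule DERIV_chain2[of "zero_prod L t"], rule zero_prod_deriv) (auto intro!: derivative_eq_intros)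
  moreover have "((\<lambda>x. zero_prod L t (x + \<tau>)) has_field_derivative
      (exp (?A x) * (of_nat L * qa \<tau>) * zero_prod L t x + deriv (zero_prod L t) x * exp (?A x))) (at x)"
    unfolding zero_prod_quasi_periodic[OF assms]
    by (intro DERIV_mult zero_prod_deriv) (auto intro!: derivative_eq_intros)
  ultimately have "deriv (zero_prod L t) (x + \<tau>) * 1 =
      exp (?A x) * (of_nat L * qa \<tau>) * zero_prod L t x + deriv (zero_prod L t) x * exp (?A x)" by (rule DERIV_unique)
  thus ?thesis by (simp only: mult_1_right) (simp only: algebra_simps)
qed

lemma countable_zero_prod: "countable {x. zero_prod L t x = 0}"
proof -
  have "{x. zero_prod L t x = 0} = (\<Union>j\<in>{1..L}. {x. x + t j \<in> Lat})"
    by (auto simp: zero_prod_def wsigma_eq_0_iff)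
  thus ?thesis by (simp add: countable_shifted_Lat)
qed

end

locale finite_gap_data = period_pair +
  fixes l :: "nat \<Rightarrow> nat" and c0 :: "complex poly" and b :: "nat \<Rightarrow> nat \<Rightarrow> complex poly" and Q :: "complex poly"
begin

abbreviation "X \<equiv> Xi \<omega>1 \<omega>3 l c0 b"
abbreviation "L \<equiv> l_total l"

text \<open>At a fixed x both \<Xi> and its derivative are polynomials in E; they become the
  coefficients of the linear system.\<close>

definition Xi_poly :: "complex \<Rightarrow> complex poly" where
  "Xi_poly x = c0 + (\<Sum>i\<le>3. \<Sum>j<l i. smult (P (x + hp i) ^ (l i - j)) (b i j))"

definition Xi_deriv_poly :: "complex \<Rightarrow> complex poly" where
  "Xi_deriv_poly x = (\<Sum>i\<le>3. \<Sum>j<l i. smult (of_nat (l i - j) * (deriv P (x + hp i) * P (x + hp i) ^ (l i - j - 1))) (b i j))"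

lemma poly_Xi: "poly (Xi_poly x) E = X E x"
  by (simp add: Xi_poly_def Xi_def poly_sum mult.commute)

lemma Xi_derivative:
  assumes "x \<notin> Hpts"
  shows "(X E has_field_derivative poly (Xi_deriv_poly x) E) (at x)"
proof -
  have d: "((\<lambda>x. P (x + hp i)) has_field_derivative deriv P (x + hp i)) (at x)" if "i \<le> 3" for i
  proof -
    have "((\<lambda>x. P (x + hp i)) has_field_derivative deriv P (x + hp i) * 1) (at x)"
      by (rule DERIV_chain2[of P], rule wp_derivative') (use Hpts_half[OF assms that] in \<open>auto intro!: derivative_eq_intros\<close>)
    thus ?thesis by simp
  qed
  have "((\<lambda>x. poly c0 E + (\<Sum>i\<le>3. \<Sum>j<l i. poly (b i j) E * P (x + hp i) ^ (l i - j))) has_field_derivative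
      0 + (\<Sum>i\<le>3. \<Sum>j<l i. poly (b i j) E * (of_nat (l i - j) * (deriv P (x + hp i) * P (x + hp i) ^ (l i - j - Suc 0))))) (at x)"
    by (intro DERIV_add DERIV_const DERIV_sum DERIV_cmult DERIV_power d) auto
  moreover have "X E = (\<lambda>x. poly c0 E + (\<Sum>i\<le>3. \<Sum>j<l i. poly (b i j) E * P (x + hp i) ^ (l i - j)))"
    by (rule ext) (simp add: Xi_def)
  moreover have "0 + (\<Sum>i\<le>3. \<Sum>j<l i. poly (b i j) E * (of_nat (l i - j) * (deriv P (x + hp i) * P (x + hp i) ^ (l i - j - Suc 0))))
      = poly (Xi_deriv_poly x) E"
    by (simp add: Xi_deriv_poly_def poly_sum mult_ac)
  ultimately show ?thesis by simp
qed

lemma Xi_holomorphic: "X E holomorphic_on - Hpts"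
  unfolding holomorphic_on_open[OF open_off_Hpts] using Xi_derivative by blast

lemma Xi_deriv: "x \<notin> Hpts \<Longrightarrow> deriv (X E) x = poly (Xi_deriv_poly x) E"
  by (rule DERIV_imp_deriv[OF Xi_derivative])

lemma Xi_cong:
  assumes "\<And>i. i \<le> 3 \<Longrightarrow> P (x + hp i) = P (y + hp i)"
  shows "X E x = X E y"
proof -
  have "(\<Sum>i\<le>3. \<Sum>j<l i. poly (b i j) E * P (x + hp i) ^ (l i - j)) =
      (\<Sum>i\<le>3. \<Sum>j<l i. poly (b i j) E * P (y + hp i) ^ (l i - j))"
    by (intro sum.cong refl) (simp add: assms)
  thus ?thesis by (simp add: Xi_def)
qed

lemma Xi_reflect: "x \<notin> Hpts \<Longrightarrow> X E (- x) = X E x"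
  by (rule Xi_cong) (rule wp_shift_reflect)

lemma Xi_deriv_reflect: "x \<notin> Hpts \<Longrightarrow> poly (Xi_deriv_poly (- x)) E = - poly (Xi_deriv_poly x) E"
  using deriv_reflect[OF Xi_holomorphic[of E], of 1 x] Xi_reflect by (simp add: Xi_deriv)

lemma Xi_qper: "qper trivial_character (X E)"
proof -
  have "P (x + \<tau> + hp i) = P (x + hp i)" if "\<tau> \<in> Lat" "x \<notin> Hpts" "i \<le> 3" for x \<tau> i
    using qperD[OF qper_wp_shift[OF that(3)] that(1,2)] by simp
  hence "X E (x + \<tau>) = X E x" if "\<tau> \<in> Lat" "x \<notin> Hpts" for x \<tau>
    using that by (intro Xi_cong)
  thus ?thesis unfolding qper_def by simp
qed

lemma Xi_deriv_periodic: "x \<notin> Hpts \<Longrightarrow> \<tau> \<in> Lat \<Longrightarrow> poly (Xi_deriv_poly (x + \<tau>)) E = poly (Xi_deriv_poly x) E"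
  using qperD[OF qper_deriv[OF Xi_qper Xi_holomorphic[of E]], of \<tau> x] by (simp add: Xi_deriv)

end

locale zero_system = finite_gap_data +
  fixes E s :: complex and t :: "nat \<Rightarrow> complex"
  assumes s_nonzero: "s \<noteq> 0" and zeros: "is_zero_system \<omega>1 \<omega>3 l c0 b E s t"
begin

lemma zeros_off: "j \<in> {1..L} \<Longrightarrow> t j \<notin> Hpts"
  using zeros unfolding is_zero_system_def by blast

lemma zeros_sum: "i \<in> {1..L} \<Longrightarrow> j \<in> {1..L} \<Longrightarrow> t i + t j \<notin> Lat"
  using zeros unfolding is_zero_system_def by blast

lemma zeros_diff: "i \<in> {1..L} \<Longrightarrow> j \<in> {1..L} \<Longrightarrow> i \<noteq> j \<Longrightarrow> t i - t j \<notin> Lat"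
  using zeros unfolding is_zero_system_def by blast

definition lead :: complex where
  "lead = (SOME C. C \<noteq> 0 \<and> (\<forall>x. x \<notin> Hpts \<longrightarrow> X E x = Xi_rational \<omega>1 \<omega>3 l C t (P x)) \<and>
        (\<forall>j\<in>{1..L}. deriv (Xi_rational \<omega>1 \<omega>3 l C t) (P (t j)) = - 2 * s / deriv P (t j)))"

lemma lead:
  shows lead_nonzero: "lead \<noteq> 0"
    and Xi_eq_rational: "x \<notin> Hpts \<Longrightarrow> X E x = Xi_rational \<omega>1 \<omega>3 l lead t (P x)"
    and Xi_rational_deriv: "j \<in> {1..L} \<Longrightarrow> deriv (Xi_rational \<omega>1 \<omega>3 l lead t) (P (t j)) = - 2 * s / deriv P (t j)"
proof -
  have "lead \<noteq> 0 \<and> (\<forall>x. x \<notin> Hpts \<longrightarrow> X E x = Xi_rational \<omega>1 \<omega>3 l lead t (P x)) \<and>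
        (\<forall>j\<in>{1..L}. deriv (Xi_rational \<omega>1 \<omega>3 l lead t) (P (t j)) = - 2 * s / deriv P (t j))"
    unfolding lead_def by (rule someI_ex) (use zeros in \<open>unfold is_zero_system_def, elim conjE\<close>)
  thus "lead \<noteq> 0" "x \<notin> Hpts \<Longrightarrow> X E x = Xi_rational \<omega>1 \<omega>3 l lead t (P x)"
    "j \<in> {1..L} \<Longrightarrow> deriv (Xi_rational \<omega>1 \<omega>3 l lead t) (P (t j)) = - 2 * s / deriv P (t j)" by auto
qed

text \<open>Chain rule through z = P(x): the sign convention prescribes d\<Xi>/dz at
  \<open>P (t j)\<close>, and \<open>deriv P (t j)\<close> cancels because it is nonzero, 2
  \<open>t j\<close> not being a period.\<close>

lemma Xi_deriv_at_zero:
  assumes j: "j \<in> {1..L}"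
  shows "poly (Xi_deriv_poly (t j)) E = - 2 * s"
proof -
  let ?R = "Xi_rational \<omega>1 \<omega>3 l lead t"
  have tj: "t j \<notin> Hpts" by (rule zeros_off[OF j])
  have nz: "deriv P (t j) \<noteq> 0"
    by (rule wp_deriv_nonzero[OF Hpts_Lat[OF tj]]) (use zeros_sum[OF j j] in \<open>simp only: mult_2 not_False_eq_True\<close>)
  define U where "U = - ((\<lambda>k. e_val \<omega>1 \<omega>3 k) ` {1..3})"
  have U: "open U" unfolding U_def by (intro open_Compl finite_imp_closed) auto
  have "?R holomorphic_on U" unfolding Xi_rational_def[abs_def]
    by (intro holomorphic_intros) (auto simp: U_def)
  hence R: "(?R has_field_derivative deriv ?R (P (t j))) (at (P (t j)))"
  proof (rule holomorphic_derivI[OF _ U])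
    show "P (t j) \<in> U" unfolding U_def Compl_iff image_iff using wp_neq_e_val[OF tj] by blast
  qed
  have "((\<lambda>x. ?R (P x)) has_field_derivative deriv ?R (P (t j)) * deriv P (t j)) (at (t j))"
    by (rule DERIV_chain2[OF R wp_derivative'[OF Hpts_Lat[OF tj]]])
  hence "(X E has_field_derivative deriv ?R (P (t j)) * deriv P (t j)) (at (t j))"
    by (rule has_field_derivative_transform_within_open[OF _ open_off_Hpts]) (use tj Xi_eq_rational in auto)
  from DERIV_unique[OF this Xi_derivative[OF tj]] show ?thesis
    unfolding Xi_rational_deriv[OF j] using nz by simp
qed

lemma Xi_at_zero: "j \<in> {1..L} \<Longrightarrow> X E (t j) = 0"
  using Xi_eq_rational[OF zeros_off] by (auto simp: Xi_rational_def)

abbreviation "p \<equiv> zero_prod L t"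
abbreviation "q \<equiv> zero_prod L (\<lambda>j. - t j)"

text \<open>Every difference of values of wp in the rational form is replaced by its sigma quotient.
  For a half period, S(x - hp k) and S(x + hp k) agree up to an exponential, so their product is a
  square up to that exponential; collecting these gives \<gamma>.\<close>

lemma Xi_factor:
  "\<exists>C \<gamma>. C \<noteq> 0 \<and> (\<forall>x. x \<notin> Hpts \<longrightarrow> X E x * Theta l x ^ 2 = C * p x * q x * exp (\<gamma> * x))"
proof -
  have "\<exists>c. c \<noteq> 0 \<and> (\<forall>x. x \<notin> Lat \<longrightarrow> P x - P y = c * S (x - y) * S (x + y) / S x ^ 2)" if "y \<notin> Lat" for y
    by (rule wp_diff_factor[OF that]) (intro exI conjI)
  hence "\<forall>y. \<exists>c. y \<notin> Lat \<longrightarrow> c \<noteq> 0 \<and> (\<forall>x. x \<notin> Lat \<longrightarrow> P x - P y = c * S (x - y) * S (x + y) / S x ^ 2)" by blast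
  from choice[OF this] obtain c where
    "\<forall>y. y \<notin> Lat \<longrightarrow> c y \<noteq> 0 \<and> (\<forall>x. x \<notin> Lat \<longrightarrow> P x - P y = c y * S (x - y) * S (x + y) / S x ^ 2)" ..
  hence c: "c y \<noteq> 0" "x \<notin> Lat \<Longrightarrow> P x - P y = c y * S (x - y) * S (x + y) / S x ^ 2" if "y \<notin> Lat" for x y
    using that by auto
  let ?g = "\<lambda>k x. qa (2 * hp k) * (x - hp k) + qb (2 * hp k)"
  let ?\<gamma> = "\<Sum>k=1..3. of_nat (l k) * qa (2 * hp k)"
  let ?\<delta> = "\<Sum>k=1..3. of_nat (l k) * (qb (2 * hp k) - qa (2 * hp k) * hp k)"
  let ?ct = "\<Prod>j=1..L. c (t j)"
  let ?ch = "\<Prod>k=1..3. c (hp k) ^ l k"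
  have ct: "?ct \<noteq> 0" using c(1) Hpts_Lat[OF zeros_off] by auto
  have ch: "?ch \<noteq> 0" using c(1) half_period_notin by auto
  let ?C = "lead * ?ct / ?ch * exp ?\<delta>"
  have "X E x * Theta l x ^ 2 = ?C * p x * q x * exp (?\<gamma> * x)" if x: "x \<notin> Hpts" for x
  proof -
    have xL: "x \<notin> Lat" using x by (rule Hpts_Lat)
    have Sx: "S x \<noteq> 0" by (rule wsigma_nonzero[OF x])
    let ?H = "\<Prod>k=1..3. S (x + hp k) ^ (2 * l k)"
    have H: "?H \<noteq> 0" using wsigma_half_nonzero[OF x] by auto
    have num: "(\<Prod>j=1..L. P x - P (t j)) = ?ct * (q x * p x) / S x ^ (2 * L)"
    proof -
      have "(\<Prod>j=1..L. P x - P (t j)) = (\<Prod>j=1..L. c (t j) * (S (x - t j) * S (x + t j)) / S x ^ 2)"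
        by (rule prod.cong) (use c(2)[OF Hpts_Lat[OF zeros_off] xL] in \<open>auto simp: mult.assoc\<close>)
      also have "\<dots> = ?ct * (q x * p x) / (\<Prod>j=1..L. S x ^ 2)"
        by (simp only: prod_dividef prod.distrib zero_prod_def diff_conv_add_uminus)
      finally show ?thesis by (simp add: power_mult)
    qed
    have "(P x - e_val \<omega>1 \<omega>3 k) ^ l k = c (hp k) ^ l k * (exp (- (of_nat (l k) * ?g k x)) * S (x + hp k) ^ (2 * l k)) / S x ^ (2 * l k)"
      if k: "k \<in> {1..3}" for k
    proof -
      have "x - hp k + 2 * hp k = x + hp k" by simp
      hence "S (x + hp k) = exp (?g k x) * S (x - hp k)"
        using wsigma_add[OF two_half_period[of k], of "x - hp k"] by (simp only:)
      moreover have "exp (- u) * (exp u * v) = v" for u v :: complex by (simp add: exp_minus)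
      ultimately have "S (x - hp k) = exp (- ?g k x) * S (x + hp k)" by (simp only:)
      moreover have "P x - e_val \<omega>1 \<omega>3 k = c (hp k) * S (x - hp k) * S (x + hp k) / S x ^ 2"
        unfolding e_val_def by (rule c(2)[OF half_period_notin[OF k] xL])
      ultimately have "P x - e_val \<omega>1 \<omega>3 k = c (hp k) * (exp (- ?g k x) * S (x + hp k) ^ 2) / S x ^ 2"
        by (simp add: power2_eq_square mult.assoc)
      moreover have "exp (- ?g k x) ^ l k = exp (- (of_nat (l k) * ?g k x))"
        by (simp only: exp_of_nat_mult[symmetric] mult_minus_right)
      ultimately show ?thesis by (simp only: power_divide power_mult_distrib power_mult)
    qed
    hence "(\<Prod>k=1..3. (P x - e_val \<omega>1 \<omega>3 k) ^ l k) =
        (\<Prod>k=1..3. c (hp k) ^ l k * (exp (- (of_nat (l k) * ?g k x)) * S (x + hp k) ^ (2 * l k)) / S x ^ (2 * l k))"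
      by (rule prod.cong[OF refl])
    also have "\<dots> = ?ch * (exp (\<Sum>k=1..3. - (of_nat (l k) * ?g k x)) * ?H) / S x ^ (\<Sum>k=1..3. 2 * l k)"
      by (simp only: prod_dividef prod.distrib exp_sum[OF finite_atLeastAtMost] power_sum)
    also have "(\<Sum>k=1..3. - (of_nat (l k) * ?g k x)) = - (?\<gamma> * x + ?\<delta>)"
      by (simp add: sum_negf[symmetric] sum_distrib_left sum_distrib_right sum.distrib[symmetric] algebra_simps)
    finally have den: "(\<Prod>k=1..3. (P x - e_val \<omega>1 \<omega>3 k) ^ l k) =
        ?ch * (exp (- (?\<gamma> * x + ?\<delta>)) * ?H) / S x ^ (\<Sum>k=1..3. 2 * l k)" .
    have "Theta l x = S x ^ l 0 * (\<Prod>k=1..3. S (x + hp k) ^ l k)"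
      unfolding Theta_def atMost_3_eq by simp
    hence th: "Theta l x ^ 2 = S x ^ (2 * l 0) * ?H"
      by (simp add: power_mult_distrib prod_power_distrib power_mult[symmetric] mult.commute)
    have "2 * L = 2 * l 0 + (\<Sum>k=1..3. 2 * l k)"
      unfolding l_total_def atMost_3_eq by (simp add: sum_distrib_left)
    hence SL: "S x ^ (2 * L) = S x ^ (2 * l 0) * S x ^ (\<Sum>k=1..3. 2 * l k)" by (simp only: power_add)
    have "X E x * Theta l x ^ 2 = lead * (?ct * (q x * p x) / S x ^ (2 * L))
        / (?ch * (exp (- (?\<gamma> * x + ?\<delta>)) * ?H) / S x ^ (\<Sum>k=1..3. 2 * l k)) * (S x ^ (2 * l 0) * ?H)"
      unfolding Xi_eq_rational[OF x] Xi_rational_def num den th ..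
    also have "\<dots> = lead * ?ct / ?ch * (p x * q x) * inverse (exp (- (?\<gamma> * x + ?\<delta>)))"
    proof -
      have *: "a0 * (a1 * a2 / (u * v)) / (ch * (e * h) / v) * (u * h) = a0 * a1 / ch * (a2' * inverse e)"
        if "u \<noteq> 0" "v \<noteq> 0" "ch \<noteq> 0" "e \<noteq> 0" "h \<noteq> 0" "a2 = a2'" for a0 a1 a2 a2' u v ch e h :: complex
        using that by (simp add: field_simps)
      show ?thesis unfolding SL mult.assoc[of _ "p x * q x"]
        by (rule *) (use Sx H ch in \<open>simp_all add: mult.commute\<close>)
    qed
    also have "inverse (exp (- (?\<gamma> * x + ?\<delta>))) = exp (?\<gamma> * x) * exp ?\<delta>"
      by (simp only: exp_minus inverse_inverse_eq exp_add)
    finally show ?thesis by (simp only: mult_ac)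
  qed
  moreover have "?C \<noteq> 0" using lead_nonzero ct ch by simp
  ultimately show ?thesis by (intro exI[of _ ?C] exI[of _ ?\<gamma>] conjI allI impI)
qed

end

lemma eq_off_countable_on:
  fixes f g :: "complex \<Rightarrow> complex"
  assumes "open U" "continuous_on U f" "continuous_on U g" "countable H" "\<And>x. x \<in> U \<Longrightarrow> x \<notin> H \<Longrightarrow> f x = g x" "x \<in> U"
  shows "f x = g x"
proof (rule ccontr)
  assume "f x \<noteq> g x"
  have "open (U \<inter> (\<lambda>x. f x - g x) -` (- {0}))"
    by (intro continuous_open_preimage continuous_intros assms)
  moreover have "x \<in> U \<inter> (\<lambda>x. f x - g x) -` (- {0})" using assms(6) \<open>f x \<noteq> g x\<close> by simp
  ultimately obtain e where e: "e > 0" "ball x e \<subseteq> U \<inter> (\<lambda>x. f x - g x) -` (- {0})"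
    unfolding open_contains_ball by blast
  hence "ball x e \<subseteq> H" using assms(5) by fastforce
  thus False using uncountable_ball[OF e(1)] assms(4) countable_subset by blast
qed

context period_pair
begin

lemma pole_le_deriv:
  assumes f: "pole_le n f"
  shows "pole_le (\<lambda>i. n i + 1) (deriv f)"
proof -
  let ?N = "numer n f"
  let ?Z = "\<lambda>x. \<Prod>i\<le>3. S (x + hp i)"
  let ?W = "\<lambda>x. \<Sum>i\<le>3. of_nat (n i) * (deriv S (x + hp i) * (\<Prod>k\<in>{..3} - {i}. S (x + hp k)))"
  show ?thesis
  proof (rule pole_leI)
    show "(\<lambda>x. deriv ?N x * ?Z x - ?N x * ?W x) holomorphic_on UNIV"
      by (intro holomorphic_intros holomorphic_deriv numer_holomorphic[OF f] entire_shift[of "deriv S"] wsigma_deriv_holomorphic) auto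
    fix x assume x: "x \<notin> Hpts"
    have xi: "x + hp i \<notin> Lat" if "i \<le> 3" for i using Hpts_half[OF x that] .
    have dS: "((\<lambda>x. S (x + hp i)) has_field_derivative S (x + hp i) * Z (x + hp i)) (at x)" if "i \<le> 3" for i
    proof -
      have "((\<lambda>x. S (x + hp i)) has_field_derivative S (x + hp i) * Z (x + hp i) * 1) (at x)"
        by (rule DERIV_chain2[of S], rule wsigma_derivative[OF xi[OF that]]) (auto intro!: derivative_eq_intros)
      thus ?thesis by simp
    qed
    have dS': "((\<lambda>x. S (x + hp i) ^ n i) has_field_derivative S (x + hp i) ^ n i * (of_nat (n i) * Z (x + hp i))) (at x)" if "i \<le> 3" for i
    proof (cases "n i")
      case (Suc m)
      show ?thesis using DERIV_power[OF dS[OF that], of "n i"] by (simp add: Suc algebra_simps)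
    qed simp
    have dT: "(Theta n has_field_derivative Theta n x * (\<Sum>i\<le>3. of_nat (n i) * Z (x + hp i))) (at x)"
      unfolding Theta_def[abs_def] by (rule has_field_derivative_prod_log) (use dS' in auto)
    have df: "(f has_field_derivative deriv f x) (at x)"
      by (rule holomorphic_derivI[OF pole_le_holomorphic[OF f] open_off_Hpts]) (use x in auto)
    have "(?N has_field_derivative deriv f x * Theta n x + Theta n x * (\<Sum>i\<le>3. of_nat (n i) * Z (x + hp i)) * f x) (at x)"
      by (rule has_field_derivative_transform_within_open[OF DERIV_mult[OF df dT] open_off_Hpts])
         (use x numer_eq[OF f] in auto)
    from DERIV_imp_deriv[OF this] have dN: "deriv ?N x = deriv f x * Theta n x + ?N x * (\<Sum>i\<le>3. of_nat (n i) * Z (x + hp i))"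
      using numer_eq[OF f x] by (simp add: algebra_simps)
    have W: "?W x = ?Z x * (\<Sum>i\<le>3. of_nat (n i) * Z (x + hp i))"
      unfolding sum_distrib_left
    proof (rule sum.cong[OF refl])
      fix i :: nat assume "i \<in> {..3}"
      hence i: "i \<le> 3" by simp
      have "?Z x = S (x + hp i) * (\<Prod>k\<in>{..3} - {i}. S (x + hp k))"
        by (rule prod.remove) (use i in auto)
      thus "of_nat (n i) * (deriv S (x + hp i) * (\<Prod>k\<in>{..3} - {i}. S (x + hp k))) = ?Z x * (of_nat (n i) * Z (x + hp i))"
        using wsigma_deriv_eq[OF xi[OF i]] by simp
    qed
    have "Theta (\<lambda>i. n i + 1) x = Theta n x * ?Z x" by (simp add: Theta_def prod.distrib)
    thus "deriv f x * Theta (\<lambda>i. n i + 1) x = deriv ?N x * ?Z x - ?N x * ?W x"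
      unfolding W dN by (simp add: algebra_simps)
  qed
qed

end

context zero_system
begin

lemma zero_prod_eq_0I: "j \<in> {1..L} \<Longrightarrow> x + u j \<in> Lat \<Longrightarrow> zero_prod L u x = 0"
  by (auto simp: zero_prod_def wsigma_eq_0_iff)

lemma Xi_zero_translates:
  assumes "j \<in> {1..L}" "\<tau> \<in> Lat"
  shows "t j + \<tau> \<notin> Hpts" "- t j + \<tau> \<notin> Hpts" "X E (t j + \<tau>) = 0" "X E (- t j + \<tau>) = 0"
    "poly (Xi_deriv_poly (t j + \<tau>)) E = - 2 * s" "poly (Xi_deriv_poly (- t j + \<tau>)) E = 2 * s"
proof -
  have tj: "t j \<notin> Hpts" "- t j \<notin> Hpts" using zeros_off[OF assms(1)] by simp_all
  show "t j + \<tau> \<notin> Hpts" "- t j + \<tau> \<notin> Hpts"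
    using tj assms(2) Hpts_add_iff[of \<tau> "- t j"] by (simp_all only: Hpts_add_iff not_False_eq_True)
  show "X E (t j + \<tau>) = 0" "X E (- t j + \<tau>) = 0"
    using qperD[OF Xi_qper[of E] assms(2) tj(1)] qperD[OF Xi_qper[of E] assms(2) tj(2)]
      Xi_at_zero[OF assms(1)] Xi_reflect[OF tj(1), of E] by simp_all
  show "poly (Xi_deriv_poly (t j + \<tau>)) E = - 2 * s" "poly (Xi_deriv_poly (- t j + \<tau>)) E = 2 * s"
    using Xi_deriv_periodic[OF tj(1) assms(2), of E] Xi_deriv_periodic[OF tj(2) assms(2), of E]
      Xi_deriv_at_zero[OF assms(1)] Xi_deriv_reflect[OF tj(1), of E] by simp_all
qed

text \<open>Both sides of \<open>s / \<Xi> = (p' / p - q' / q) / 2 + d\<close> have the same simple poles and residues.\<close>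
lemma root_over_Xi:
  "\<exists>C \<gamma> d. C \<noteq> 0 \<and> (\<forall>x. x \<notin> Hpts \<longrightarrow> X E x * Theta l x ^ 2 = C * p x * q x * exp (\<gamma> * x)) \<and>
     (\<forall>x. s * Theta l x ^ 2 = C * exp (\<gamma> * x) * ((deriv p x * q x - p x * deriv q x) / 2 + d * (p x * q x)))"
proof -
  obtain C \<gamma> where C: "C \<noteq> 0" "\<forall>x. x \<notin> Hpts \<longrightarrow> X E x * Theta l x ^ 2 = C * p x * q x * exp (\<gamma> * x)"
    using Xi_factor by (elim exE conjE)
  \<comment> \<open>\<open>R\<close> is p q / \<Xi> written as an entire function, and
    \<open>Y\<close> is p q times the difference of s / \<Xi> and (p'/p - q'/q) / 2. The values -2 s
    and 2 s of \<Xi>' at t j and -t j make \<open>Y\<close> vanish there, so \<open>Y\<close> is p q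
    times an entire elliptic function, which is the constant d.\<close>
  define R where "R x = Theta l x ^ 2 * exp (- \<gamma> * x) / C" for x
  define Y where "Y x = s * R x - (deriv p x * q x - p x * deriv q x) / 2" for x
  have R: "R holomorphic_on UNIV" unfolding R_def[abs_def] using C(1)
    by (intro holomorphic_intros Theta_holomorphic) auto
  have Y: "Y holomorphic_on UNIV" unfolding Y_def[abs_def]
    by (intro holomorphic_intros R holomorphic_deriv zero_prod_holomorphic) auto
  have XR: "X E x * R x = p x * q x" if "x \<notin> Hpts" for x
  proof -
    have "X E x * R x = (X E x * Theta l x ^ 2) * exp (- \<gamma> * x) / C" by (simp add: R_def)
    also have "\<dots> = p x * q x * (exp (\<gamma> * x) * exp (- \<gamma> * x))" using C that by simp
    also have "exp (\<gamma> * x) * exp (- \<gamma> * x) = 1" unfolding exp_add[symmetric] by simp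
    finally show ?thesis by simp
  qed
  have deriv_XR: "poly (Xi_deriv_poly x) E * R x + deriv R x * X E x = deriv p x * q x + deriv q x * p x" if x: "x \<notin> Hpts" for x
  proof -
    have "(R has_field_derivative deriv R x) (at x)" by (rule holomorphic_derivI[OF R]) auto
    from DERIV_mult[OF Xi_derivative[OF x, of E] this]
    have "((\<lambda>x. p x * q x) has_field_derivative poly (Xi_deriv_poly x) E * R x + deriv R x * X E x) (at x)"
      by (rule has_field_derivative_transform_within_open[OF _ open_off_Hpts]) (use x XR in auto)
    from DERIV_unique[OF this DERIV_mult[OF zero_prod_deriv zero_prod_deriv]] show ?thesis .
  qed
  define pt where "pt a = (if snd a then t (fst a) else - t (fst a))" for a :: "nat \<times> bool"
  let ?A = "{1..L} \<times> (UNIV :: bool set)"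
  have "\<exists>G. G holomorphic_on UNIV \<and> (\<forall>z. Y z = (\<Prod>a\<in>?A. S (z - pt a)) * G z)"
  proof (rule divide_by_wsigma_prod[OF _ Y])
    fix a \<tau> assume a: "a \<in> ?A" and \<tau>: "\<tau> \<in> Lat"
    obtain j \<epsilon> where j: "a = (j, \<epsilon>)" "j \<in> {1..L}" using a by auto
    note tr = Xi_zero_translates[OF j(2) \<tau>]
    show "Y (pt a + \<tau>) = 0"
    proof (cases \<epsilon>)
      case True
      let ?w = "t j + \<tau>"
      have "q ?w = 0" by (rule zero_prod_eq_0I[OF j(2)]) (use \<tau> in simp)
      moreover from this have "- (2 * (s * R ?w)) = p ?w * deriv q ?w"
        using deriv_XR[OF tr(1)] tr by (simp add: mult_ac)
      hence "s * R ?w = - (p ?w * deriv q ?w) / 2" by algebra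
      ultimately show ?thesis using True j by (simp add: Y_def pt_def)
    next
      case False
      let ?w = "- t j + \<tau>"
      have "p ?w = 0" by (rule zero_prod_eq_0I[OF j(2)]) (use \<tau> in simp)
      moreover from this deriv_XR[OF tr(2)] tr have "2 * s * R ?w = deriv p ?w * q ?w" by simp
      ultimately show ?thesis using False j by (simp add: Y_def pt_def field_simps)
    qed
  next
    fix a a' assume aa': "a \<in> ?A" "a' \<in> ?A" "a \<noteq> a'"
    obtain j \<epsilon> j' \<epsilon>' where j: "a = (j, \<epsilon>)" "a' = (j', \<epsilon>')" "j \<in> {1..L}" "j' \<in> {1..L}" "j = j' \<Longrightarrow> \<epsilon> \<noteq> \<epsilon>'"
      using aa' by (cases a; cases a') auto
    have 1: "t j + t j' \<notin> Lat" by (rule zeros_sum[OF j(3,4)])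
    hence 2: "- t j - t j' \<notin> Lat" using Lat_uminus_iff[of "t j + t j'"] by simp
    have 3: "t j - t j' \<notin> Lat" if "j \<noteq> j'" by (rule zeros_diff[OF j(3,4) that])
    have 4: "t j' - t j \<notin> Lat" if "j \<noteq> j'" using zeros_diff[OF j(4,3)] that by simp
    show "pt a - pt a' \<notin> Lat"
      using 1 2 3 4 j(1,2,5) by (cases \<epsilon>; cases \<epsilon>'; cases "j = j'") (simp_all add: pt_def)
  qed simp
  then obtain G where G: "G holomorphic_on UNIV" "\<And>z. Y z = (\<Prod>a\<in>?A. S (z - pt a)) * G z" by (elim exE conjE) simp
  have prod: "(\<Prod>a\<in>?A. S (z - pt a)) = p z * q z" for z
  proof -
    have "(\<Prod>a\<in>?A. S (z - pt a)) = (\<Prod>j=1..L. \<Prod>\<epsilon>\<in>UNIV. S (z - pt (j, \<epsilon>)))"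
      by (simp add: prod.cartesian_product)
    also have "\<dots> = (\<Prod>j=1..L. S (z + t j) * S (z + - t j))" by (simp add: UNIV_bool pt_def)
    finally show ?thesis by (simp only: prod.distrib zero_prod_def)
  qed
  have YG: "Y z = p z * q z * G z" for z using G(2)[of z] prod[of z] by simp
  have "G (x + \<tau>) = G x" if \<tau>: "\<tau> \<in> Lat" for \<tau> x
  proof (rule eq_off_countable[of "\<lambda>x. G (x + \<tau>)" G])
    show "continuous_on UNIV (\<lambda>x. G (x + \<tau>))" by (intro entire_continuous[OF G(1)] continuous_intros)
    show "continuous_on UNIV G" by (rule holomorphic_on_imp_continuous_on[OF G(1)])
    show "countable (Hpts \<union> ({x. p x = 0} \<union> {x. q x = 0}))"
      by (intro countable_Un countable_Hpts countable_zero_prod)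
    fix x assume x: "x \<notin> Hpts \<union> ({x. p x = 0} \<union> {x. q x = 0})"
    hence x': "x \<notin> Hpts" "p x \<noteq> 0" "q x \<noteq> 0" by auto
    define ep where "ep = exp (of_nat L * (qa \<tau> * x + qb \<tau>) + qa \<tau> * (\<Sum>j=1..L. t j))"
    define eq where "eq = exp (of_nat L * (qa \<tau> * x + qb \<tau>) + qa \<tau> * (\<Sum>j=1..L. - t j))"
    \<comment> \<open>Under translation p' gains the term a p and q' the term a q, with the same a
      because both products have L factors; in p' q - p q' these terms cancel.\<close>
    define a where "a = of_nat L * qa \<tau>"
    have e: "ep \<noteq> 0" "eq \<noteq> 0" by (simp_all add: ep_def eq_def)
    have pq: "p (x + \<tau>) = ep * p x" "q (x + \<tau>) = eq * q x"
      "deriv p (x + \<tau>) = ep * (a * p x + deriv p x)" "deriv q (x + \<tau>) = eq * (a * q x + deriv q x)"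
      unfolding ep_def eq_def a_def
      by (rule zero_prod_quasi_periodic[OF \<tau>] zero_prod_deriv_quasi_periodic[OF \<tau>])+
    have X0: "X E x \<noteq> 0" using XR[OF x'(1)] x' by auto
    have "X E x * R (x + \<tau>) = (ep * eq) * (p x * q x)"
      using XR[of "x + \<tau>"] x'(1) \<tau> qperD[OF Xi_qper[of E] \<tau> x'(1)] pq by simp
    also have "\<dots> = X E x * (ep * eq * R x)" using XR[OF x'(1)] by simp
    finally have "R (x + \<tau>) = ep * eq * R x" using X0 by simp
    hence "Y (x + \<tau>) = ep * eq * Y x" unfolding Y_def pq by (simp add: algebra_simps)
    hence "ep * eq * (p x * q x) * G (x + \<tau>) = ep * eq * (p x * q x) * G x"
      unfolding YG pq by (simp add: mult_ac)
    thus "G (x + \<tau>) = G x" using e x' by simp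
  qed
  from elliptic_entire_constant[OF G(1) this] obtain d where d: "\<forall>z. G z = d" ..
  have "s * Theta l x ^ 2 = C * exp (\<gamma> * x) * ((deriv p x * q x - p x * deriv q x) / 2 + d * (p x * q x))" for x
  proof -
    have "s * R x = (deriv p x * q x - p x * deriv q x) / 2 + d * (p x * q x)"
      using YG[of x] d by (simp add: Y_def algebra_simps)
    moreover have "s * Theta l x ^ 2 = C * exp (\<gamma> * x) * (s * R x)"
    proof -
      have "exp (\<gamma> * x) * exp (- \<gamma> * x) = 1" unfolding exp_add[symmetric] by simp
      hence "C * exp (\<gamma> * x) * (s * R x) = s * Theta l x ^ 2 * (C / C)" by (simp add: R_def mult_ac)
      also have "\<dots> = s * Theta l x ^ 2" using C(1) by simp
      finally show ?thesis by (rule sym)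
    qed
    ultimately show ?thesis by simp
  qed
  hence "\<forall>x. s * Theta l x ^ 2 = C * exp (\<gamma> * x) * ((deriv p x * q x - p x * deriv q x) / 2 + d * (p x * q x))" ..
  with C show ?thesis
    by - (rule exI[of _ C], rule exI[of _ \<gamma>], rule exI[of _ d], intro conjI)
qed

end

section \<open>The elliptic function vanishing at the zeros of the solution\<close>

text \<open>Formally (X' + 2 s) / X is twice the logarithmic derivative of p / \<theta> plus g + 2
  d, and multiplication by G gives T. Since X, p, q and a may vanish at the point in question, only
  \<theta> and \<sigma> are ever cancelled.\<close>

lemma first_order_identity:
  fixes X X' p q a p' q' a' \<theta> \<theta>' \<sigma> \<sigma>' C e g d s G G' T :: complex
  assumes nz: "\<theta> \<noteq> 0" "\<sigma> \<noteq> 0"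
    and X: "X * \<theta> ^ 2 = C * p * q * e"
    and X': "X' * \<theta> ^ 2 + X * (2 * \<theta> * \<theta>') = C * (p' * q * e + p * q' * e + p * q * (g * e))"
    and s: "s * \<theta> ^ 2 = C * e * ((p' * q - p * q') / 2 + d * (p * q))"
    and G: "G = p * a / (\<theta> * \<sigma>)"
    and G': "G' * (\<theta> * \<sigma>) + G * (\<theta>' * \<sigma> + \<theta> * \<sigma>') = p' * a + p * a'"
    and T: "T = 2 * G' + 2 * (p * (\<sigma>' * a - \<sigma> * a' + (g / 2 + d) * (\<sigma> * a)) / (\<theta> * \<sigma> ^ 2))"
  shows "G * (X' + 2 * s) = X * T"
proof -
  define T1 where "T1 = T * (\<theta> ^ 2 * \<sigma> ^ 2)"
  have Gts: "G * (\<theta> * \<sigma>) = p * a" using nz G by simp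
  have "T1 = 2 * (G' * (\<theta> * \<sigma>)) * (\<theta> * \<sigma>) + 2 * p * (\<sigma>' * a - \<sigma> * a' + (g / 2 + d) * (\<sigma> * a)) * \<theta>"
    unfolding T1_def T using nz by (simp add: field_simps power2_eq_square)
  also have "G' * (\<theta> * \<sigma>) = p' * a + p * a' - G * (\<theta>' * \<sigma> + \<theta> * \<sigma>')" using G' by (simp add: algebra_simps)
  finally have "T1 = 2 * (p' * a + p * a') * (\<theta> * \<sigma>) - 2 * (G * (\<theta> * \<sigma>)) * (\<theta>' * \<sigma> + \<theta> * \<sigma>')
      + 2 * p * (\<sigma>' * a - \<sigma> * a' + (g / 2 + d) * (\<sigma> * a)) * \<theta>" by (simp add: algebra_simps)
  also have "\<dots> = \<sigma> * a * (2 * p' * \<theta> - 2 * p * \<theta>' + (g + 2 * d) * (p * \<theta>))"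
    unfolding Gts by (simp add: algebra_simps)
  finally have T1: "T1 = \<sigma> * a * (2 * p' * \<theta> - 2 * p * \<theta>' + (g + 2 * d) * (p * \<theta>))" .
  have "(X' * \<theta> ^ 2 + 2 * (s * \<theta> ^ 2)) * \<theta>
      = C * (p' * q * e + p * q' * e + p * q * (g * e)) * \<theta> - 2 * (X * \<theta> ^ 2) * \<theta>'
        + 2 * (C * e * ((p' * q - p * q') / 2 + d * (p * q))) * \<theta>"
    unfolding X'[symmetric] s by (simp add: algebra_simps power2_eq_square)
  also have "\<dots> = C * q * e * (2 * p' * \<theta> - 2 * p * \<theta>' + (g + 2 * d) * (p * \<theta>))"
    unfolding X by (simp add: field_simps)
  finally have XX: "(X' + 2 * s) * \<theta> ^ 2 * \<theta> = C * q * e * (2 * p' * \<theta> - 2 * p * \<theta>' + (g + 2 * d) * (p * \<theta>))"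
    by (simp add: algebra_simps)
  have "G * (X' + 2 * s) * (\<theta> ^ 2 * \<theta> ^ 2 * \<sigma> ^ 2) = (G * (\<theta> * \<sigma>)) * ((X' + 2 * s) * \<theta> ^ 2 * \<theta>) * \<sigma>"
    by (simp add: power2_eq_square mult_ac)
  also have "\<dots> = (C * p * q * e) * T1" unfolding XX Gts T1 by (simp add: mult_ac)
  also have "\<dots> = X * T * (\<theta> ^ 2 * \<theta> ^ 2 * \<sigma> ^ 2)" unfolding X[symmetric] T1_def by (simp add: mult_ac)
  finally show ?thesis using nz by simp
qed

context finite_gap_data
begin

text \<open>The factor S(x + \<alpha>) / S(x) that makes the quotient elliptic costs one more pole
  at 0. \<open>T_order\<close> leaves room for the derivative of G.\<close>

definition G_order :: "nat \<Rightarrow> nat" where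
  "G_order i = l i + base_order i"

abbreviation "T_order \<equiv> \<lambda>i. G_order i + 1"

lemma G_order_0: "G_order 0 > 0"
  by (simp add: G_order_def base_order_def)

lemma Theta_G_order: "Theta G_order x = Theta l x * S x"
  unfolding G_order_def[abs_def] Theta_add Theta_base_order ..

lemma theta_exponent_G_order:
  "theta_exponent G_order \<tau> x = of_nat (L + 1) * (qa \<tau> * x + qb \<tau>) + qa \<tau> * (\<Sum>k=1..3. of_nat (l k) * hp k)"
proof -
  have "(\<Sum>i\<le>3. G_order i) = L + 1"
    unfolding l_total_def atMost_3_eq by (simp add: G_order_def base_order_def)
  moreover have "(\<Sum>k=1..3. of_nat (G_order k) * hp k) = (\<Sum>k=1..3. of_nat (l k) * hp k)"
    by (rule sum.cong) (auto simp: G_order_def base_order_def)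
  ultimately show ?thesis unfolding theta_exponent_eq by (simp only:)
qed

end

locale zero_system_off = zero_system +
  assumes alpha_off: "alpha \<omega>1 \<omega>3 l t \<notin> Lat"
begin

abbreviation "\<alpha> \<equiv> alpha \<omega>1 \<omega>3 l t"

definition G0 :: "complex \<Rightarrow> complex" where
  "G0 x = p x * S (x + \<alpha>) / (Theta l x * S x)"

text \<open>This is \<open>G0\<close> times Z(x) - Z(x + \<alpha>) + d, the poles of Z(x + \<alpha>)
  being absorbed by zeros of \<open>G0\<close>. Thus \<open>T0\<close> is 2 \<open>G0\<close> times
  the logarithmic derivative of p / Theta plus d.\<close>

definition V0 :: "complex \<Rightarrow> complex \<Rightarrow> complex" where
  "V0 d x = p x * (deriv S x * S (x + \<alpha>) - S x * deriv S (x + \<alpha>) + d * (S x * S (x + \<alpha>))) / (Theta l x * S x ^ 2)"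

definition T0 :: "complex \<Rightarrow> complex \<Rightarrow> complex" where
  "T0 d x = 2 * deriv G0 x + 2 * V0 d x"

lemma G0_numerator: "x \<notin> Hpts \<Longrightarrow> G0 x * Theta G_order x = p x * S (x + \<alpha>)"
  using Theta_nonzero[of x l] wsigma_nonzero[of x] by (simp add: G0_def Theta_G_order)

lemma G0_pole_le: "pole_le G_order G0"
  by (rule pole_leI[OF _ G0_numerator]) (intro holomorphic_intros zero_prod_holomorphic)

lemma G0_qper: "qper trivial_character G0"
  unfolding qper_def
proof (intro ballI allI impI)
  fix \<tau> x assume \<tau>: "\<tau> \<in> Lat"
  have e: "G0 x = zero_quotient l t x * (S (x + \<alpha>) / S x)" for x
    by (simp add: G0_def zero_quotient_def)
  have "S (x + \<tau> + \<alpha>) = exp (qa \<tau> * (x + \<alpha>) + qb \<tau>) * S (x + \<alpha>)"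
    using wsigma_add[OF \<tau>, of "x + \<alpha>"] by (simp add: add_ac)
  hence "S (x + \<tau> + \<alpha>) / S (x + \<tau>) = exp ((qa \<tau> * (x + \<alpha>) + qb \<tau>) - (qa \<tau> * x + qb \<tau>)) * (S (x + \<alpha>) / S x)"
    unfolding exp_diff wsigma_add[OF \<tau>, of x] by simp
  also have "(qa \<tau> * (x + \<alpha>) + qb \<tau>) - (qa \<tau> * x + qb \<tau>) = qa \<tau> * \<alpha>" by (simp add: algebra_simps)
  finally have "G0 (x + \<tau>) = (exp (- qa \<tau> * \<alpha>) * exp (qa \<tau> * \<alpha>)) * G0 x"
    unfolding e zero_quotient_quasi_periodic[OF \<tau>] by (simp add: mult_ac)
  also have "exp (- qa \<tau> * \<alpha>) * exp (qa \<tau> * \<alpha>) = 1" unfolding exp_add[symmetric] by simp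
  finally show "G0 (x + \<tau>) = 1 * G0 x" by simp
qed

lemma G0_holomorphic: "G0 holomorphic_on - Hpts"
  by (rule pole_le_holomorphic[OF G0_pole_le])

lemma exists_T0: "\<exists>d. \<forall>x. x \<notin> Hpts \<longrightarrow> G0 x * (poly (Xi_deriv_poly x) E + 2 * s) = X E x * T0 d x"
proof -
  obtain C \<gamma> d where C: "C \<noteq> 0" "\<forall>x. x \<notin> Hpts \<longrightarrow> X E x * Theta l x ^ 2 = C * p x * q x * exp (\<gamma> * x)"
     "\<forall>x. s * Theta l x ^ 2 = C * exp (\<gamma> * x) * ((deriv p x * q x - p x * deriv q x) / 2 + d * (p x * q x))"
    using root_over_Xi by (elim exE conjE)
  have "G0 x * (poly (Xi_deriv_poly x) E + 2 * s) = X E x * T0 (\<gamma> / 2 + d) x" if x: "x \<notin> Hpts" for x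
  proof (rule first_order_identity[where \<theta> = "Theta l x" and \<theta>' = "deriv (Theta l) x" and \<sigma> = "S x" and \<sigma>' = "deriv S x"
        and p = "p x" and q = "q x" and a = "S (x + \<alpha>)" and p' = "deriv p x" and q' = "deriv q x" and a' = "deriv S (x + \<alpha>)"
        and C = C and e = "exp (\<gamma> * x)" and g = \<gamma> and d = d and G' = "deriv G0 x"])
    show "Theta l x \<noteq> 0" "S x \<noteq> 0" using x by (auto simp: Theta_nonzero wsigma_nonzero)
    show "X E x * Theta l x ^ 2 = C * p x * q x * exp (\<gamma> * x)" using C(2) x by blast
    show "s * Theta l x ^ 2 = C * exp (\<gamma> * x) * ((deriv p x * q x - p x * deriv q x) / 2 + d * (p x * q x))"
      using C(3) by blast
    show "G0 x = p x * S (x + \<alpha>) / (Theta l x * S x)" by (rule G0_def)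
    show "T0 (\<gamma> / 2 + d) x = 2 * deriv G0 x + 2 * (p x * (deriv S x * S (x + \<alpha>) - S x * deriv S (x + \<alpha>) +
        (\<gamma> / 2 + d) * (S x * S (x + \<alpha>))) / (Theta l x * S x ^ 2))" by (simp add: T0_def V0_def)
    have "((\<lambda>x. X E x * Theta l x ^ 2) has_field_derivative
        poly (Xi_deriv_poly x) E * Theta l x ^ 2 + (of_nat 2 * (deriv (Theta l) x * Theta l x ^ (2 - Suc 0))) * X E x) (at x)"
      by (intro DERIV_mult Xi_derivative x DERIV_power Theta_deriv)
    hence "((\<lambda>x. C * (p x * q x * exp (\<gamma> * x))) has_field_derivative
        poly (Xi_deriv_poly x) E * Theta l x ^ 2 + (of_nat 2 * (deriv (Theta l) x * Theta l x ^ (2 - Suc 0))) * X E x) (at x)"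
      by (rule has_field_derivative_transform_within_open[OF _ open_off_Hpts]) (use x C(2) in \<open>auto simp: mult.assoc\<close>)
    moreover have "((\<lambda>x. C * (p x * q x * exp (\<gamma> * x))) has_field_derivative
        C * ((deriv p x * q x + deriv q x * p x) * exp (\<gamma> * x) + exp (\<gamma> * x) * \<gamma> * (p x * q x))) (at x)"
      by (intro DERIV_cmult DERIV_mult zero_prod_deriv) (auto intro!: derivative_eq_intros)
    ultimately have "poly (Xi_deriv_poly x) E * Theta l x ^ 2 + (of_nat 2 * (deriv (Theta l) x * Theta l x ^ (2 - Suc 0))) * X E x
       = C * ((deriv p x * q x + deriv q x * p x) * exp (\<gamma> * x) + exp (\<gamma> * x) * \<gamma> * (p x * q x))" by (rule DERIV_unique)
    thus "poly (Xi_deriv_poly x) E * Theta l x ^ 2 + X E x * (2 * Theta l x * deriv (Theta l) x) =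
        C * (deriv p x * q x * exp (\<gamma> * x) + p x * deriv q x * exp (\<gamma> * x) + p x * q x * (\<gamma> * exp (\<gamma> * x)))"
      by (simp add: algebra_simps)
    have dS: "((\<lambda>x. S (x + \<alpha>)) has_field_derivative deriv S (x + \<alpha>) * 1) (at x)"
      by (rule DERIV_chain2[of S], rule wsigma_deriv_has_derivative) (auto intro!: derivative_eq_intros)
    have dG: "(G0 has_field_derivative deriv G0 x) (at x)"
      by (rule holomorphic_derivI[OF G0_holomorphic open_off_Hpts]) (use x in auto)
    have "((\<lambda>x. G0 x * (Theta l x * S x)) has_field_derivative
        deriv G0 x * (Theta l x * S x) + (deriv (Theta l) x * S x + deriv S x * Theta l x) * G0 x) (at x)"
      by (intro DERIV_mult dG Theta_deriv wsigma_deriv_has_derivative)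
    hence "((\<lambda>x. p x * S (x + \<alpha>)) has_field_derivative
        deriv G0 x * (Theta l x * S x) + (deriv (Theta l) x * S x + deriv S x * Theta l x) * G0 x) (at x)"
      by (rule has_field_derivative_transform_within_open[OF _ open_off_Hpts])
         (use x G0_numerator in \<open>auto simp: Theta_G_order\<close>)
    from DERIV_unique[OF this DERIV_mult[OF zero_prod_deriv dS]]
    show "deriv G0 x * (Theta l x * S x) + G0 x * (deriv (Theta l) x * S x + Theta l x * deriv S x) =
        deriv p x * S (x + \<alpha>) + p x * deriv S (x + \<alpha>)" by (simp add: algebra_simps)
  qed
  thus ?thesis by (intro exI[of _ "\<gamma> / 2 + d"] allI impI)
qed

definition offset :: complex where
  "offset = (SOME d. \<forall>x. x \<notin> Hpts \<longrightarrow> G0 x * (poly (Xi_deriv_poly x) E + 2 * s) = X E x * T0 d x)"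

lemma G0_T0: "x \<notin> Hpts \<Longrightarrow> G0 x * (poly (Xi_deriv_poly x) E + 2 * s) = X E x * T0 offset x"
proof -
  have "\<forall>x. x \<notin> Hpts \<longrightarrow> G0 x * (poly (Xi_deriv_poly x) E + 2 * s) = X E x * T0 offset x"
    unfolding offset_def by (rule someI_ex[OF exists_T0])
  thus "x \<notin> Hpts \<Longrightarrow> G0 x * (poly (Xi_deriv_poly x) E + 2 * s) = X E x * T0 offset x" by blast
qed

text \<open>Off the half points the zeros of \<Xi> are among those of p and q, hence
  countable.\<close>

lemma Xi_cancel:
  assumes "f holomorphic_on - Hpts" "g holomorphic_on - Hpts" "\<And>x. x \<notin> Hpts \<Longrightarrow> X E x * f x = X E x * g x" "x \<notin> Hpts"
  shows "f x = g x"
proof (rule eq_off_countable_on[where f = f and g = g and x = x, OF open_off_Hpts])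
  obtain C \<gamma> where C: "C \<noteq> 0" "\<forall>x. x \<notin> Hpts \<longrightarrow> X E x * Theta l x ^ 2 = C * p x * q x * exp (\<gamma> * x)"
    using Xi_factor by (elim exE conjE)
  show "countable ({x. p x = 0} \<union> {x. q x = 0})"
    by (intro countable_Un countable_zero_prod)
  fix x assume x: "x \<in> - Hpts" "x \<notin> {x. p x = 0} \<union> {x. q x = 0}"
  hence "X E x * Theta l x ^ 2 \<noteq> 0" using C by auto
  hence "X E x \<noteq> 0" by auto
  thus "f x = g x" using assms(3)[of x] x by simp
qed (use assms in \<open>auto intro: holomorphic_on_imp_continuous_on\<close>)

lemma V0_pole_le: "pole_le T_order (V0 d)"
proof (rule pole_le_mono[of "\<lambda>i. l i + (base_order i + base_order i)"])
  show "pole_le (\<lambda>i. l i + (base_order i + base_order i)) (V0 d)"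
  proof (rule pole_leI)
    show "(\<lambda>x. p x * (deriv S x * S (x + \<alpha>) - S x * deriv S (x + \<alpha>) + d * (S x * S (x + \<alpha>)))) holomorphic_on UNIV"
      by (intro holomorphic_intros zero_prod_holomorphic wsigma_deriv_holomorphic entire_shift[of "deriv S"])
    fix x assume x: "x \<notin> Hpts"
    have "Theta (\<lambda>i. l i + (base_order i + base_order i)) x = Theta l x * S x ^ 2"
      unfolding Theta_add Theta_base_order by (simp add: power2_eq_square)
    thus "V0 d x * Theta (\<lambda>i. l i + (base_order i + base_order i)) x =
        p x * (deriv S x * S (x + \<alpha>) - S x * deriv S (x + \<alpha>) + d * (S x * S (x + \<alpha>)))"
      using Theta_nonzero[OF x] wsigma_nonzero[OF x] by (simp add: V0_def)
  qed
qed (auto simp: G_order_def base_order_def)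

lemma T0_pole_le: "pole_le T_order (T0 d)"
  unfolding T0_def[abs_def] by (intro pole_le_add pole_le_cmult pole_le_deriv G0_pole_le V0_pole_le)

text \<open>\<open>G0_T0\<close> transfers the periodicity of \<open>G0\<close>, \<Xi> and \<Xi>' to
  \<open>T0\<close> once \<Xi> is cancelled.\<close>

lemma T0_qper: "qper trivial_character (T0 offset)"
  unfolding qper_def
proof (intro ballI allI impI)
  fix \<tau> x assume \<tau>: "\<tau> \<in> Lat" and x: "x \<notin> Hpts"
  have h: "T0 offset holomorphic_on - Hpts" by (rule pole_le_holomorphic[OF T0_pole_le])
  have "T0 offset (x + \<tau>) = T0 offset x"
  proof (rule Xi_cancel[where f = "\<lambda>x. T0 offset (x + \<tau>)", OF _ h _ x])
    have "T0 offset \<circ> (\<lambda>x. x + \<tau>) holomorphic_on - Hpts"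
      by (rule holomorphic_on_compose) (use \<tau> in \<open>auto intro!: holomorphic_intros holomorphic_on_subset[OF h]\<close>)
    thus "(\<lambda>x. T0 offset (x + \<tau>)) holomorphic_on - Hpts" by (simp add: o_def)
    fix x assume x: "x \<notin> Hpts"
    have "X E x * T0 offset (x + \<tau>) = X E (x + \<tau>) * T0 offset (x + \<tau>)"
      using qperD[OF Xi_qper \<tau> x, of E] by simp
    also have "\<dots> = G0 (x + \<tau>) * (poly (Xi_deriv_poly (x + \<tau>)) E + 2 * s)"
      using G0_T0[of "x + \<tau>"] x \<tau> by simp
    also have "\<dots> = G0 x * (poly (Xi_deriv_poly x) E + 2 * s)"
      using qperD[OF G0_qper \<tau> x] Xi_deriv_periodic[OF x \<tau>, of E] by simp
    finally show "X E x * T0 offset (x + \<tau>) = X E x * T0 offset x" using G0_T0[OF x] by simp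
  qed
  thus "T0 offset (x + \<tau>) = 1 * T0 offset x" by simp
qed

text \<open>The pole orders exceed the number of prescribed zeros by one, so dividing the numerator
  by p leaves the quasi-periods of the single factor S(x + \<alpha>). \<open>theta_one\<close> then
  gives this factor, and with it the position of the last zero.\<close>

lemma G0_unique:
  assumes G: "pole_le G_order G" "qper trivial_character G"
    and zero: "\<And>j \<tau>. j \<in> {1..L} \<Longrightarrow> \<tau> \<in> Lat \<Longrightarrow> G (- t j + \<tau>) = 0"
  shows "\<exists>c. \<forall>x. x \<notin> Hpts \<longrightarrow> G x = c * G0 x"
proof -
  let ?N = "numer G_order G"
  have N: "?N holomorphic_on UNIV" by (rule numer_holomorphic[OF G(1)])
  have "\<exists>K. K holomorphic_on UNIV \<and> (\<forall>z. ?N z = (\<Prod>j\<in>{1..L}. S (z - (- t j))) * K z)"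
  proof (rule divide_by_wsigma_prod[OF _ N])
    show "?N (- t j + \<tau>) = 0" if "j \<in> {1..L}" "\<tau> \<in> Lat" for j \<tau>
      using numer_eq[OF G(1) Xi_zero_translates(2)[OF that]] zero[OF that] by simp
    show "- t j - - t j' \<notin> Lat" if "j \<in> {1..L}" "j' \<in> {1..L}" "j \<noteq> j'" for j j'
      using zeros_diff[OF that(2,1)] that(3) by simp
  qed simp
  then obtain K where K: "K holomorphic_on UNIV" "\<forall>z. ?N z = (\<Prod>j\<in>{1..L}. S (z - (- t j))) * K z"
    by (elim exE conjE)
  have NK: "?N z = p z * K z" for z using K(2) by (simp add: zero_prod_def)
  have per: "K (x + \<tau>) = exp (qa \<tau> * (x + \<alpha>) + qb \<tau>) * K x" if \<tau>: "\<tau> \<in> Lat" for \<tau> x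
  proof (rule cancel_off_countable[of "\<lambda>x. K (x + \<tau>)" "\<lambda>x. exp (qa \<tau> * (x + \<alpha>) + qb \<tau>) * K x", OF _ _ countable_zero_prod[of L t]])
    show "continuous_on UNIV (\<lambda>x. K (x + \<tau>))" by (intro entire_continuous[OF K(1)] continuous_intros)
    show "continuous_on UNIV (\<lambda>x. exp (qa \<tau> * (x + \<alpha>) + qb \<tau>) * K x)"
      by (intro continuous_intros holomorphic_on_imp_continuous_on[OF K(1)])
    fix x
    let ?A = "of_nat L * (qa \<tau> * x + qb \<tau>) + qa \<tau> * (\<Sum>j=1..L. t j)"
    have "exp ?A * (p x * K (x + \<tau>)) = ?N (x + \<tau>)"
      unfolding NK zero_prod_quasi_periodic[OF \<tau>] by (simp add: mult_ac)
    also have "\<dots> = exp (theta_exponent G_order \<tau> x) * (p x * K x)"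
      using numer_quasi_periodic[OF G \<tau>, of x] by (simp add: NK)
    also have "theta_exponent G_order \<tau> x = ?A + (qa \<tau> * (x + \<alpha>) + qb \<tau>)"
      unfolding theta_exponent_G_order alpha_def by (simp add: algebra_simps)
    finally have "exp ?A * (p x * K (x + \<tau>)) = exp ?A * (p x * (exp (qa \<tau> * (x + \<alpha>) + qb \<tau>) * K x))"
      unfolding exp_add by (simp only: mult_ac)
    thus "p x * K (x + \<tau>) = p x * (exp (qa \<tau> * (x + \<alpha>) + qb \<tau>) * K x)"
      by (simp only: mult_left_cancel[OF exp_not_eq_zero])
  qed
  from theta_one[of K \<alpha>, OF K(1) per] obtain c where c: "\<forall>x. K x = c * S (x + \<alpha>)" ..
  have "G x = c * G0 x" if x: "x \<notin> Hpts" for x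
  proof -
    have "G x * Theta G_order x = c * (p x * S (x + \<alpha>))"
      using numer_eq[OF G(1) x] NK[of x] c by simp
    hence "G x * Theta G_order x = c * G0 x * Theta G_order x" using G0_numerator[OF x] by simp
    thus ?thesis using Theta_nonzero[OF x, of G_order] by simp
  qed
  thus ?thesis by (intro exI[of _ c] allI impI)
qed

end

section \<open>The linear system satisfied by the elliptic function\<close>

context period_pair
begin

fun is_odd :: "nat \<times> nat \<Rightarrow> bool" where
  "is_odd (i, 0) \<longleftrightarrow> i \<noteq> 0"
| "is_odd (i, Suc j) \<longleftrightarrow> odd j"

text \<open>P(x + hp i) is even in x because \<open>hp i\<close> is half a period, and each
  derivative changes parity. \<open>wp_logderiv\<close> is odd since wp' is.\<close>

lemma basis_reflect:
  assumes "i \<le> 3" "x \<notin> Hpts"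
  shows "basis (i, j) (- x) = (if is_odd (i, j) then - 1 else 1) * basis (i, j) x"
proof (cases j)
  case 0
  thus ?thesis using wp_deriv_uminus[OF Hpts_Lat[OF assms(2)]] by simp
next
  case (Suc m)
  have "\<forall>x. x \<notin> Hpts \<longrightarrow> basis (i, Suc m) (- x) = (- 1) ^ m * basis (i, Suc m) x"
  proof (induction m)
    case 0
    show ?case using wp_shift_reflect[OF _ assms(1)] by simp
  next
    case (Suc m)
    have "deriv (basis (i, Suc m)) (- x) = - ((- 1) ^ m) * deriv (basis (i, Suc m)) x" if "x \<notin> Hpts" for x
      by (rule deriv_reflect[OF basis_holomorphic[OF assms(1)] _ that]) (use Suc in blast)
    thus ?case by simp
  qed
  thus ?thesis using assms(2) Suc by (simp add: minus_one_power_iff)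
qed

definition basis_index :: "(nat \<Rightarrow> nat) \<Rightarrow> (nat \<times> nat) set" where
  "basis_index n = insert (0, 0) (pole_index base_order n)"

lemma basis_index_basis:
  assumes "n 0 > 0" "p \<in> basis_index n"
  shows "fst p \<le> 3" "pole_le n (basis p)"
  using assms basis_pole_le[of "fst p" "snd p" n]
  by (auto simp: basis_index_def pole_index_def simp del: basis.simps)

text \<open>A choice of linearly independent spanning functions, so that their coefficients are determined.\<close>
definition indep_index :: "(nat \<Rightarrow> nat) \<Rightarrow> (nat \<times> nat) set" where
  "indep_index n = (SOME J. J \<subseteq> basis_index n \<and>
      (\<forall>c. (\<forall>x\<in>- Hpts. (\<Sum>j\<in>J. c j * basis j x) = 0) \<longrightarrow> (\<forall>j\<in>J. c j = 0)) \<and>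
      (\<forall>c. \<exists>c'. \<forall>x\<in>- Hpts. (\<Sum>i\<in>basis_index n. c i * basis i x) = (\<Sum>j\<in>J. c' j * basis j x)))"

lemma indep_index:
  shows indep_index_subset: "indep_index n \<subseteq> basis_index n"
    and indep_index_independent: "(\<And>x. x \<notin> Hpts \<Longrightarrow> (\<Sum>j\<in>indep_index n. c j * basis j x) = 0) \<Longrightarrow> j \<in> indep_index n \<Longrightarrow> c j = 0"
    and indep_index_span: "\<exists>c'. \<forall>x\<in>- Hpts. (\<Sum>i\<in>basis_index n. c i * basis i x) = (\<Sum>j\<in>indep_index n. c' j * basis j x)"
proof -
  have "finite (basis_index n)" by (simp add: basis_index_def)
  from maximal_independent_subset_on[OF this, of "- Hpts" basis]
  have "\<exists>J. J \<subseteq> basis_index n \<and>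
      (\<forall>c. (\<forall>x\<in>- Hpts. (\<Sum>j\<in>J. c j * basis j x) = 0) \<longrightarrow> (\<forall>j\<in>J. c j = 0)) \<and>
      (\<forall>c. \<exists>c'. \<forall>x\<in>- Hpts. (\<Sum>i\<in>basis_index n. c i * basis i x) = (\<Sum>j\<in>J. c' j * basis j x))" .
  note * = someI_ex[OF this, folded indep_index_def]
  show "indep_index n \<subseteq> basis_index n" by (rule conjunct1[OF *])
  show "c j = 0" if "\<And>x. x \<notin> Hpts \<Longrightarrow> (\<Sum>j\<in>indep_index n. c j * basis j x) = 0" "j \<in> indep_index n"
    using conjunct1[OF conjunct2[OF *], rule_format, of c j] that by simp
  show "\<exists>c'. \<forall>x\<in>- Hpts. (\<Sum>i\<in>basis_index n. c i * basis i x) = (\<Sum>j\<in>indep_index n. c' j * basis j x)"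
    by (rule spec[OF conjunct2[OF conjunct2[OF *]]])
qed

lemma finite_indep_index [simp]: "finite (indep_index n)"
  by (rule finite_subset[OF indep_index_subset]) (simp add: basis_index_def)

lemma indep_index_basis:
  assumes "n 0 > 0" "p \<in> indep_index n"
  shows "fst p \<le> 3" "pole_le n (basis p)"
  using basis_index_basis[of n p] assms indep_index_subset[of n] by auto

lemma elliptic_span:
  assumes "n 0 > 0" "pole_le n f" "qper trivial_character f"
  shows "\<exists>c. \<forall>x. x \<notin> Hpts \<longrightarrow> f x = (\<Sum>p\<in>indep_index n. c p * basis p x)"
proof -
  obtain c0 c where c: "\<forall>x. x \<notin> Hpts \<longrightarrow> f x = c0 * 1 + (\<Sum>p\<in>pole_index base_order n. c p * basis p x)"
    using elliptic_expansion[OF assms] by (elim exE)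
  have notin: "(0, 0) \<notin> pole_index base_order n" by (simp add: pole_index_def base_order_def)
  let ?c = "c((0, 0) := c0)"
  obtain c' where c': "\<forall>x\<in>- Hpts. (\<Sum>i\<in>basis_index n. ?c i * basis i x) = (\<Sum>j\<in>indep_index n. c' j * basis j x)"
    using indep_index_span[where c = ?c and n = n] by (elim exE)
  have "f x = (\<Sum>p\<in>indep_index n. c' p * basis p x)" if x: "x \<notin> Hpts" for x
  proof -
    have "(\<Sum>i\<in>pole_index base_order n. ?c i * basis i x) = (\<Sum>i\<in>pole_index base_order n. c i * basis i x)"
      by (rule sum.cong) (use notin in auto)
    hence "(\<Sum>i\<in>basis_index n. ?c i * basis i x) = c0 * 1 + (\<Sum>p\<in>pole_index base_order n. c p * basis p x)"
      unfolding basis_index_def using notin by simp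
    thus ?thesis using c c' x by simp
  qed
  thus ?thesis by (intro exI[of _ c'] allI impI)
qed

lemma pole_le_sum:
  assumes "finite A" "\<And>a. a \<in> A \<Longrightarrow> pole_le n (f a)"
  shows "pole_le n (\<lambda>x. \<Sum>a\<in>A. c a * f a x)"
  using assms
proof (induction A rule: finite_induct)
  case empty
  show ?case using pole_le_mono[OF pole_le_entire[of "\<lambda>_. 0"], of n] by simp
next
  case (insert a A)
  thus ?case using pole_le_add[OF pole_le_cmult[of n "f a" "c a"]] by simp
qed

lemma qper_sum:
  assumes "\<And>a. a \<in> A \<Longrightarrow> qper trivial_character (f a)"
  shows "qper trivial_character (\<lambda>x. \<Sum>a\<in>A. c a * f a x)"
  unfolding qper_def
proof (intro ballI allI impI)
  fix \<tau> x assume "\<tau> \<in> Lat" "x \<notin> Hpts"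
  hence "(\<Sum>a\<in>A. c a * f a (x + \<tau>)) = (\<Sum>a\<in>A. c a * f a x)"
    using qperD[OF assms] by (intro sum.cong) auto
  thus "(\<Sum>a\<in>A. c a * f a (x + \<tau>)) = 1 * (\<Sum>a\<in>A. c a * f a x)" by simp
qed

text \<open>Odd basis functions in G and even ones in T carry the factor s. Then reflection in x
  amounts, up to sign, to s -> -s, and the equation splits into two parts in which s occurs only
  through s^2 = -Q(E).\<close>

definition weight :: "bool \<Rightarrow> complex \<Rightarrow> nat \<times> nat \<Rightarrow> complex" where
  "weight k s p = (if is_odd p = k then s else 1)"

definition comb :: "bool \<Rightarrow> (nat \<Rightarrow> nat) \<Rightarrow> (nat \<times> nat \<Rightarrow> complex) \<Rightarrow> complex \<Rightarrow> complex \<Rightarrow> complex" where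
  "comb k n v s x = (\<Sum>p\<in>indep_index n. v p * weight k s p * basis p x)"

lemma comb_pole_le: "n 0 > 0 \<Longrightarrow> pole_le n (comb k n v s)"
  unfolding comb_def[abs_def] by (rule pole_le_sum) (auto intro: indep_index_basis)

lemma comb_qper:
  assumes "n 0 > 0"
  shows "qper trivial_character (comb k n v s)"
  unfolding comb_def[abs_def]
proof (rule qper_sum)
  fix p assume "p \<in> indep_index n"
  from indep_index_basis(1)[of n, OF assms this] show "qper trivial_character (basis p)"
    using qper_basis[of "fst p" "snd p"] by simp
qed

lemma comb_reflect:
  assumes "n 0 > 0" "x \<notin> Hpts"
  shows "comb k n v (- s) x = (if k then 1 else - 1) * comb k n v s (- x)"
  unfolding comb_def sum_distrib_left
proof (rule sum.cong[OF refl])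
  fix p assume "p \<in> indep_index n"
  hence "basis p (- x) = (if is_odd p then - 1 else 1) * basis p x"
    using basis_reflect[of "fst p" x "snd p"] indep_index_basis(1)[of n p] assms by simp
  thus "v p * weight k (- s) p * basis p x = (if k then 1 else - 1) * (v p * weight k s p * basis p (- x))"
    by (simp add: weight_def)
qed

lemma comb_eq_0:
  assumes "\<And>x. x \<notin> Hpts \<Longrightarrow> comb k n v s x = 0" "s \<noteq> 0" "p \<in> indep_index n"
  shows "v p = 0"
proof -
  have "v p * weight k s p = 0"
    by (rule indep_index_independent[where c = "\<lambda>p. v p * weight k s p", OF _ assms(3)]) (use assms(1) in \<open>simp add: comb_def\<close>)
  thus ?thesis using assms(2) by (simp add: weight_def split: if_splits)
qed

lemma elliptic_comb:
  assumes "n 0 > 0" "pole_le n f" "qper trivial_character f" "s \<noteq> 0"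
  shows "\<exists>v. \<forall>x. x \<notin> Hpts \<longrightarrow> comb k n v s x = f x"
proof -
  obtain c where c: "\<forall>x. x \<notin> Hpts \<longrightarrow> f x = (\<Sum>p\<in>indep_index n. c p * basis p x)"
    using elliptic_span[OF assms(1-3)] by (elim exE)
  have "weight k s p \<noteq> 0" for p using assms(4) by (simp add: weight_def)
  hence "comb k n (\<lambda>p. c p / weight k s p) s x = (\<Sum>p\<in>indep_index n. c p * basis p x)" for x
    by (simp add: comb_def)
  thus ?thesis using c by (intro exI[of _ "\<lambda>p. c p / weight k s p"]) simp
qed

end

context finite_gap_data
begin

definition unknowns :: "((nat \<times> nat) + (nat \<times> nat)) set" where
  "unknowns = indep_index G_order <+> indep_index T_order"

text \<open>The even and odd parts of \<open>G (\<Xi>' + 2 s) - \<Xi> T\<close>, whose coefficients are free of \<open>s\<close>.\<close>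
definition xi_row :: "complex \<times> bool \<Rightarrow> (nat \<times> nat) + (nat \<times> nat) \<Rightarrow> complex poly" where
  "xi_row r i = (case i of
      Inl p \<Rightarrow> smult (basis p (fst r)) (if snd r then (if is_odd p then Xi_deriv_poly (fst r) else [:2:])
                  else (if is_odd p then smult (- 2) Q else Xi_deriv_poly (fst r)))
    | Inr p \<Rightarrow> (if is_odd p = snd r then 0 else smult (- basis p (fst r)) (Xi_poly (fst r))))"

lemma finite_unknowns: "finite unknowns"
  by (simp add: unknowns_def)

text \<open>The row \<open>False\<close> collects the terms free of s, with s^2 replaced by -Q(E),
  and the row \<open>True\<close> collects the coefficient of s.\<close>

lemma row_combination:
  assumes "s ^ 2 = - poly Q E"
  shows "(\<Sum>i\<in>unknowns. poly (xi_row (x, False) i) E * v i) + s * (\<Sum>i\<in>unknowns. poly (xi_row (x, True) i) E * v i)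
     = comb True G_order (\<lambda>p. v (Inl p)) s x * (poly (Xi_deriv_poly x) E + 2 * s) - X E x * comb False T_order (\<lambda>p. v (Inr p)) s x"
proof -
  have Q: "poly Q E = - (s * s)" using assms by (simp add: power2_eq_square)
  have U: "(\<Sum>i\<in>unknowns. f i) = (\<Sum>p\<in>indep_index G_order. f (Inl p)) + (\<Sum>p\<in>indep_index T_order. f (Inr p))" for f :: "_ \<Rightarrow> complex"
    unfolding unknowns_def by (subst sum.Plus) simp_all
  have 1: "(\<Sum>p\<in>indep_index G_order. poly (xi_row (x, False) (Inl p)) E * v (Inl p)) + s * (\<Sum>p\<in>indep_index G_order. poly (xi_row (x, True) (Inl p)) E * v (Inl p))
      = comb True G_order (\<lambda>p. v (Inl p)) s x * (poly (Xi_deriv_poly x) E + 2 * s)"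
    unfolding comb_def sum_distrib_left sum_distrib_right sum.distrib[symmetric]
    by (rule sum.cong[OF refl]) (simp add: xi_row_def weight_def Q algebra_simps)
  have 2: "(\<Sum>p\<in>indep_index T_order. poly (xi_row (x, False) (Inr p)) E * v (Inr p)) + s * (\<Sum>p\<in>indep_index T_order. poly (xi_row (x, True) (Inr p)) E * v (Inr p))
      = - (X E x * comb False T_order (\<lambda>p. v (Inr p)) s x)"
    unfolding comb_def sum_distrib_left sum_distrib_right sum.distrib[symmetric] sum_negf[symmetric]
    by (rule sum.cong[OF refl]) (simp add: xi_row_def weight_def poly_Xi algebra_simps)
  show ?thesis unfolding U using 1 2 by (simp add: algebra_simps)
qed

end

context zero_system_off
begin

text \<open>At a single x and s the equation only says that one row plus s times the other vanishes.
  Applied at -x, with the parities of all functions, it says the same with -s; as s is nonzero, both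
  rows vanish.\<close>

lemma rows_iff:
  assumes sq: "s ^ 2 = - poly Q E"
  shows "(\<forall>r\<in>(- Hpts) \<times> UNIV. (\<Sum>i\<in>unknowns. poly (xi_row r i) E * v i) = 0) \<longleftrightarrow>
    (\<forall>x. x \<notin> Hpts \<longrightarrow> comb True G_order (\<lambda>p. v (Inl p)) s x * (poly (Xi_deriv_poly x) E + 2 * s)
        = X E x * comb False T_order (\<lambda>p. v (Inr p)) s x)" (is "?A \<longleftrightarrow> ?B")
proof
  assume ?A
  show ?B
  proof (intro allI impI)
    fix x assume "x \<notin> Hpts"
    hence "(\<Sum>i\<in>unknowns. poly (xi_row (x, k) i) E * v i) = 0" for k using \<open>?A\<close> by simp
    hence "0 + s * 0 = comb True G_order (\<lambda>p. v (Inl p)) s x * (poly (Xi_deriv_poly x) E + 2 * s)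
        - X E x * comb False T_order (\<lambda>p. v (Inr p)) s x"
      using row_combination[OF sq, of x v] by (simp only:)
    thus "comb True G_order (\<lambda>p. v (Inl p)) s x * (poly (Xi_deriv_poly x) E + 2 * s)
        = X E x * comb False T_order (\<lambda>p. v (Inr p)) s x" by simp
  qed
next
  assume B: ?B
  have sq': "(- s) ^ 2 = - poly Q E" using sq by simp
  show ?A
  proof
    fix r :: "complex \<times> bool" assume "r \<in> (- Hpts) \<times> UNIV"
    then obtain x k where r: "r = (x, k)" "x \<notin> Hpts" by auto
    let ?R = "\<lambda>k. \<Sum>i\<in>unknowns. poly (xi_row (x, k) i) E * v i"
    have 1: "?R False + s * ?R True = 0"
      unfolding row_combination[OF sq] using B r(2) by simp
    have "?R False + (- s) * ?R True = comb True G_order (\<lambda>p. v (Inl p)) s (- x) * (poly (Xi_deriv_poly x) E + 2 * - s)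
        + X E x * comb False T_order (\<lambda>p. v (Inr p)) s (- x)"
      unfolding row_combination[OF sq'] using comb_reflect[of G_order x True] comb_reflect[of T_order x False] r(2) G_order_0
      by simp
    also have "\<dots> = - (comb True G_order (\<lambda>p. v (Inl p)) s (- x) * (poly (Xi_deriv_poly (- x)) E + 2 * s)
        - X E (- x) * comb False T_order (\<lambda>p. v (Inr p)) s (- x))"
      using Xi_reflect[OF r(2), of E] Xi_deriv_reflect[OF r(2), of E] by (simp add: algebra_simps)
    also have "\<dots> = 0" using B r(2) by simp
    finally have 2: "?R False + (- s) * ?R True = 0" .
    have "?R False = 0" using 1 2 by (simp add: algebra_simps add_eq_0_iff)
    moreover from this 1 have "?R True = 0" using s_nonzero by simp
    ultimately show "(\<Sum>i\<in>unknowns. poly (xi_row r i) E * v i) = 0" using r by (cases k) simp_all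
  qed
qed

lemma zero_prod_at_0: "p 0 \<noteq> 0"
  using Hpts_Lat[OF zeros_off] by (auto simp: zero_prod_def wsigma_eq_0_iff)

lemma wsigma_alpha: "S \<alpha> \<noteq> 0"
  using alpha_off by (simp add: wsigma_eq_0_iff)

lemma kernel_exists:
  assumes sq: "s ^ 2 = - poly Q E"
  shows "\<exists>v. (\<exists>i\<in>unknowns. v i \<noteq> 0) \<and> (\<forall>r\<in>(- Hpts) \<times> UNIV. (\<Sum>i\<in>unknowns. poly (xi_row r i) E * v i) = 0)"
proof -
  obtain g where g: "\<forall>x. x \<notin> Hpts \<longrightarrow> comb True G_order g s x = G0 x"
    using elliptic_comb[where k = True, OF G_order_0 G0_pole_le G0_qper s_nonzero] by (elim exE)
  obtain h where h: "\<forall>x. x \<notin> Hpts \<longrightarrow> comb False T_order h s x = T0 offset x"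
    using elliptic_comb[where n = T_order and k = False, OF _ T0_pole_le T0_qper s_nonzero] by auto
  define v where "v = case_sum g h"
  have "\<forall>r\<in>(- Hpts) \<times> UNIV. (\<Sum>i\<in>unknowns. poly (xi_row r i) E * v i) = 0"
    unfolding rows_iff[OF sq] using g h G0_T0 by (simp add: v_def)
  moreover have "\<exists>i\<in>unknowns. v i \<noteq> 0"
  proof (rule ccontr)
    assume "\<not> (\<exists>i\<in>unknowns. v i \<noteq> 0)"
    hence "g q = 0" if "q \<in> indep_index G_order" for q
      using that unfolding unknowns_def v_def by (metis InlI old.sum.simps(5))
    hence "comb True G_order g s x = 0" for x by (simp add: comb_def)
    hence z: "p x * S (x + \<alpha>) = 0" if "x \<notin> Hpts" for x
      using g that G0_numerator[OF that] by simp
    \<comment> \<open>If all coefficients of G vanished, so would the numerator of \<open>G0\<close>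
      everywhere; but at 0 it is nonzero, neither the t j nor \<alpha> being periods.\<close>
    have "p 0 * S (0 + \<alpha>) = 0"
      by (rule entire_eq_off_Hpts[of "\<lambda>x. p x * S (x + \<alpha>)" "\<lambda>_. 0"])
         (use z in \<open>auto intro!: holomorphic_intros zero_prod_holomorphic\<close>)
    thus False using zero_prod_at_0 wsigma_alpha by simp
  qed
  ultimately show ?thesis by blast
qed

text \<open>At -t j the function \<Xi> vanishes while \<Xi>' + 2 s equals 4 s, so G must vanish
  there and \<open>G0_unique\<close> applies. Cancelling \<Xi> gives T with the same scalar, and
  independence of the chosen basis functions excludes the scalar zero.\<close>

lemma kernel_unique:
  assumes sq: "s ^ 2 = - poly Q E" and v: "\<exists>i\<in>unknowns. v i \<noteq> 0"
    and ker: "\<forall>r\<in>(- Hpts) \<times> UNIV. (\<Sum>i\<in>unknowns. poly (xi_row r i) E * v i) = 0"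
  shows "\<exists>c. c \<noteq> 0 \<and> (\<forall>x. x \<notin> Hpts \<longrightarrow> comb True G_order (\<lambda>p. v (Inl p)) s x = c * G0 x) \<and>
    (\<forall>x. x \<notin> Hpts \<longrightarrow> comb False T_order (\<lambda>p. v (Inr p)) s x = c * T0 offset x)"
proof -
  let ?G = "comb True G_order (\<lambda>p. v (Inl p)) s"
  let ?T = "comb False T_order (\<lambda>p. v (Inr p)) s"
  have eq: "?G x * (poly (Xi_deriv_poly x) E + 2 * s) = X E x * ?T x" if "x \<notin> Hpts" for x
    using ker that unfolding rows_iff[OF sq] by blast
  have "\<exists>c. \<forall>x. x \<notin> Hpts \<longrightarrow> ?G x = c * G0 x"
  proof (rule G0_unique[OF comb_pole_le[where n = G_order, OF G_order_0] comb_qper[where n = G_order, OF G_order_0]])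
    fix j \<tau> assume j: "j \<in> {1..L}" "\<tau> \<in> Lat"
    note tr = Xi_zero_translates[OF j]
    have "?G (- t j + \<tau>) * (2 * s + 2 * s) = 0" using eq[OF tr(2)] unfolding tr(4,6) by simp
    thus "?G (- t j + \<tau>) = 0" using s_nonzero by simp
  qed
  then obtain c where c: "\<forall>x. x \<notin> Hpts \<longrightarrow> ?G x = c * G0 x" ..
  have T: "?T x = c * T0 offset x" if x: "x \<notin> Hpts" for x
  proof (rule Xi_cancel[where f = ?T and g = "\<lambda>x. c * T0 offset x", OF _ _ _ x])
    show "?T holomorphic_on - Hpts" by (rule pole_le_holomorphic[OF comb_pole_le]) simp
    show "(\<lambda>x. c * T0 offset x) holomorphic_on - Hpts" by (rule pole_le_holomorphic[OF pole_le_cmult[OF T0_pole_le]])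
    fix x assume x: "x \<notin> Hpts"
    have "X E x * ?T x = c * (G0 x * (poly (Xi_deriv_poly x) E + 2 * s))"
      unfolding eq[OF x, symmetric] using c x by simp
    thus "X E x * ?T x = X E x * (c * T0 offset x)"
      unfolding G0_T0[OF x] by (simp only: mult.left_commute)
  qed
  have "c \<noteq> 0"
  proof
    assume c0: "c = 0"
    have "v (Inl q) = 0" if "q \<in> indep_index G_order" for q
      by (rule comb_eq_0[where v = "\<lambda>p. v (Inl p)" and k = True, OF _ s_nonzero that]) (use c c0 in simp)
    moreover have "v (Inr q) = 0" if "q \<in> indep_index T_order" for q
      by (rule comb_eq_0[where v = "\<lambda>p. v (Inr p)" and k = False, OF _ s_nonzero that]) (use T c0 in simp)
    ultimately show False using v by (auto simp: unknowns_def)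
  qed
  with c T show ?thesis by (intro exI[of _ c] conjI allI impI) auto
qed

end

section \<open>Rationality of \<open>\<alpha>\<close> and \<open>\<kappa>\<close>\<close>

lemma higher_deriv_linear_combination:
  fixes f :: "'b \<Rightarrow> complex \<Rightarrow> complex"
  assumes "finite A" "\<And>a. a \<in> A \<Longrightarrow> f a holomorphic_on UNIV"
  shows "(deriv ^^ n) (\<lambda>x. \<Sum>a\<in>A. c a * f a x) z = (\<Sum>a\<in>A. c a * (deriv ^^ n) (f a) z)"
proof -
  have "(deriv ^^ n) (\<lambda>x. \<Sum>a\<in>A. c a * f a x) z = (\<Sum>a\<in>A. (deriv ^^ n) (\<lambda>x. c a * f a x) z)"
    by (rule higher_deriv_sum[where U = UNIV, OF assms(1)]) (auto intro!: holomorphic_intros assms(2))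
  also have "\<dots> = (\<Sum>a\<in>A. c a * (deriv ^^ n) (f a) z)"
    by (rule sum.cong[OF refl]) (rule higher_deriv_cmult[where A = UNIV], use assms(2) in auto)
  finally show ?thesis .
qed

context period_pair
begin

abbreviation half_prod :: "complex \<Rightarrow> complex" where
  "half_prod x \<equiv> \<Prod>k=1..3. S (x + hp k)"

lemma half_prod_at_0: "half_prod 0 \<noteq> 0"
  using half_period_notin by (auto simp: wsigma_eq_0_iff)

lemma Theta_1: "Theta (\<lambda>_. 1) x = S x * half_prod x"
  unfolding Theta_def atMost_3_eq by simp

abbreviation sd :: "nat \<Rightarrow> complex" where
  "sd n \<equiv> (deriv ^^ n) S 0"

text \<open>These invert the Leibniz rule for \<open>v = \<beta> k\<close> and \<open>k = 2 S' + S f\<close>, where \<open>\<beta>\<close>, \<open>v\<close> stand for the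
  sequences of derivatives at \<open>0\<close> and \<open>k(0) = 2\<close>.\<close>
definition quotient_1 :: "(nat \<Rightarrow> complex) \<Rightarrow> (nat \<Rightarrow> complex) \<Rightarrow> complex" where
  "quotient_1 \<beta> v = (v 1 - 2 * \<beta> 1) / \<beta> 0"
definition quotient_2 :: "(nat \<Rightarrow> complex) \<Rightarrow> (nat \<Rightarrow> complex) \<Rightarrow> complex" where
  "quotient_2 \<beta> v = (v 2 - 2 * \<beta> 2 - 2 * \<beta> 1 * quotient_1 \<beta> v) / \<beta> 0"
definition quotient_3 :: "(nat \<Rightarrow> complex) \<Rightarrow> (nat \<Rightarrow> complex) \<Rightarrow> complex" where
  "quotient_3 \<beta> v = (v 3 - 2 * \<beta> 3 - 3 * \<beta> 2 * quotient_1 \<beta> v - 3 * \<beta> 1 * quotient_2 \<beta> v) / \<beta> 0"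
definition factor_0 :: "(nat \<Rightarrow> complex) \<Rightarrow> (nat \<Rightarrow> complex) \<Rightarrow> complex" where
  "factor_0 \<beta> v = quotient_1 \<beta> v - 2 * sd 2"
definition factor_1 :: "(nat \<Rightarrow> complex) \<Rightarrow> (nat \<Rightarrow> complex) \<Rightarrow> complex" where
  "factor_1 \<beta> v = (quotient_2 \<beta> v - 2 * sd 3 - sd 2 * factor_0 \<beta> v) / 2"
definition factor_2 :: "(nat \<Rightarrow> complex) \<Rightarrow> (nat \<Rightarrow> complex) \<Rightarrow> complex" where
  "factor_2 \<beta> v = (quotient_3 \<beta> v - 2 * sd 4 - sd 3 * factor_0 \<beta> v - 3 * sd 2 * factor_1 \<beta> v) / 3"

text \<open>Since S has a simple zero at 0, the n-th derivative of S f at 0 involves f only up to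
  order n - 1. Three derivatives of the known functions \<open>Bf\<close> and \<open>Vf\<close>
  therefore reach the second derivative of f.\<close>

lemma taylor_division:
  fixes f Bf Vf :: "complex \<Rightarrow> complex"
  assumes U: "open U" "0 \<in> U" and f: "f holomorphic_on U"
    and Bf: "Bf holomorphic_on UNIV" "Bf 0 \<noteq> 0" and Vf: "Vf holomorphic_on UNIV"
    and eq: "\<And>x. x \<in> U \<Longrightarrow> Vf x = Bf x * (2 * deriv S x + S x * f x)"
  defines "\<beta> \<equiv> \<lambda>n. (deriv ^^ n) Bf 0" and "v \<equiv> \<lambda>n. (deriv ^^ n) Vf 0"
  shows "deriv f 0 = factor_1 \<beta> v" "(deriv ^^ 2) f 0 = factor_2 \<beta> v"
proof -
  define k where "k x = 2 * deriv S x + S x * f x" for x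
  define \<kappa> where "\<kappa> n = (deriv ^^ n) k 0" for n
  define \<phi> where "\<phi> n = (deriv ^^ n) f 0" for n
  have k: "k holomorphic_on U" unfolding k_def[abs_def]
    by (intro holomorphic_intros wsigma_deriv_holomorphic f)
  have BU: "Bf holomorphic_on U" "Vf holomorphic_on U" using Bf(1) Vf holomorphic_on_subset by blast+
  have v: "v n = (\<Sum>i=0..n. of_nat (n choose i) * \<beta> i * \<kappa> (n - i))" for n
  proof -
    have "v n = (deriv ^^ n) (\<lambda>x. Bf x * k x) 0" unfolding v_def
      by (rule higher_deriv_transform_within_open[OF BU(2) _ U]) (use eq in \<open>auto intro!: holomorphic_intros BU k simp: k_def[symmetric]\<close>)
    also have "\<dots> = (\<Sum>i=0..n. of_nat (n choose i) * \<beta> i * \<kappa> (n - i))"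
      unfolding \<beta>_def \<kappa>_def by (rule higher_deriv_mult[OF BU(1) k U])
    finally show ?thesis .
  qed
  have \<kappa>: "\<kappa> n = 2 * sd (Suc n) + (\<Sum>i=0..n. of_nat (n choose i) * sd i * \<phi> (n - i))" for n
  proof -
    have "\<kappa> n = (deriv ^^ n) (\<lambda>x. 2 * deriv S x) 0 + (deriv ^^ n) (\<lambda>x. S x * f x) 0"
      unfolding \<kappa>_def k_def[abs_def]
      by (rule higher_deriv_add[OF _ _ U]) (intro holomorphic_intros wsigma_deriv_holomorphic f)+
    also have "(deriv ^^ n) (\<lambda>x. 2 * deriv S x) 0 = 2 * (deriv ^^ n) (deriv S) 0"
      by (rule higher_deriv_cmult[where A = U]) (use U wsigma_deriv_holomorphic in auto)
    also have "(deriv ^^ n) (deriv S) 0 = sd (Suc n)" by (simp add: funpow_swap1)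
    also have "(deriv ^^ n) (\<lambda>x. S x * f x) 0 = (\<Sum>i=0..n. of_nat (n choose i) * sd i * \<phi> (n - i))"
      unfolding \<phi>_def by (rule higher_deriv_mult[OF wsigma_holomorphic f U])
    finally show ?thesis .
  qed
  have s01: "sd 0 = 0" "sd (Suc 0) = 1" by simp_all
  have \<kappa>0: "\<kappa> 0 = 2" using \<kappa>[of 0] s01 by simp
  have \<kappa>1: "\<kappa> 1 = 2 * sd 2 + \<phi> 0" using \<kappa>[of 1] s01 by (simp add: numeral_2_eq_2)
  have \<kappa>2: "\<kappa> 2 = 2 * sd 3 + sd 2 * \<phi> 0 + 2 * \<phi> 1"
    using \<kappa>[of 2] s01 by (simp add: numeral_2_eq_2 numeral_3_eq_3)
  have \<kappa>3: "\<kappa> 3 = 2 * sd 4 + sd 3 * \<phi> 0 + 3 * sd 2 * \<phi> 1 + 3 * \<phi> 2"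
    using \<kappa>[of 3] s01 by (simp add: eval_nat_numeral)
  have \<beta>0: "\<beta> 0 \<noteq> 0" using Bf(2) by (simp add: \<beta>_def)
  have "v 1 = 2 * \<beta> 1 + \<beta> 0 * \<kappa> 1" using v[of 1] \<kappa>0 by simp
  hence q1: "quotient_1 \<beta> v = \<kappa> 1" using \<beta>0 by (simp add: quotient_1_def)
  have "v 2 = 2 * \<beta> 2 + 2 * \<beta> 1 * \<kappa> 1 + \<beta> 0 * \<kappa> 2"
    using v[of 2] \<kappa>0 by (simp add: numeral_2_eq_2)
  hence q2: "quotient_2 \<beta> v = \<kappa> 2" using \<beta>0 by (simp add: quotient_2_def q1)
  have "v 3 = 2 * \<beta> 3 + 3 * \<beta> 2 * \<kappa> 1 + 3 * \<beta> 1 * \<kappa> 2 + \<beta> 0 * \<kappa> 3"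
    using v[of 3] \<kappa>0 by (simp add: eval_nat_numeral)
  hence q3: "quotient_3 \<beta> v = \<kappa> 3" using \<beta>0 by (simp add: quotient_3_def q1 q2)
  have f0: "factor_0 \<beta> v = \<phi> 0" unfolding factor_0_def q1 \<kappa>1 by simp
  have f1: "factor_1 \<beta> v = \<phi> 1" unfolding factor_1_def f0 q2 \<kappa>2 by simp
  have f2: "factor_2 \<beta> v = \<phi> 2" unfolding factor_2_def f0 f1 q3 \<kappa>3 by simp
  show "deriv f 0 = factor_1 \<beta> v" "(deriv ^^ 2) f 0 = factor_2 \<beta> v"
    by (simp_all add: f1 f2 \<phi>_def)
qed

end

context finite_gap_data
begin

text \<open>Together with \<open>V_taylor\<close>: derivatives at 0 of the numerators of G and of T
  - 2 G'. The orders \<open>l i + 1\<close> and \<open>T_order\<close> differ by exactly one factor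
  S, so the auxiliary factors at the other half periods cancel in the quotient of the two
  numerators.\<close>

definition G_taylor :: "(nat \<times> nat + nat \<times> nat \<Rightarrow> complex) \<Rightarrow> complex \<Rightarrow> nat \<Rightarrow> complex" where
  "G_taylor v s n = (\<Sum>p\<in>indep_index G_order. v (Inl p) * weight True s p * (deriv ^^ n) (numer (\<lambda>i. l i + 1) (basis p)) 0)"

definition V_taylor :: "(nat \<times> nat + nat \<times> nat \<Rightarrow> complex) \<Rightarrow> complex \<Rightarrow> nat \<Rightarrow> complex" where
  "V_taylor v s n = (\<Sum>p\<in>indep_index T_order. v (Inr p) * weight False s p * (deriv ^^ n) (numer T_order (basis p)) 0)
     + (- 2) * (\<Sum>p\<in>indep_index G_order. v (Inl p) * weight True s p * (deriv ^^ n) (numer T_order (deriv (basis p))) 0)"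

text \<open>The second sum compensates the logarithmic derivative at 0 of the extra factors S(x + hp
  k), which the order \<open>l k + 1\<close> puts into the numerator of G.\<close>

definition kappa_const :: complex where
  "kappa_const = (\<Sum>k=1..3. of_nat (l k) * eta_val \<omega>1 \<omega>3 k) + (\<Sum>k=1..3. Z (hp k))"

end

context zero_system_off
begin

text \<open>The numerator of G is c p S(x + \<alpha>) times \<open>half_prod\<close>, and that of T
  - 2 G' is the same times 2 S' + S f, where f = 2 (offset - Z(x + \<alpha>)). The scalar c drops
  out of all quotients. The logarithmic derivative of the first at 0 contains the sum of the Z(t j)
  and Z(\<alpha>), that is -\<kappa> up to a constant, while f' and f'' at 0 are 2
  \<open>P \<alpha>\<close> and 2 \<open>deriv P \<alpha>\<close>.\<close>

lemma taylor_reading: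
  assumes c: "c \<noteq> 0" and G: "\<forall>x. x \<notin> Hpts \<longrightarrow> comb True G_order (\<lambda>p. v (Inl p)) s x = c * G0 x"
    and T: "\<forall>x. x \<notin> Hpts \<longrightarrow> comb False T_order (\<lambda>p. v (Inr p)) s x = c * T0 offset x"
  defines "\<beta> \<equiv> G_taylor v s" and "w \<equiv> V_taylor v s"
  shows "\<beta> 0 \<noteq> 0" "kappa \<omega>1 \<omega>3 l t = kappa_const - \<beta> 1 / \<beta> 0"
    "P \<alpha> = factor_1 \<beta> w / 2" "deriv P \<alpha> = factor_2 \<beta> w / 2"
proof -
  let ?R = "\<lambda>i. l i + 1"
  let ?JG = "indep_index G_order" and ?JT = "indep_index T_order"
  let ?g = "\<lambda>p. v (Inl p) * weight True s p" and ?h = "\<lambda>p. v (Inr p) * weight False s p"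
  have JG: "pole_le ?R (basis p)" "pole_le T_order (deriv (basis p))" "basis p holomorphic_on - Hpts" if "p \<in> ?JG" for p
  proof -
    have b: "pole_le G_order (basis p)" by (rule indep_index_basis(2)[where n = G_order, OF G_order_0 that])
    show "pole_le ?R (basis p)" by (rule pole_le_mono[OF b]) (simp add: G_order_def base_order_def)
    show "pole_le T_order (deriv (basis p))" by (rule pole_le_deriv[OF b])
    show "basis p holomorphic_on - Hpts" by (rule pole_le_holomorphic[OF b])
  qed
  have JT: "pole_le T_order (basis p)" if "p \<in> ?JT" for p
    by (rule indep_index_basis(2)[where n = T_order, OF _ that]) simp
  define Bf where "Bf x = (\<Sum>p\<in>?JG. ?g p * numer ?R (basis p) x)" for x
  define Vf where "Vf x = (\<Sum>p\<in>?JT. ?h p * numer T_order (basis p) x)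
      + (- 2) * (\<Sum>p\<in>?JG. ?g p * numer T_order (deriv (basis p)) x)" for x
  have Bhol: "Bf holomorphic_on UNIV" unfolding Bf_def[abs_def]
    by (intro holomorphic_intros numer_holomorphic JG)
  have Vhol1: "(\<lambda>x. \<Sum>p\<in>?JT. ?h p * numer T_order (basis p) x) holomorphic_on UNIV"
    by (intro holomorphic_intros numer_holomorphic JT)
  have Vhol2: "(\<lambda>x. \<Sum>p\<in>?JG. ?g p * numer T_order (deriv (basis p)) x) holomorphic_on UNIV"
    by (intro holomorphic_intros numer_holomorphic JG)
  have Vhol: "Vf holomorphic_on UNIV" unfolding Vf_def[abs_def]
    by (intro holomorphic_intros Vhol1 Vhol2)
  have \<beta>: "(deriv ^^ n) Bf 0 = \<beta> n" for n
    unfolding Bf_def[abs_def] \<beta>_def G_taylor_def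
    by (rule higher_deriv_linear_combination[OF finite_indep_index]) (rule numer_holomorphic[OF JG(1)])
  have w: "(deriv ^^ n) Vf 0 = w n" for n
  proof -
    have "(deriv ^^ n) Vf 0 = (deriv ^^ n) (\<lambda>x. \<Sum>p\<in>?JT. ?h p * numer T_order (basis p) x) 0
        + (deriv ^^ n) (\<lambda>x. (- 2) * (\<Sum>p\<in>?JG. ?g p * numer T_order (deriv (basis p)) x)) 0"
      unfolding Vf_def[abs_def] by (rule higher_deriv_add[where S = UNIV]) (intro Vhol1 holomorphic_intros Vhol2 | simp)+
    also have "(deriv ^^ n) (\<lambda>x. (- 2) * (\<Sum>p\<in>?JG. ?g p * numer T_order (deriv (basis p)) x)) 0
        = (- 2) * (deriv ^^ n) (\<lambda>x. \<Sum>p\<in>?JG. ?g p * numer T_order (deriv (basis p)) x) 0"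
      by (rule higher_deriv_cmult[where A = UNIV]) (use Vhol2 in auto)
    also have "(deriv ^^ n) (\<lambda>x. \<Sum>p\<in>?JG. ?g p * numer T_order (deriv (basis p)) x) 0 =
        (\<Sum>p\<in>?JG. ?g p * (deriv ^^ n) (numer T_order (deriv (basis p))) 0)"
      by (rule higher_deriv_linear_combination[OF finite_indep_index]) (rule numer_holomorphic[OF JG(2)])
    also have "(deriv ^^ n) (\<lambda>x. \<Sum>p\<in>?JT. ?h p * numer T_order (basis p) x) 0 =
        (\<Sum>p\<in>?JT. ?h p * (deriv ^^ n) (numer T_order (basis p)) 0)"
      by (rule higher_deriv_linear_combination[OF finite_indep_index]) (rule numer_holomorphic[OF JT])
    finally show ?thesis by (simp only: w_def V_taylor_def)
  qed
  have Beq: "Bf x = c * (p x * S (x + \<alpha>) * half_prod x)" for x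
  proof (rule entire_eq_off_Hpts[OF Bhol])
    show "(\<lambda>x. c * (p x * S (x + \<alpha>) * half_prod x)) holomorphic_on UNIV"
      by (intro holomorphic_intros zero_prod_holomorphic)
    fix x assume x: "x \<notin> Hpts"
    have "Bf x = comb True G_order (\<lambda>p. v (Inl p)) s x * Theta ?R x"
      unfolding Bf_def comb_def sum_distrib_right
      by (rule sum.cong[OF refl]) (simp only: numer_eq[OF JG(1) x, symmetric] mult.assoc)
    also have "\<dots> = c * (G0 x * Theta G_order x) * half_prod x"
      using G x by (simp only: Theta_add Theta_1 Theta_G_order) simp
    finally show "Bf x = c * (p x * S (x + \<alpha>) * half_prod x)"
      unfolding G0_numerator[OF x] by (simp only: mult.assoc)
  qed
  have Veq: "Vf x = 2 * c * (p x * half_prod x * (deriv S x * S (x + \<alpha>) - S x * deriv S (x + \<alpha>) + offset * (S x * S (x + \<alpha>))))" for x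
  proof (rule entire_eq_off_Hpts[OF Vhol])
    show "(\<lambda>x. 2 * c * (p x * half_prod x * (deriv S x * S (x + \<alpha>) - S x * deriv S (x + \<alpha>) + offset * (S x * S (x + \<alpha>))))) holomorphic_on UNIV"
      by (intro holomorphic_intros zero_prod_holomorphic wsigma_deriv_holomorphic entire_shift[of "deriv S"])
    fix x assume x: "x \<notin> Hpts"
    have dG: "(\<Sum>p\<in>?JG. ?g p * deriv (basis p) x) = c * deriv G0 x"
    proof -
      have "((\<lambda>x. \<Sum>p\<in>?JG. ?g p * basis p x) has_field_derivative (\<Sum>p\<in>?JG. ?g p * deriv (basis p) x)) (at x)"
        by (intro DERIV_sum DERIV_cmult holomorphic_derivI[OF JG(3) open_off_Hpts]) (use x in auto)
      hence "((\<lambda>x. c * G0 x) has_field_derivative (\<Sum>p\<in>?JG. ?g p * deriv (basis p) x)) (at x)"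
        by (rule has_field_derivative_transform_within_open[OF _ open_off_Hpts])
           (use x G in \<open>auto simp: comb_def\<close>)
      moreover have "((\<lambda>x. c * G0 x) has_field_derivative c * deriv G0 x) (at x)"
        by (intro DERIV_cmult holomorphic_derivI[OF G0_holomorphic open_off_Hpts]) (use x in auto)
      ultimately show ?thesis by (rule DERIV_unique)
    qed
    have "Vf x = (comb False T_order (\<lambda>p. v (Inr p)) s x + (- 2) * (\<Sum>p\<in>?JG. ?g p * deriv (basis p) x)) * Theta T_order x"
    proof -
      have 1: "(\<Sum>p\<in>?JT. ?h p * numer T_order (basis p) x) = comb False T_order (\<lambda>p. v (Inr p)) s x * Theta T_order x"
        unfolding comb_def sum_distrib_right
        by (rule sum.cong[OF refl]) (simp only: numer_eq[OF JT x, symmetric] mult.assoc)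
      have 2: "(\<Sum>p\<in>?JG. ?g p * numer T_order (deriv (basis p)) x) = (\<Sum>p\<in>?JG. ?g p * deriv (basis p) x) * Theta T_order x"
        unfolding sum_distrib_right
        by (rule sum.cong[OF refl]) (simp only: numer_eq[OF JG(2) x, symmetric] mult.assoc)
      show ?thesis unfolding Vf_def 1 2 by (simp only: distrib_right mult.assoc)
    qed
    also have "\<dots> = 2 * c * (V0 offset x * Theta T_order x)"
      unfolding dG using T x by (simp add: T0_def algebra_simps)
    also have "V0 offset x * Theta T_order x = p x * half_prod x * (deriv S x * S (x + \<alpha>) - S x * deriv S (x + \<alpha>) + offset * (S x * S (x + \<alpha>)))"
      unfolding Theta_add Theta_1 Theta_G_order using Theta_nonzero[OF x, of l] wsigma_nonzero[OF x]
      by (simp add: V0_def power2_eq_square)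
    finally show "Vf x = 2 * c * (p x * half_prod x * (deriv S x * S (x + \<alpha>) - S x * deriv S (x + \<alpha>) + offset * (S x * S (x + \<alpha>))))" .
  qed
  have B0: "Bf 0 \<noteq> 0" using Beq[of 0] c zero_prod_at_0 wsigma_alpha half_prod_at_0 by simp
  thus "\<beta> 0 \<noteq> 0" using \<beta>[of 0] by simp
  show "kappa \<omega>1 \<omega>3 l t = kappa_const - \<beta> 1 / \<beta> 0"
  proof -
    let ?z = "(\<Sum>j=1..L. Z (t j)) + Z \<alpha> + (\<Sum>k=1..3. Z (hp k))"
    have dS: "((\<lambda>x. S (x + y)) has_field_derivative S (0 + y) * Z y) (at 0)" if "y \<notin> Lat" for y
    proof -
      have "((\<lambda>x. S (x + y)) has_field_derivative S (0 + y) * Z (0 + y) * 1) (at 0)"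
        by (rule DERIV_chain2[of S], rule wsigma_derivative) (use that in \<open>auto intro!: derivative_eq_intros\<close>)
      thus ?thesis by simp
    qed
    have 1: "(p has_field_derivative p 0 * (\<Sum>j=1..L. Z (t j))) (at 0)"
      unfolding zero_prod_def[abs_def]
      by (rule has_field_derivative_prod_log[OF finite_atLeastAtMost dS[OF Hpts_Lat[OF zeros_off]]])
    have 2: "(half_prod has_field_derivative half_prod 0 * (\<Sum>k=1..3. Z (hp k))) (at 0)"
      by (rule has_field_derivative_prod_log[OF finite_atLeastAtMost dS[OF half_period_notin]])
    have "((\<lambda>x. c * (p x * S (x + \<alpha>) * half_prod x)) has_field_derivative
        c * ((p 0 * (\<Sum>j=1..L. Z (t j)) * S (0 + \<alpha>) + S (0 + \<alpha>) * Z \<alpha> * p 0) * half_prod 0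
          + half_prod 0 * (\<Sum>k=1..3. Z (hp k)) * (p 0 * S (0 + \<alpha>)))) (at 0)"
      by (intro DERIV_cmult DERIV_mult 1 2 dS alpha_off)
    moreover have "Bf = (\<lambda>x. c * (p x * S (x + \<alpha>) * half_prod x))" by (rule ext) (rule Beq)
    ultimately have "deriv Bf 0 = Bf 0 * ?z"
      using DERIV_imp_deriv by (simp add: Beq algebra_simps)
    moreover have "\<beta> 0 = Bf 0" "\<beta> 1 = deriv Bf 0" using \<beta>[of 0] \<beta>[of 1] by simp_all
    ultimately have "\<beta> 1 / \<beta> 0 = ?z" using B0 by simp
    thus ?thesis by (simp add: kappa_eq kappa_bar_def kappa_const_def)
  qed
  define U where "U = (\<lambda>x. x + \<alpha>) -` (- Lat)"
  have U: "open U" "0 \<in> U"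
    using closed_Lat alpha_off unfolding U_def
    by (auto intro!: continuous_open_vimage continuous_intros simp: open_closed)
  \<comment> \<open>The number \<open>offset\<close>, about which nothing is known, enters f only as
    a constant and disappears from f' and f''.\<close>
  define f where "f x = 2 * (offset - Z (x + \<alpha>))" for x
  have df: "(f has_field_derivative 2 * P (x + \<alpha>)) (at x)" if "x \<in> U" for x
  proof -
    have "((\<lambda>x. Z (x + \<alpha>)) has_field_derivative - P (x + \<alpha>) * 1) (at x)"
      by (rule DERIV_chain2[of Z], rule wzeta_derivative) (use that in \<open>auto intro!: derivative_eq_intros simp: U_def\<close>)
    from DERIV_cmult[OF DERIV_diff[OF DERIV_const[of offset] this], of 2] show ?thesis
      unfolding f_def[abs_def] by simp
  qed
  have f: "f holomorphic_on U" unfolding holomorphic_on_open[OF U(1)] using df by blast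
  have VB: "Vf x = Bf x * (2 * deriv S x + S x * f x)" if "x \<in> U" for x
  proof -
    have "deriv S (x + \<alpha>) = S (x + \<alpha>) * Z (x + \<alpha>)" by (rule wsigma_deriv_eq) (use that in \<open>simp add: U_def\<close>)
    thus ?thesis unfolding Veq Beq f_def by (simp add: algebra_simps)
  qed
  have d1: "deriv f x = 2 * P (x + \<alpha>)" if "x \<in> U" for x by (rule DERIV_imp_deriv[OF df[OF that]])
  have d2: "(deriv ^^ 2) f 0 = 2 * deriv P \<alpha>"
  proof -
    have "deriv (deriv f) 0 = deriv (\<lambda>x. 2 * P (x + \<alpha>)) 0" by (rule deriv_eq_on_open[OF U d1])
    moreover have "((\<lambda>x. P (x + \<alpha>)) has_field_derivative deriv P (0 + \<alpha>) * 1) (at 0)"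
      by (rule DERIV_chain2[of P], rule wp_derivative') (use alpha_off in \<open>auto intro!: derivative_eq_intros\<close>)
    from DERIV_imp_deriv[OF DERIV_cmult[OF this, of 2]] have "deriv (\<lambda>x. 2 * P (x + \<alpha>)) 0 = 2 * deriv P \<alpha>" by simp
    ultimately show ?thesis by (simp add: numeral_2_eq_2)
  qed
  have \<beta>': "(\<lambda>n. (deriv ^^ n) Bf 0) = \<beta>" and w': "(\<lambda>n. (deriv ^^ n) Vf 0) = w"
    by (rule ext, rule \<beta>) (rule ext, rule w)
  note td = taylor_division[OF U f Bhol B0 Vhol VB, unfolded \<beta>' w']
  have "factor_1 \<beta> w = 2 * P \<alpha>" "factor_2 \<beta> w = 2 * deriv P \<alpha>"
    using td d1[OF U(2)] d2 by simp_all
  thus "P \<alpha> = factor_1 \<beta> w / 2" "deriv P \<alpha> = factor_2 \<beta> w / 2" by simp_all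
qed

end

section \<open>The change of sign of s and t, and the rational formulas\<close>

context finite_gap_data
begin

definition admissible :: "(complex \<times> complex \<times> (nat \<Rightarrow> complex)) set" where
  "admissible = {(E, s, t). poly Q E \<noteq> 0 \<and> s ^ 2 = - poly Q E \<and> is_zero_system \<omega>1 \<omega>3 l c0 b E s t \<and>
     alpha \<omega>1 \<omega>3 l t \<notin> Lat}"

lemma admissibleD:
  assumes "(E, s, t) \<in> admissible"
  shows "s ^ 2 = - poly Q E" "zero_system_off \<omega>1 \<omega>3 l c0 b E s t"
proof -
  show "s ^ 2 = - poly Q E" using assms by (simp add: admissible_def)
  show "zero_system_off \<omega>1 \<omega>3 l c0 b E s t"
    by unfold_locales (use assms in \<open>auto simp: admissible_def\<close>)
qed

lemma double_half_sum: "2 * (\<Sum>k=1..3. of_nat (l k) * hp k) \<in> Lat"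
proof -
  have "(\<Sum>k\<in>K. of_nat (l k) * (2 * hp k)) \<in> Lat" if "finite K" for K
    using that by (induction K rule: finite_induct) (auto intro!: Lat_add Lat_of_nat_mult two_half_period)
  from this[of "{1..3}"] show ?thesis by (simp add: sum_distrib_left mult_ac)
qed

text \<open>Only the zeros change sign, not the half periods, so alpha is negated up to twice a sum
  of half periods, which is a period by \<open>double_half_sum\<close>.\<close>

lemma alpha_uminus:
  "alpha \<omega>1 \<omega>3 l (\<lambda>j. - t j) = - alpha \<omega>1 \<omega>3 l t + 2 * (\<Sum>k=1..3. of_nat (l k) * hp k)"
  by (simp add: alpha_def sum_negf)

lemma zero_system_uminus:
  assumes z: "is_zero_system \<omega>1 \<omega>3 l c0 b E s t"
  shows "is_zero_system \<omega>1 \<omega>3 l c0 b E (- s) (\<lambda>j. - t j)"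
proof -
  have off: "t j \<notin> Hpts" if "j \<in> {1..L}" for j using z that unfolding is_zero_system_def by blast
  have sum: "t i + t j \<notin> Lat" if "i \<in> {1..L}" "j \<in> {1..L}" for i j using z that unfolding is_zero_system_def by blast
  have diff: "t i - t j \<notin> Lat" if "i \<in> {1..L}" "j \<in> {1..L}" "i \<noteq> j" for i j using z that unfolding is_zero_system_def by blast
  have R: "Xi_rational \<omega>1 \<omega>3 l C (\<lambda>j. - t j) = Xi_rational \<omega>1 \<omega>3 l C t" for C
    by (rule ext) (simp add: Xi_rational_def)
  obtain C where C: "C \<noteq> 0" "\<forall>x. x \<notin> Hpts \<longrightarrow> X E x = Xi_rational \<omega>1 \<omega>3 l C t (P x)"
    "\<forall>j\<in>{1..L}. deriv (Xi_rational \<omega>1 \<omega>3 l C t) (P (t j)) = - 2 * s / deriv P (t j)"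
    using z unfolding is_zero_system_def by (elim conjE exE)
  have "deriv (Xi_rational \<omega>1 \<omega>3 l C (\<lambda>j. - t j)) (P (- t j)) = - 2 * (- s) / deriv P (- t j)" if "j \<in> {1..L}" for j
    unfolding R using C(3) that wp_deriv_uminus[OF Hpts_Lat[OF off[OF that]]] by simp
  moreover have "- t i + - t j \<notin> Lat" if "i \<in> {1..L}" "j \<in> {1..L}" for i j
    using sum[OF that] Lat_uminus_iff[of "t i + t j"] by simp
  moreover have "- t i - - t j \<notin> Lat" if "i \<in> {1..L}" "j \<in> {1..L}" "i \<noteq> j" for i j
    using diff[OF that(2,1)] that(3) by simp
  ultimately show ?thesis
    unfolding is_zero_system_def using C(1,2) off R by (intro conjI ballI impI exI[of _ C]) auto
qed

lemma admissible_uminus: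
  assumes "(E, s, t) \<in> admissible"
  shows "(E, - s, \<lambda>j. - t j) \<in> admissible"
proof -
  have "alpha \<omega>1 \<omega>3 l (\<lambda>j. - t j) \<notin> Lat"
    using assms double_half_sum unfolding alpha_uminus admissible_def by (simp only: Lat_add_iff) simp
  thus ?thesis using assms zero_system_uminus by (simp add: admissible_def)
qed

sublocale ext: root_extension admissible Q "\<lambda>t j. - t j"
  by unfold_locales (auto simp: admissibleD(1) admissible_uminus)

lemma wp_alpha_uminus:
  assumes "(E, s, t) \<in> admissible"
  shows "P (alpha \<omega>1 \<omega>3 l (\<lambda>j. - t j)) = P (alpha \<omega>1 \<omega>3 l t)"
    "deriv P (alpha \<omega>1 \<omega>3 l (\<lambda>j. - t j)) = - deriv P (alpha \<omega>1 \<omega>3 l t)"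
proof -
  have a: "alpha \<omega>1 \<omega>3 l t \<notin> Lat" using assms by (simp add: admissible_def)
  hence a': "- alpha \<omega>1 \<omega>3 l t \<notin> Lat" by simp
  show "P (alpha \<omega>1 \<omega>3 l (\<lambda>j. - t j)) = P (alpha \<omega>1 \<omega>3 l t)"
    unfolding alpha_uminus wp_periodic[OF double_half_sum a'] by simp
  show "deriv P (alpha \<omega>1 \<omega>3 l (\<lambda>j. - t j)) = - deriv P (alpha \<omega>1 \<omega>3 l t)"
    unfolding alpha_uminus wp_deriv_periodic'[OF a' double_half_sum] by (rule wp_deriv_uminus[OF a])
qed

text \<open>The period by which the new alpha deviates from the negated one adds twice the sum of
  the \<open>l k\<close> eta_k to zeta. Together with the unchanged eta terms of
  \<open>kappa_bar\<close> this is exactly what makes kappa odd.\<close>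

lemma kappa_uminus:
  assumes "(E, s, t) \<in> admissible"
  shows "kappa \<omega>1 \<omega>3 l (\<lambda>j. - t j) = - kappa \<omega>1 \<omega>3 l t"
proof -
  have a: "- alpha \<omega>1 \<omega>3 l t \<notin> Lat" using assms by (simp add: admissible_def)
  \<comment> \<open>The multiples of each 2 \<open>hp k\<close> are added one at a time, so that
    every intermediate argument stays off the lattice, as \<open>wzeta_add\<close> demands, and each
    increment is 2 eta_k.\<close>
  have "Z (- y + (\<Sum>k\<in>K. of_nat (l k) * (2 * hp k))) = - Z y + (\<Sum>k\<in>K. of_nat (l k) * (2 * eta_val \<omega>1 \<omega>3 k))"
    if "finite K" "K \<subseteq> {1..3}" "y \<notin> Lat" for K y
    using that(1,2)
  proof (induction K rule: finite_induct)
    case (insert k K)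
    have mult: "Z (x + of_nat n * (2 * hp k)) = Z x + of_nat n * (2 * eta_val \<omega>1 \<omega>3 k)" if x: "x \<notin> Lat" for x n
    proof (induction n)
      case (Suc n)
      have "x + of_nat n * (2 * hp k) \<notin> Lat" using x by (simp add: Lat_of_nat_mult two_half_period)
      from wzeta_add[OF two_half_period[of k] this] Suc qa_double[OF half_period_notin two_half_period, of k] insert.prems
      show ?case by (simp add: eta_val_def algebra_simps)
    qed simp
    have "(\<Sum>k\<in>K. of_nat (l k) * (2 * hp k)) \<in> Lat"
      using insert.hyps(1) by (induction K rule: finite_induct) (auto intro!: Lat_add Lat_of_nat_mult two_half_period)
    hence "- y + (\<Sum>k\<in>K. of_nat (l k) * (2 * hp k)) \<notin> Lat" using \<open>y \<notin> Lat\<close> by simp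
    note step = mult[OF this, of "l k"]
    have e: "- y + (\<Sum>k\<in>insert k K. of_nat (l k) * (2 * hp k)) =
        - y + (\<Sum>k\<in>K. of_nat (l k) * (2 * hp k)) + of_nat (l k) * (2 * hp k)"
      using insert.hyps by simp
    show ?case unfolding e step using insert by simp
  qed simp
  from this[of "{1..3}" "alpha \<omega>1 \<omega>3 l t"] a
  have "Z (alpha \<omega>1 \<omega>3 l (\<lambda>j. - t j)) = - Z (alpha \<omega>1 \<omega>3 l t) + 2 * (\<Sum>k=1..3. of_nat (l k) * eta_val \<omega>1 \<omega>3 k)"
    unfolding alpha_uminus sum_distrib_left by (simp add: mult.left_commute)
  thus ?thesis by (simp add: kappa_eq kappa_bar_def sum_negf)
qed

lemma rat_weight: "ext.rat (\<lambda>E s t. weight k s p)"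
  unfolding weight_def by (cases "is_odd p = k") (auto intro: ext.rat_root ext.rat_const)

text \<open>The rows involve neither s nor t, so one polynomial vector can be chosen for all
  admissible E. By \<open>kernel_unique\<close>, whatever its values are, it yields nonzero
  multiples of \<open>G0\<close> and \<open>T0\<close> at each admissible (E, s, t).\<close>

lemma kernel_polynomials:
  "\<exists>w. \<forall>E s t. (E, s, t) \<in> admissible \<longrightarrow>
     (let \<beta> = G_taylor (\<lambda>i. poly (w i) E) s; v = V_taylor (\<lambda>i. poly (w i) E) s in
       \<beta> 0 \<noteq> 0 \<and> kappa \<omega>1 \<omega>3 l t = kappa_const - \<beta> 1 / \<beta> 0 \<and>
       P (alpha \<omega>1 \<omega>3 l t) = factor_1 \<beta> v / 2 \<and> deriv P (alpha \<omega>1 \<omega>3 l t) = factor_2 \<beta> v / 2)"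
proof -
  have "\<exists>w. \<forall>E\<in>{E. \<exists>s t. (E, s, t) \<in> admissible}. (\<exists>i\<in>unknowns. poly (w i) E \<noteq> 0) \<and>
      (\<forall>r\<in>(- Hpts) \<times> UNIV. (\<Sum>i\<in>unknowns. poly (xi_row r i) E * poly (w i) E) = 0)"
  proof (rule polynomial_kernel_everywhere[OF finite_unknowns])
    fix E assume "E \<in> {E. \<exists>s t. (E, s, t) \<in> admissible}"
    then obtain s t where st: "(E, s, t) \<in> admissible" by blast
    interpret zero_system_off \<omega>1 \<omega>3 l c0 b Q E s t by (rule admissibleD(2)[OF st])
    show "\<exists>v. (\<exists>i\<in>unknowns. v i \<noteq> 0) \<and> (\<forall>r\<in>(- Hpts) \<times> UNIV. (\<Sum>i\<in>unknowns. poly (xi_row r i) E * v i) = 0)"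
      by (rule kernel_exists[OF admissibleD(1)[OF st]])
  qed
  then obtain w where w: "\<forall>E\<in>{E. \<exists>s t. (E, s, t) \<in> admissible}. (\<exists>i\<in>unknowns. poly (w i) E \<noteq> 0) \<and>
      (\<forall>r\<in>(- Hpts) \<times> UNIV. (\<Sum>i\<in>unknowns. poly (xi_row r i) E * poly (w i) E) = 0)" ..
  show ?thesis
  proof (intro exI[of _ w] allI impI)
    fix E s t assume st: "(E, s, t) \<in> admissible"
    interpret zero_system_off \<omega>1 \<omega>3 l c0 b Q E s t by (rule admissibleD(2)[OF st])
    have w': "\<exists>i\<in>unknowns. poly (w i) E \<noteq> 0"
      "\<forall>r\<in>(- Hpts) \<times> UNIV. (\<Sum>i\<in>unknowns. poly (xi_row r i) E * poly (w i) E) = 0" using w st by blast+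
    obtain c where c: "c \<noteq> 0" "\<forall>x. x \<notin> Hpts \<longrightarrow> comb True G_order (\<lambda>p. poly (w (Inl p)) E) s x = c * G0 x"
      "\<forall>x. x \<notin> Hpts \<longrightarrow> comb False T_order (\<lambda>p. poly (w (Inr p)) E) s x = c * T0 offset x"
      using kernel_unique[OF admissibleD(1)[OF st] w'] by (elim exE conjE)
    show "let \<beta> = G_taylor (\<lambda>i. poly (w i) E) s; v = V_taylor (\<lambda>i. poly (w i) E) s in
       \<beta> 0 \<noteq> 0 \<and> kappa \<omega>1 \<omega>3 l t = kappa_const - \<beta> 1 / \<beta> 0 \<and>
       P (alpha \<omega>1 \<omega>3 l t) = factor_1 \<beta> v / 2 \<and> deriv P (alpha \<omega>1 \<omega>3 l t) = factor_2 \<beta> v / 2"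
      unfolding Let_def by (intro conjI taylor_reading[OF c])
  qed
qed

lemma spectral_rationality:
  "\<exists>P1 P2 P3 P4 P5 P6 :: complex poly. P2 \<noteq> 0 \<and> P4 \<noteq> 0 \<and> P6 \<noteq> 0 \<and>
     (\<forall>E s t. (E, s, t) \<in> admissible \<longrightarrow>
        poly P2 E \<noteq> 0 \<and> poly P4 E \<noteq> 0 \<and> poly P6 E \<noteq> 0 \<and>
        P (alpha \<omega>1 \<omega>3 l t) = poly P1 E / poly P2 E \<and>
        deriv P (alpha \<omega>1 \<omega>3 l t) = poly P3 E / poly P4 E * s \<and>
        kappa \<omega>1 \<omega>3 l t = poly P5 E / poly P6 E * s)"
proof -
  obtain w where "\<forall>E s t. (E, s, t) \<in> admissible \<longrightarrow>
     (let \<beta> = G_taylor (\<lambda>i. poly (w i) E) s; v = V_taylor (\<lambda>i. poly (w i) E) s in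
       \<beta> 0 \<noteq> 0 \<and> kappa \<omega>1 \<omega>3 l t = kappa_const - \<beta> 1 / \<beta> 0 \<and>
       P (alpha \<omega>1 \<omega>3 l t) = factor_1 \<beta> v / 2 \<and> deriv P (alpha \<omega>1 \<omega>3 l t) = factor_2 \<beta> v / 2)"
    using kernel_polynomials ..
  note w = this[unfolded Let_def, rule_format]
  let ?\<beta> = "\<lambda>E s. G_taylor (\<lambda>i. poly (w i) E) s" and ?v = "\<lambda>E s. V_taylor (\<lambda>i. poly (w i) E) s"
  have \<beta>: "ext.rat (\<lambda>E s t. ?\<beta> E s n)" for n
    unfolding G_taylor_def by (intro ext.rat_sum ext.rat_mult ext.rat_poly ext.rat_const rat_weight finite_indep_index)
  have v: "ext.rat (\<lambda>E s t. ?v E s n)" for n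
    unfolding V_taylor_def
    by (intro ext.rat_add ext.rat_sum ext.rat_mult ext.rat_poly ext.rat_const rat_weight finite_indep_index)
  note rules = ext.rat_diff ext.rat_mult ext.rat_const \<beta> v
  \<comment> \<open>Apart from numerical constants this is the only denominator in the
    formulas.\<close>
  have nz: "?\<beta> E s 0 \<noteq> 0" if "(E, s, t) \<in> admissible" for E s t using w[OF that] by blast
  have q1: "ext.rat (\<lambda>E s t. quotient_1 (?\<beta> E s) (?v E s))"
    unfolding quotient_1_def by (intro ext.rat_divide[OF _ \<beta> nz] rules)
  have q2: "ext.rat (\<lambda>E s t. quotient_2 (?\<beta> E s) (?v E s))"
    unfolding quotient_2_def by (intro ext.rat_divide[OF _ \<beta> nz] rules q1)
  have q3: "ext.rat (\<lambda>E s t. quotient_3 (?\<beta> E s) (?v E s))"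
    unfolding quotient_3_def by (intro ext.rat_divide[OF _ \<beta> nz] rules q1 q2)
  have half: "ext.rat F \<Longrightarrow> c \<noteq> 0 \<Longrightarrow> ext.rat (\<lambda>E s t. F E s t / c)" for F and c :: complex
    by (rule ext.rat_divide[OF _ ext.rat_const])
  have f0: "ext.rat (\<lambda>E s t. factor_0 (?\<beta> E s) (?v E s))"
    unfolding factor_0_def by (intro rules q1)
  have f1: "ext.rat (\<lambda>E s t. factor_1 (?\<beta> E s) (?v E s))"
    unfolding factor_1_def by (intro half rules q2 f0) simp
  have f2: "ext.rat (\<lambda>E s t. factor_2 (?\<beta> E s) (?v E s))"
    unfolding factor_2_def by (intro half rules q3 f0 f1) simp
  have "ext.rat (\<lambda>E s t. factor_1 (?\<beta> E s) (?v E s) / 2)" by (rule half[OF f1]) simp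
  hence "ext.rat (\<lambda>E s t. P (alpha \<omega>1 \<omega>3 l t))" by (rule ext.rat_cong) (use w in simp)
  hence "\<exists>p r. r \<noteq> 0 \<and> (\<forall>E s t. (E, s, t) \<in> admissible \<longrightarrow> poly r E \<noteq> 0 \<and> P (alpha \<omega>1 \<omega>3 l t) = poly p E / poly r E)"
    by (rule ext.rat_even) (erule wp_alpha_uminus)
  then obtain P1 P2 where
    1: "P2 \<noteq> 0" "\<forall>E s t. (E, s, t) \<in> admissible \<longrightarrow> poly P2 E \<noteq> 0 \<and> P (alpha \<omega>1 \<omega>3 l t) = poly P1 E / poly P2 E"
    by (elim exE conjE)
  have "ext.rat (\<lambda>E s t. factor_2 (?\<beta> E s) (?v E s) / 2)" by (rule half[OF f2]) simp
  hence "ext.rat (\<lambda>E s t. deriv P (alpha \<omega>1 \<omega>3 l t))" by (rule ext.rat_cong) (use w in simp)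
  hence "\<exists>p r. r \<noteq> 0 \<and> (\<forall>E s t. (E, s, t) \<in> admissible \<longrightarrow> poly r E \<noteq> 0 \<and> deriv P (alpha \<omega>1 \<omega>3 l t) = poly p E / poly r E * s)"
    by (rule ext.rat_odd) (erule wp_alpha_uminus)
  then obtain P3 P4 where
    2: "P4 \<noteq> 0" "\<forall>E s t. (E, s, t) \<in> admissible \<longrightarrow> poly P4 E \<noteq> 0 \<and> deriv P (alpha \<omega>1 \<omega>3 l t) = poly P3 E / poly P4 E * s"
    by (elim exE conjE)
  have "ext.rat (\<lambda>E s t. kappa_const - ?\<beta> E s 1 / ?\<beta> E s 0)" by (intro ext.rat_divide[OF _ \<beta> nz] rules)
  hence "ext.rat (\<lambda>E s t. kappa \<omega>1 \<omega>3 l t)" by (rule ext.rat_cong) (use w in simp)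
  hence "\<exists>p r. r \<noteq> 0 \<and> (\<forall>E s t. (E, s, t) \<in> admissible \<longrightarrow> poly r E \<noteq> 0 \<and> kappa \<omega>1 \<omega>3 l t = poly p E / poly r E * s)"
    by (rule ext.rat_odd) (erule kappa_uminus)
  then obtain P5 P6 where
    3: "P6 \<noteq> 0" "\<forall>E s t. (E, s, t) \<in> admissible \<longrightarrow> poly P6 E \<noteq> 0 \<and> kappa \<omega>1 \<omega>3 l t = poly P5 E / poly P6 E * s"
    by (elim exE conjE)
  show ?thesis
    by (rule exI[of _ P1], rule exI[of _ P2], rule exI[of _ P3], rule exI[of _ P4], rule exI[of _ P5], rule exI[of _ P6])
       (use 1 2 3 in blast)
qed

end

theorem theorem2p3:
  fixes \<omega>1 \<omega>3 :: complex and l :: "nat \<Rightarrow> nat"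
    and c0 :: "complex poly" and b :: "nat \<Rightarrow> nat \<Rightarrow> complex poly" and Q :: "complex poly"
  assumes periods: "\<omega>1 \<noteq> \<omega>3" "independent {2 * \<omega>1, 2 * \<omega>3}"
    and l_nonzero: "\<exists>i\<le>3. l i \<noteq> 0"
    and Xi: "is_Xi \<omega>1 \<omega>3 l c0 b"
    and Q: "is_Q \<omega>1 \<omega>3 l c0 b Q"
  shows
    "(\<forall>E s t. poly Q E \<noteq> 0 \<and> s ^ 2 = - poly Q E \<and> is_zero_system \<omega>1 \<omega>3 l c0 b E s t
        \<and> alpha \<omega>1 \<omega>3 l t \<notin> period_lattice \<omega>1 \<omega>3 \<longrightarrow>
        (\<exists>bt :: nat \<Rightarrow> nat \<Rightarrow> complex. \<forall>x. x \<notin> half_points \<omega>1 \<omega>3 \<longrightarrow>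
           Lambda_tilde \<omega>1 \<omega>3 l t x =
             exp (kappa \<omega>1 \<omega>3 l t * x) *
             (\<Sum>i\<le>3. \<Sum>j<l i. bt i j * (deriv ^^ j) (Phi \<omega>1 \<omega>3 i (alpha \<omega>1 \<omega>3 l t)) x)))
     \<and>
     (\<exists>P1 P2 P3 P4 P5 P6 :: complex poly. P2 \<noteq> 0 \<and> P4 \<noteq> 0 \<and> P6 \<noteq> 0 \<and>
        (\<forall>E s t. poly Q E \<noteq> 0 \<and> s ^ 2 = - poly Q E \<and> is_zero_system \<omega>1 \<omega>3 l c0 b E s t
           \<and> alpha \<omega>1 \<omega>3 l t \<notin> period_lattice \<omega>1 \<omega>3 \<longrightarrow>
           poly P2 E \<noteq> 0 \<and> poly P4 E \<noteq> 0 \<and> poly P6 E \<noteq> 0 \<and>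
           wp \<omega>1 \<omega>3 (alpha \<omega>1 \<omega>3 l t) = poly P1 E / poly P2 E \<and>
           deriv (wp \<omega>1 \<omega>3) (alpha \<omega>1 \<omega>3 l t) = poly P3 E / poly P4 E * s \<and>
           kappa \<omega>1 \<omega>3 l t = poly P5 E / poly P6 E * s))
     \<and>
     (\<forall>E s t. poly Q E \<noteq> 0 \<and> s ^ 2 = - poly Q E \<and> is_zero_system \<omega>1 \<omega>3 l c0 b E s t
        \<and> alpha \<omega>1 \<omega>3 l t \<in> period_lattice \<omega>1 \<omega>3 \<longrightarrow>
        (\<exists>t'. (\<forall>j\<in>{1..l_total l}. t' j - t j \<in> period_lattice \<omega>1 \<omega>3) \<and> alpha \<omega>1 \<omega>3 l t' = 0) \<and>
        (\<forall>t'. (\<forall>j\<in>{1..l_total l}. t' j - t j \<in> period_lattice \<omega>1 \<omega>3) \<and> alpha \<omega>1 \<omega>3 l t' = 0 \<longrightarrow>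
          (\<exists>(c :: complex) (ck :: nat \<Rightarrow> complex) (bb :: nat \<Rightarrow> nat \<Rightarrow> complex).
             \<forall>x. x \<notin> half_points \<omega>1 \<omega>3 \<longrightarrow>
               Lambda_tilde \<omega>1 \<omega>3 l t x =
                 exp (kappa_bar \<omega>1 \<omega>3 l t' * x) *
                 (c + (\<Sum>i\<le>3. \<Sum>j<l i - 1. bb i j *
                         (deriv ^^ j) (\<lambda>y. wp \<omega>1 \<omega>3 (y + half_period \<omega>1 \<omega>3 i)) x)
                    + (\<Sum>k=1..3. ck k * (deriv (wp \<omega>1 \<omega>3) x
                                        / (wp \<omega>1 \<omega>3 x - e_val \<omega>1 \<omega>3 k)))))))"
proof -
  interpret period_pair \<omega>1 \<omega>3 by unfold_locales (rule periods)+
  interpret finite_gap_data \<omega>1 \<omega>3 l c0 b Q by unfold_locales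
  have off: "t j \<notin> Lat" if "is_zero_system \<omega>1 \<omega>3 l c0 b E s t" "j \<in> {1..L}" for E s t j
    using that Hpts_Lat unfolding is_zero_system_def by blast
  \<comment> \<open>The normalisation of the zeros in part (b) needs a zero to shift.\<close>
  have "L > 0"
  proof -
    obtain i where "i \<in> {..3}" "l i \<noteq> 0" using l_nonzero by auto
    thus ?thesis unfolding l_total_def by (metis finite_atMost gr_zeroI sum_eq_0_iff)
  qed
  show ?thesis
  proof (intro conjI)
    show "\<forall>E s t. poly Q E \<noteq> 0 \<and> s ^ 2 = - poly Q E \<and> is_zero_system \<omega>1 \<omega>3 l c0 b E s t
        \<and> alpha \<omega>1 \<omega>3 l t \<notin> Lat \<longrightarrow>
        (\<exists>bt :: nat \<Rightarrow> nat \<Rightarrow> complex. \<forall>x. x \<notin> Hpts \<longrightarrow>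
           Lambda_tilde \<omega>1 \<omega>3 l t x = exp (kappa \<omega>1 \<omega>3 l t * x) *
             (\<Sum>i\<le>3. \<Sum>j<l i. bt i j * (deriv ^^ j) (Ph i (alpha \<omega>1 \<omega>3 l t)) x))"
    proof (intro allI impI, elim conjE)
      fix E s t
      assume z: "is_zero_system \<omega>1 \<omega>3 l c0 b E s t" and a: "alpha \<omega>1 \<omega>3 l t \<notin> Lat"
      show "\<exists>bt. \<forall>x. x \<notin> Hpts \<longrightarrow> Lambda_tilde \<omega>1 \<omega>3 l t x = exp (kappa \<omega>1 \<omega>3 l t * x) *
             (\<Sum>i\<le>3. \<Sum>j<l i. bt i j * (deriv ^^ j) (Ph i (alpha \<omega>1 \<omega>3 l t)) x)"
        by (rule Lambda_tilde_Phi_expansion[OF off[OF z] a])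
    qed
  next
    show "\<exists>P1 P2 P3 P4 P5 P6 :: complex poly. P2 \<noteq> 0 \<and> P4 \<noteq> 0 \<and> P6 \<noteq> 0 \<and>
        (\<forall>E s t. poly Q E \<noteq> 0 \<and> s ^ 2 = - poly Q E \<and> is_zero_system \<omega>1 \<omega>3 l c0 b E s t
           \<and> alpha \<omega>1 \<omega>3 l t \<notin> Lat \<longrightarrow>
           poly P2 E \<noteq> 0 \<and> poly P4 E \<noteq> 0 \<and> poly P6 E \<noteq> 0 \<and>
           P (alpha \<omega>1 \<omega>3 l t) = poly P1 E / poly P2 E \<and>
           deriv P (alpha \<omega>1 \<omega>3 l t) = poly P3 E / poly P4 E * s \<and>
           kappa \<omega>1 \<omega>3 l t = poly P5 E / poly P6 E * s)"
      using spectral_rationality unfolding admissible_def mem_Collect_eq prod.case .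
  next
    show "\<forall>E s t. poly Q E \<noteq> 0 \<and> s ^ 2 = - poly Q E \<and> is_zero_system \<omega>1 \<omega>3 l c0 b E s t
        \<and> alpha \<omega>1 \<omega>3 l t \<in> Lat \<longrightarrow>
        (\<exists>t'. (\<forall>j\<in>{1..L}. t' j - t j \<in> Lat) \<and> alpha \<omega>1 \<omega>3 l t' = 0) \<and>
        (\<forall>t'. (\<forall>j\<in>{1..L}. t' j - t j \<in> Lat) \<and> alpha \<omega>1 \<omega>3 l t' = 0 \<longrightarrow>
          (\<exists>(c :: complex) (ck :: nat \<Rightarrow> complex) (bb :: nat \<Rightarrow> nat \<Rightarrow> complex).
             \<forall>x. x \<notin> Hpts \<longrightarrow>
               Lambda_tilde \<omega>1 \<omega>3 l t x =
                 exp (kappa_bar \<omega>1 \<omega>3 l t' * x) *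
                 (c + (\<Sum>i\<le>3. \<Sum>j<l i - 1. bb i j * (deriv ^^ j) (\<lambda>y. P (y + hp i)) x)
                    + (\<Sum>k=1..3. ck k * (deriv P x / (P x - e_val \<omega>1 \<omega>3 k))))))"
    proof (intro allI impI conjI, goal_cases)
      case (1 E s t)
      thus ?case by (intro exists_normalised_zeros[OF \<open>L > 0\<close>]) simp
    next
      case (2 E s t t')
      hence z: "is_zero_system \<omega>1 \<omega>3 l c0 b E s t" and t': "\<forall>j\<in>{1..L}. t' j - t j \<in> Lat"
        and a: "alpha \<omega>1 \<omega>3 l t' = 0" by blast+
      show ?case by (rule Lambda_tilde_wp_expansion[OF off[OF z] bspec[OF t'] a])
    qed
  qed
qed

end
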